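(* Let $\mathfrak{A}$ be a finite-dimensional C$^*$-algebra and $\alpha\in\mathrm{Aut}(\mathfrak{A})$. Then the Voiculescu–Brown entropy satisfies $ht(\alpha)=0$, and the Möbius function $\mu$ is linearly disjoint from $(\mathfrak{A},\alpha)$.
   Context: $\mu$ is the Möbius function: $\mu(1)=1$, $\mu(n)=0$ if $n$ is not square-free, and $\mu(n)=(-1)^t$ if $n$ is a product of $t$ distinct primes. $\mathrm{Aut}(\mathfrak{A})$ is the group of $*$-automorphisms of $\mathfrak{A}$. For a C$^*$-algebra $\mathfrak{A}$ and $\alpha\in\mathrm{Aut}(\mathfrak{A})$, $\mu$ is linearly disjoint from $(\mathfrak{A},\alpha)$ if $\frac1N\sum_{n=1}^N\mu(n)\rho(\alpha^n(A))\to0$ as $N\to\infty$ for every state $\rho$ on $\mathfrak{A}$ and every $A\in\mathfrak{A}$. Voiculescu–Brown entropy: let $\mathfrak{A}$ be exact (equivalently, nuclearly embeddable), $\alpha$ an automorphism of $\mathfrak{A}$, and $\pi:\mathfrak{A}\to\mathcal{B}(\mathcal{H})$ a faithful $*$-representation. For a finite set $\Omega\subset\mathfrak{A}$ and $\delta>0$ let $CPA(\pi,\Omega,\delta)$ be the collection of triples $(\varphi,\psi,\mathfrak{B})$ where $\mathfrak{B}$ is a finite-dimensional C$^*$-algebra and $\varphi:\mathfrak{A}\to\mathfrak{B}$, $\psi:\mathfrak{B}\to\mathcal{B}(\mathcal{H})$ are contractive completely positive maps with $\|(\psi\circ\varphi)(a)-\pi(a)\|<\delta$ for all $a\in\Omega$.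 Let $rcp(\Omega,\delta)$ be the infimum of $\operatorname{rank}\mathfrak{B}$ over all such triples, where rank is the dimension of a maximal abelian C$^*$-subalgebra. Set $ht(\alpha,\Omega,\delta)=\limsup_{n\to\infty}\frac1n\log rcp(\Omega\cup\alpha\Omega\cup\cdots\cup\alpha^{n-1}\Omega,\delta)$, $ht(\alpha,\Omega)=\sup_{\delta>0}ht(\alpha,\Omega,\delta)$, and $ht(\alpha)=\sup_\Omega ht(\alpha,\Omega)$, the last supremum over all finite $\Omega\subset\mathfrak{A}$. (This does not depend on $\pi$.) *)

theory Defs
  imports
    "HOL-Analysis.Analysis"
    "HOL-Computational_Algebra.Squarefree"
    "HOL-Library.Function_Algebras"
begin

section \<open>C*-algebras\<close>

text \<open>
  The entropy below is an infimum over all finite-dimensional C*-algebras, so C*-algebras cannot be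
  a type class: they are structures on a carrier set. The carrier is a complex subspace of an
  ambient type that supplies addition and zero (\<^term>\<open>UNIV\<close> is allowed); scalar multiplication,
  product, involution and norm belong to the structure. Product, involution and norm are
  unconstrained outside the carrier. No unit is required, and the zero algebra is allowed.
\<close>

record 'a star_alg =
  carrier :: "'a set"
  scale :: "complex \<Rightarrow> 'a \<Rightarrow> 'a" (infixr "\<odot>\<index>" 75)
  mult :: "'a \<Rightarrow> 'a \<Rightarrow> 'a" (infixl "\<otimes>\<index>" 70)
  star :: "'a \<Rightarrow> 'a"
  nrm :: "'a \<Rightarrow> real"

locale cstar_algebra =
  fixes A :: "'a::ab_group_add star_alg" (structure)
  assumes vector_space: "vector_space (scale A)"
    and subspace: "module.subspace (scale A) (carrier A)"
    and mult_closed: "\<lbrakk>a \<in> carrier A; b \<in> carrier A\<rbrakk> \<Longrightarrow> a \<otimes> b \<in> carrier A"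
    and mult_assoc: "\<lbrakk>a \<in> carrier A; b \<in> carrier A; c \<in> carrier A\<rbrakk> \<Longrightarrow> (a \<otimes> b) \<otimes> c = a \<otimes> (b \<otimes> c)"
    and mult_add_left: "\<lbrakk>a \<in> carrier A; b \<in> carrier A; c \<in> carrier A\<rbrakk> \<Longrightarrow> (a + b) \<otimes> c = a \<otimes> c + b \<otimes> c"
    and mult_add_right: "\<lbrakk>a \<in> carrier A; b \<in> carrier A; c \<in> carrier A\<rbrakk> \<Longrightarrow> a \<otimes> (b + c) = a \<otimes> b + a \<otimes> c"
    and mult_scale_left: "\<lbrakk>a \<in> carrier A; b \<in> carrier A\<rbrakk> \<Longrightarrow> (z \<odot> a) \<otimes> b = z \<odot> (a \<otimes> b)"
    and mult_scale_right: "\<lbrakk>a \<in> carrier A; b \<in> carrier A\<rbrakk> \<Longrightarrow> a \<otimes> (z \<odot> b) = z \<odot> (a \<otimes> b)"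
    and star_closed: "a \<in> carrier A \<Longrightarrow> star A a \<in> carrier A"
    and star_star: "a \<in> carrier A \<Longrightarrow> star A (star A a) = a"
    and star_add: "\<lbrakk>a \<in> carrier A; b \<in> carrier A\<rbrakk> \<Longrightarrow> star A (a + b) = star A a + star A b"
    and star_scale: "a \<in> carrier A \<Longrightarrow> star A (z \<odot> a) = cnj z \<odot> star A a"
    and star_mult: "\<lbrakk>a \<in> carrier A; b \<in> carrier A\<rbrakk> \<Longrightarrow> star A (a \<otimes> b) = star A b \<otimes> star A a"
    and nrm_nonneg: "a \<in> carrier A \<Longrightarrow> 0 \<le> nrm A a"
    and nrm_eq_0_iff: "a \<in> carrier A \<Longrightarrow> nrm A a = 0 \<longleftrightarrow> a = 0"
    and nrm_triangle: "\<lbrakk>a \<in> carrier A; b \<in> carrier A\<rbrakk> \<Longrightarrow> nrm A (a + b) \<le> nrm A a + nrm A b"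
    and nrm_scale: "a \<in> carrier A \<Longrightarrow> nrm A (z \<odot> a) = cmod z * nrm A a"
    and nrm_mult: "\<lbrakk>a \<in> carrier A; b \<in> carrier A\<rbrakk> \<Longrightarrow> nrm A (a \<otimes> b) \<le> nrm A a * nrm A b"
    and cstar_identity: "a \<in> carrier A \<Longrightarrow> nrm A (star A a \<otimes> a) = (nrm A a)\<^sup>2"
    and complete: "\<lbrakk>\<And>n. f n \<in> carrier A;
        \<And>e. e > 0 \<Longrightarrow> \<exists>N. \<forall>m\<ge>N. \<forall>n\<ge>N. nrm A (f m - f n) < e\<rbrakk>
      \<Longrightarrow> \<exists>l\<in>carrier A. (\<lambda>n. nrm A (f n - l)) \<longlonglongrightarrow> 0"

definition finite_dimensional :: "'a::ab_group_add star_alg \<Rightarrow> bool" where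
  "finite_dimensional A \<longleftrightarrow> (\<exists>S. finite S \<and> module.span (scale A) S = carrier A)"

definition cstar_subalgebra :: "'a::ab_group_add set \<Rightarrow> 'a star_alg \<Rightarrow> bool" where
  "cstar_subalgebra D A \<longleftrightarrow> D \<subseteq> carrier A \<and> cstar_algebra (A\<lparr>carrier := D\<rparr>)"

definition abelian_subalgebra :: "'a::ab_group_add set \<Rightarrow> 'a star_alg \<Rightarrow> bool" where
  "abelian_subalgebra D A \<longleftrightarrow>
     cstar_subalgebra D A \<and> (\<forall>a\<in>D. \<forall>b\<in>D. mult A a b = mult A b a)"

definition maximal_abelian_subalgebra :: "'a::ab_group_add set \<Rightarrow> 'a star_alg \<Rightarrow> bool" where
  "maximal_abelian_subalgebra D A \<longleftrightarrow>
     abelian_subalgebra D A \<and> (\<forall>D'. abelian_subalgebra D' A \<and> D \<subseteq> D' \<longrightarrow> D' = D)"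

text \<open>
  In a finite-dimensional C*-algebra all maximal abelian C*-subalgebras have the same dimension,
  so the choice does not matter.
\<close>

definition rank_alg :: "'a::ab_group_add star_alg \<Rightarrow> nat" where
  "rank_alg A = vector_space.dim (scale A) (SOME D. maximal_abelian_subalgebra D A)"


section \<open>Maps between C*-algebras\<close>

definition linear_map :: "'a::ab_group_add star_alg \<Rightarrow> 'b::ab_group_add star_alg \<Rightarrow> ('a \<Rightarrow> 'b) \<Rightarrow> bool" where
  "linear_map A B f \<longleftrightarrow>
     f ` carrier A \<subseteq> carrier B \<and>
     (\<forall>a\<in>carrier A. \<forall>b\<in>carrier A. f (a + b) = f a + f b) \<and>
     (\<forall>z. \<forall>a\<in>carrier A. f (scale A z a) = scale B z (f a))"

definition star_hom :: "'a::ab_group_add star_alg \<Rightarrow> 'b::ab_group_add star_alg \<Rightarrow> ('a \<Rightarrow> 'b) \<Rightarrow> bool" where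
  "star_hom A B f \<longleftrightarrow>
     linear_map A B f \<and>
     (\<forall>a\<in>carrier A. \<forall>b\<in>carrier A. f (mult A a b) = mult B (f a) (f b)) \<and>
     (\<forall>a\<in>carrier A. f (star A a) = star B (f a))"

definition star_automorphism :: "'a::ab_group_add star_alg \<Rightarrow> ('a \<Rightarrow> 'a) \<Rightarrow> bool" where
  "star_automorphism A \<alpha> \<longleftrightarrow> star_hom A A \<alpha> \<and> bij_betw \<alpha> (carrier A) (carrier A)"

text \<open>
  Positivity of an element of $M_n(A)$: the matrix \<open>X\<close> equals $Y^* Y$ for some \<open>Y\<close> in $M_n(A)$,
  where $(Y^* Y)_{ij} = \sum_k Y_{ki}^* Y_{kj}$. Only the entries with indices below \<open>n\<close> matter.
\<close>

definition positive_matrix :: "'a::ab_group_add star_alg \<Rightarrow> nat \<Rightarrow> (nat \<Rightarrow> nat \<Rightarrow> 'a) \<Rightarrow> bool" where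
  "positive_matrix A n X \<longleftrightarrow>
     (\<exists>Y. (\<forall>i<n. \<forall>j<n. Y i j \<in> carrier A) \<and>
          (\<forall>i<n. \<forall>j<n. X i j = (\<Sum>k<n. mult A (star A (Y k i)) (Y k j))))"

definition completely_positive :: "'a::ab_group_add star_alg \<Rightarrow> 'b::ab_group_add star_alg \<Rightarrow> ('a \<Rightarrow> 'b) \<Rightarrow> bool" where
  "completely_positive A B f \<longleftrightarrow>
     linear_map A B f \<and>
     (\<forall>n X. positive_matrix A n X \<longrightarrow> positive_matrix B n (\<lambda>i j. f (X i j)))"

definition contractive :: "'a::ab_group_add star_alg \<Rightarrow> 'b::ab_group_add star_alg \<Rightarrow> ('a \<Rightarrow> 'b) \<Rightarrow> bool" where
  "contractive A B f \<longleftrightarrow> (\<forall>a\<in>carrier A. nrm B (f a) \<le> nrm A a)"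


section \<open>Complex Hilbert spaces and bounded operators\<close>

class complex_hilbert = banach +
  fixes scaleC :: "complex \<Rightarrow> 'a \<Rightarrow> 'a"
    and cinner :: "'a \<Rightarrow> 'a \<Rightarrow> complex"
  assumes scaleC_add_right: "scaleC z (x + y) = scaleC z x + scaleC z y"
    and scaleC_add_left: "scaleC (z + w) x = scaleC z x + scaleC w x"
    and scaleC_scaleC: "scaleC z (scaleC w x) = scaleC (z * w) x"
    and scaleC_of_real: "scaleC (complex_of_real r) x = scaleR r x"
    and cinner_add_left: "cinner (x + y) u = cinner x u + cinner y u"
    and cinner_scaleC_left: "cinner (scaleC z x) y = z * cinner x y"
    and cinner_commute: "cinner x y = cnj (cinner y x)"
    and cinner_self: "cinner x x = complex_of_real ((norm x)\<^sup>2)"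

text \<open>
  The type of bounded linear operators in the library consists of the real-linear ones; the
  carrier of \<open>bounded_operators\<close> selects the complex-linear operators.
\<close>

definition bounded_operators :: "('h::complex_hilbert \<Rightarrow>\<^sub>L 'h) star_alg" where
  "bounded_operators = \<lparr>
     carrier = {T. \<forall>z x. blinfun_apply T (scaleC z x) = scaleC z (blinfun_apply T x)},
     scale = (\<lambda>z T. Blinfun (\<lambda>x. scaleC z (blinfun_apply T x))),
     mult = blinfun_compose,
     star = (\<lambda>T. THE S. \<forall>x y. cinner (blinfun_apply S x) y = cinner x (blinfun_apply T y)),
     nrm = norm \<rparr>"

definition faithful_representation ::
    "'a::ab_group_add star_alg \<Rightarrow> ('a \<Rightarrow> 'h::complex_hilbert \<Rightarrow>\<^sub>L 'h) \<Rightarrow> bool" where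
  "faithful_representation A \<pi> \<longleftrightarrow> star_hom A bounded_operators \<pi> \<and> inj_on \<pi> (carrier A)"


section \<open>Voiculescu--Brown entropy\<close>

text \<open>
  Up to isomorphism, every finite-dimensional C*-algebra has as carrier a space of sequences
  supported on an initial segment. So quantifying over all C*-algebra structures on subspaces of
  the following type covers them all; note that scalar multiplication, product, involution and
  norm remain arbitrary.
\<close>

type_synonym fd_alg = "(nat \<Rightarrow> complex) star_alg"

definition CPA ::
    "'a::ab_group_add star_alg \<Rightarrow> ('a \<Rightarrow> 'h::complex_hilbert \<Rightarrow>\<^sub>L 'h) \<Rightarrow> 'a set \<Rightarrow> real \<Rightarrow>
     (('a \<Rightarrow> nat \<Rightarrow> complex) \<times> ((nat \<Rightarrow> complex) \<Rightarrow> 'h \<Rightarrow>\<^sub>L 'h) \<times> fd_alg) set" where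
  "CPA A \<pi> \<Omega> \<delta> = {(\<phi>, \<psi>, B).
     cstar_algebra B \<and> finite_dimensional B \<and>
     completely_positive A B \<phi> \<and> contractive A B \<phi> \<and>
     completely_positive B bounded_operators \<psi> \<and> contractive B bounded_operators \<psi> \<and>
     (\<forall>a\<in>\<Omega>. norm (\<psi> (\<phi> a) - \<pi> a) < \<delta>)}"

text \<open>The infimum of the empty set is \<open>\<infinity>\<close>.\<close>

definition rcp ::
    "'a::ab_group_add star_alg \<Rightarrow> ('a \<Rightarrow> 'h::complex_hilbert \<Rightarrow>\<^sub>L 'h) \<Rightarrow> 'a set \<Rightarrow> real \<Rightarrow> enat" where
  "rcp A \<pi> \<Omega> \<delta> = (INF (\<phi>, \<psi>, B)\<in>CPA A \<pi> \<Omega> \<delta>. enat (rank_alg B))"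

text \<open>
  The convention $\log 0 = 0$ matters only for the value \<open>rcp = 0\<close>, which occurs exactly when the
  zero algebra gives an admissible triple, that is, when \<open>\<pi>\<close> has norm less than \<open>\<delta>\<close> on \<open>\<Omega>\<close>. On a
  nonzero algebra the suprema over \<open>\<delta>\<close> and \<open>\<Omega>\<close> are therefore the same as with
  $\log 0 = -\infty$; the zero algebra gets entropy 0 rather than $-\infty$.
\<close>

definition log_enat :: "enat \<Rightarrow> ereal" where
  "log_enat r = (case r of enat m \<Rightarrow> if m = 0 then 0 else ereal (ln (real m)) | \<infinity> \<Rightarrow> \<infinity>)"

definition ht_set_delta ::
    "'a::ab_group_add star_alg \<Rightarrow> ('a \<Rightarrow> 'h::complex_hilbert \<Rightarrow>\<^sub>L 'h) \<Rightarrow> ('a \<Rightarrow> 'a) \<Rightarrow> 'a set \<Rightarrow> real \<Rightarrow> ereal" where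
  "ht_set_delta A \<pi> \<alpha> \<Omega> \<delta> =
     limsup (\<lambda>n. ereal (1 / real n) * log_enat (rcp A \<pi> (\<Union>i<n. (\<alpha> ^^ i) ` \<Omega>) \<delta>))"

definition ht_set ::
    "'a::ab_group_add star_alg \<Rightarrow> ('a \<Rightarrow> 'h::complex_hilbert \<Rightarrow>\<^sub>L 'h) \<Rightarrow> ('a \<Rightarrow> 'a) \<Rightarrow> 'a set \<Rightarrow> ereal" where
  "ht_set A \<pi> \<alpha> \<Omega> = (SUP \<delta>\<in>{0<..}. ht_set_delta A \<pi> \<alpha> \<Omega> \<delta>)"

definition ht ::
    "'a::ab_group_add star_alg \<Rightarrow> ('a \<Rightarrow> 'h::complex_hilbert \<Rightarrow>\<^sub>L 'h) \<Rightarrow> ('a \<Rightarrow> 'a) \<Rightarrow> ereal" where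
  "ht A \<pi> \<alpha> = (SUP \<Omega>\<in>{\<Omega>. finite \<Omega> \<and> \<Omega> \<subseteq> carrier A}. ht_set A \<pi> \<alpha> \<Omega>)"


section \<open>Linear disjointness from the Moebius function\<close>

definition moebius_mu :: "nat \<Rightarrow> int" where
  "moebius_mu n = (if squarefree n then (- 1) ^ card (prime_factors n) else 0)"

text \<open>
  A state is a positive linear functional of norm 1. The norm is a supremum in the extended reals,
  so it is \<open>\<infinity>\<close> for an unbounded functional.
\<close>

definition state :: "'a::ab_group_add star_alg \<Rightarrow> ('a \<Rightarrow> complex) \<Rightarrow> bool" where
  "state A \<rho> \<longleftrightarrow>
     (\<forall>a\<in>carrier A. \<forall>b\<in>carrier A. \<rho> (a + b) = \<rho> a + \<rho> b) \<and>
     (\<forall>z. \<forall>a\<in>carrier A. \<rho> (scale A z a) = z * \<rho> a) \<and>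
     (\<forall>a\<in>carrier A. \<rho> (mult A (star A a) a) \<in> \<real> \<and> 0 \<le> Re (\<rho> (mult A (star A a) a))) \<and>
     (SUP a\<in>{a \<in> carrier A. nrm A a \<le> 1}. ereal (cmod (\<rho> a))) = 1"

definition linearly_disjoint :: "(nat \<Rightarrow> int) \<Rightarrow> 'a::ab_group_add star_alg \<Rightarrow> ('a \<Rightarrow> 'a) \<Rightarrow> bool" where
  "linearly_disjoint f A \<alpha> \<longleftrightarrow>
     (\<forall>\<rho>. state A \<rho> \<longrightarrow> (\<forall>a\<in>carrier A.
        (\<lambda>N. (1 / of_nat N) * (\<Sum>n = 1..N. of_int (f n) * \<rho> ((\<alpha> ^^ n) a))) \<longlonglongrightarrow> 0))"

end

theory Submission
  imports
    Defs
    "HOL-Complex_Analysis.Complex_Analysis"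
    "HOL-Real_Asymp.Real_Asymp"
    "HOL-Number_Theory.Prime_Powers"
    "HOL-Number_Theory.Cong"
    "HOL-Computational_Algebra.Fundamental_Theorem_Algebra"
begin

text \<open>
  \<^bold>\<open>Entropy.\<close> A finite-dimensional algebra is its own approximation. Let \<open>\<phi>\<close> be an isomorphism of \<open>A\<close>
  onto a C*-algebra \<open>B\<close> of coordinate sequences. The triple \<open>(\<phi>, \<pi> \<circ> \<phi>\<inverse>, B)\<close> reproduces \<open>\<pi>\<close> exactly,
  so it is admissible for every finite set and every \<open>\<delta>\<close>; the numbers \<open>rcp\<close> are bounded by the rank
  of \<open>B\<close>, and dividing their logarithms by \<open>n\<close> leaves 0 (\<open>ht_eq_0\<close>). What has to be shown is that a
  *-homomorphism is completely positive, which is formal, and contractive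
  (\<open>star_hom_contractive\<close>). For the latter, all linear maps on a finite-dimensional normed space are
  bounded, say by \<open>K\<close>, and the C*-identity turns a bound for the powers \<open>(a\<^sup>* a)^(2^n)\<close> into a bound
  for \<open>a\<close> itself with \<open>K^(1/2^n)\<close> in place of \<open>K\<close>. The C*-identity for operators rests on the
  existence of adjoints, hence on the Riesz representation theorem.

  \<^bold>\<open>Disjointness.\<close> An automorphism \<open>\<alpha>\<close> and its inverse are contractive, so \<open>\<alpha>\<close> is isometric. Its
  powers are therefore bounded, which rules out Jordan blocks and eigenvalues off the unit circle:
  every element is a finite sum of eigenvectors with unimodular eigenvalues (\<open>eigen_sum_all\<close>). Hence
  \<open>\<rho> (\<alpha>^n a)\<close> is a linear combination of sequences \<open>w^n\<close> with \<open>|w| = 1\<close>, and the claim becomes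
  Davenport's theorem that \<open>w^n\<close> has mean 0 against the Moebius function
  (\<open>davenport_moebius\<close>). Every \<open>w\<close> on the unit circle can occur, already for inner automorphisms of
  two by two matrices; the case \<open>w = 1\<close> is equivalent to the prime number theorem.

  If \<open>w\<close> is not a root of unity, the correlations of \<open>w^(pm)\<close> and \<open>w^(rm)\<close> for different primes
  \<open>p\<close>, \<open>r\<close> are geometric sums with a ratio different from 1, hence bounded, and Katai's criterion
  applies (\<open>katai_criterion\<close>). Its proof compares the Moebius function with its dilates by primes,
  using only the Turan-Kubilius variance bound and the divergence of the sum of \<open>1/p\<close>.

  If \<open>w\<close> is a root of unity, \<open>n \<mapsto> w^n\<close> is periodic. Once the common divisor of \<open>n\<close> and the period is
  fixed, it is a linear combination of Dirichlet characters \<open>\<chi>\<close>. The Dirichlet series with coefficients \<open>\<mu> \<chi>\<close> is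
  \<open>1 / L(s, \<chi>)\<close>. It extends analytically across the line \<open>Re s = 1\<close> because \<open>L\<close> continues to
  \<open>Re s > 0\<close> and does not vanish on that line (\<open>Lcont_nonzero\<close>), and Newman's Tauberian
  theorem (\<open>newman_tauberian\<close>) converts this into convergence of the sum of \<open>\<mu>(n) \<chi>(n) / n\<close>, from which
  the mean value 0 follows by partial summation. The non-vanishing is the inequality
  \<open>3 + 4 cos t + cos 2t \<ge> 0\<close> applied to logarithmic derivatives, except for real characters at
  \<open>s = 1\<close>, where Monsky's argument with a Lambert series is used
  (\<open>real_character_sum_nonzero\<close>).
\<close>

section \<open>Adjoints on a complex Hilbert space\<close>

lemma cinner_add_right: "cinner x (y + z :: 'h::complex_hilbert) = cinner x y + cinner x z"
  by (subst (1 2 3) cinner_commute) (simp add: cinner_add_left)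

lemma cinner_scaleC_right: "cinner x (scaleC z y :: 'h::complex_hilbert) = cnj z * cinner x y"
  by (subst (1 2) cinner_commute) (simp add: cinner_scaleC_left)

lemma cinner_scaleR_left: "cinner (r *\<^sub>R x) (y :: 'h::complex_hilbert) = of_real r * cinner x y"
  by (simp add: scaleC_of_real[symmetric] cinner_scaleC_left)

lemma cinner_minus_left: "cinner (- x) (y :: 'h::complex_hilbert) = - cinner x y"
  using cinner_scaleR_left[of "-1" x y] by simp

lemma cinner_diff_left: "cinner (x - z) (y :: 'h::complex_hilbert) = cinner x y - cinner z y"
  using cinner_add_left[of x "-z" y] by (simp add: cinner_minus_left)

lemma Re_cinner_commute: "Re (cinner x y) = Re (cinner y (x :: 'h::complex_hilbert))"
  by (subst cinner_commute) simp

lemma norm_add_square: "(norm (x + y :: 'h::complex_hilbert))\<^sup>2 = (norm x)\<^sup>2 + (norm y)\<^sup>2 + 2 * Re (cinner x y)"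
proof -
  have "(norm (x + y))\<^sup>2 = Re (cinner (x + y) (x + y))" by (simp add: cinner_self)
  also have "\<dots> = Re (cinner x x) + Re (cinner y y) + Re (cinner x y) + Re (cinner y x)"
    by (simp add: cinner_add_left cinner_add_right)
  also have "\<dots> = (norm x)\<^sup>2 + (norm y)\<^sup>2 + 2 * Re (cinner x y)"
    using Re_cinner_commute[of y x] by (simp add: cinner_self)
  finally show ?thesis .
qed

lemma Re_cinner_le: "Re (cinner x (y :: 'h::complex_hilbert)) \<le> norm x * norm y"
proof -
  have "(norm (x + y))\<^sup>2 \<le> (norm x + norm y)\<^sup>2" by (intro power_mono norm_triangle_ineq) simp
  thus ?thesis by (simp add: norm_add_square power2_sum)
qed

lemma norm_scaleC: "norm (scaleC z x :: 'h::complex_hilbert) = cmod z * norm x"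
proof -
  have "complex_of_real ((norm (scaleC z x))\<^sup>2) = z * (cnj z * cinner x x)"
    unfolding cinner_self[symmetric] by (simp add: cinner_scaleC_left cinner_scaleC_right)
  also have "\<dots> = complex_of_real ((cmod z * norm x)\<^sup>2)"
    using complex_norm_square[of z] by (simp add: cinner_self power_mult_distrib)
  finally have "(norm (scaleC z x))\<^sup>2 = (cmod z * norm x)\<^sup>2" by (simp only: of_real_eq_iff)
  thus ?thesis by (simp add: power2_eq_iff_nonneg)
qed

lemma cinner_ext:
  fixes u v :: "'h::complex_hilbert"
  assumes "\<And>y. Re (cinner u y) = Re (cinner v y)"
  shows "u = v"
proof -
  have "Re (cinner (u - v) (u - v)) = 0" using assms[of "u - v"] by (simp add: cinner_diff_left)
  thus ?thesis by (simp add: cinner_self)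
qed

text \<open>
  The linear term of a quadratic polynomial that is nonnegative on the line and vanishes at 0 is zero.
\<close>

lemma quadratic_nonneg_imp_zero:
  fixes A c :: real
  assumes A: "A \<ge> 0" and nn: "\<And>t. t\<^sup>2 * A + 2 * t * c \<ge> 0"
  shows "c = 0"
proof -
  \<comment> \<open>At this \<open>t\<close> the polynomial equals \<open>- t\<^sup>2 (A + 2)\<close>.\<close>
  define t where "t = - c / (A + 1)"
  have c: "c = - (t * (A + 1))" using A by (simp add: t_def)
  have "t\<^sup>2 * A + 2 * t * c = - (t\<^sup>2 * (A + 2))" unfolding c by (simp add: power2_eq_square algebra_simps)
  hence "t\<^sup>2 * (A + 2) \<le> 0" using nn[of t] by linarith
  hence "t = 0" using A by (simp add: mult_le_0_iff)
  thus ?thesis unfolding c by simp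
qed

text \<open>
  The representing vector is the minimiser of \<open>\<parallel>y\<parallel>\<^sup>2 - 2 f y\<close>. By the parallelogram law this functional
  is uniformly convex, so minimising sequences are Cauchy; vanishing of the first variation at the
  minimiser is the asserted identity. Working with real parts keeps the variation one-dimensional.
\<close>

theorem riesz_real:
  fixes f :: "'h::complex_hilbert \<Rightarrow> real"
  assumes f: "bounded_linear f"
  obtains y where "\<And>x. f x = Re (cinner x y)"
proof -
  interpret f: bounded_linear f by fact
  define J where "J y = (norm y)\<^sup>2 - 2 * f y" for y :: 'h
  obtain K where K: "\<And>x. \<bar>f x\<bar> \<le> norm x * K" using f.bounded by auto
  have bdd: "bdd_below (range J)"
  proof (rule bdd_belowI2)
    fix y :: 'h
    have "0 \<le> (norm y - K)\<^sup>2" by simp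
    thus "- K\<^sup>2 \<le> J y" using K[of y] by (simp add: J_def power2_diff algebra_simps abs_le_iff)
  qed
  define m where "m = (INF y. J y)"
  have mle: "m \<le> J y" for y unfolding m_def by (rule cINF_lower[OF bdd]) simp
  have "\<exists>y :: 'h. J y < m + 1 / real (Suc n)" for n
    using cINF_less_iff[OF _ bdd, of "m + 1 / real (Suc n)"] by (auto simp: m_def)
  then obtain y where y: "\<And>n. J (y n) < m + 1 / real (Suc n)" by metis
  \<comment> \<open>Uniform convexity: the midpoint of two near-minimisers cannot do better than \<open>m\<close>.\<close>
  have par: "(norm (a - b))\<^sup>2 \<le> 2 * (J a + J b - 2 * m)" for a b
  proof -
    let ?c = "(1/2) *\<^sub>R (a + b)"
    have "(norm ?c)\<^sup>2 = (norm (a + b))\<^sup>2 / 4" by (simp add: power_divide)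
    moreover have "f ?c = (f a + f b) / 2" by (simp add: f.scaleR f.add)
    moreover have "(norm (a + b))\<^sup>2 + (norm (a - b))\<^sup>2 = 2 * (norm a)\<^sup>2 + 2 * (norm b)\<^sup>2"
      using norm_add_square[of a b] norm_add_square[of a "-b"] cinner_minus_left[of b a]
        Re_cinner_commute[of a b] Re_cinner_commute[of a "-b"] by simp
    ultimately have "J a + J b - 2 * J ?c = (norm (a - b))\<^sup>2 / 2" by (simp add: J_def algebra_simps)
    thus ?thesis using mle[of ?c] by simp
  qed
  have "Cauchy y"
  proof (rule CauchyI)
    fix e :: real assume e: "e > 0"
    \<comment> \<open>Near-minimisers up to \<open>1/M\<close> have distance at most \<open>2 / \<surd>M\<close> by uniform convexity.\<close>
    obtain M :: nat where M: "4 / e\<^sup>2 < real M" using reals_Archimedean2 by blast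
    have M0: "0 < M" using M e by (intro Nat.gr0I) (auto simp: divide_less_0_iff)
    have "norm (y i - y j) < e" if "i \<ge> M" "j \<ge> M" for i j
    proof -
      have "1 / real (Suc i) \<le> 1 / real M" "1 / real (Suc j) \<le> 1 / real M"
        using that M0 by (auto intro!: divide_left_mono)
      hence "(norm (y i - y j))\<^sup>2 < 4 / real M" using par[of "y i" "y j"] y[of i] y[of j] by simp
      also have "4 / real M \<le> e\<^sup>2" using M M0 e by (simp add: field_simps)
      finally show ?thesis using e by (simp add: power2_less_imp_less)
    qed
    thus "\<exists>M. \<forall>m\<ge>M. \<forall>n\<ge>M. norm (y m - y n) < e" by blast
  qed
  then obtain y0 where y0: "y \<longlonglongrightarrow> y0" using Cauchy_convergent convergent_def by blast
  have "(\<lambda>n. J (y n)) \<longlonglongrightarrow> J y0"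
    unfolding J_def by (intro tendsto_intros y0 f.tendsto)
  moreover have "(\<lambda>n. m + 1 / real (Suc n)) \<longlonglongrightarrow> m + 0"
    by (intro tendsto_add tendsto_const LIMSEQ_Suc[OF lim_1_over_n])
  ultimately have Jy0: "J y0 \<le> m"
    using y by (intro LIMSEQ_le[of "\<lambda>n. J (y n)" "J y0" _ m]) (auto intro!: exI[of _ 0] less_imp_le simp: divide_inverse)
  have "f x = Re (cinner x y0)" for x
  proof -
    have "t\<^sup>2 * (norm x)\<^sup>2 + 2 * t * (Re (cinner x y0) - f x) \<ge> 0" for t
    proof -
      have "J (t *\<^sub>R x + y0) = t\<^sup>2 * (norm x)\<^sup>2 + 2 * t * (Re (cinner x y0) - f x) + J y0"
        using norm_add_square[of "t *\<^sub>R x" y0]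
        by (simp add: J_def f.add f.scaleR cinner_scaleR_left power_mult_distrib algebra_simps)
      thus ?thesis using mle[of "t *\<^sub>R x + y0"] Jy0 by linarith
    qed
    from quadratic_nonneg_imp_zero[OF _ this] show ?thesis by simp
  qed
  thus ?thesis using that by blast
qed

lemma bounded_linear_scaleC: "bounded_linear (scaleC z :: 'h::complex_hilbert \<Rightarrow> 'h)"
proof (rule bounded_linear_intro)
  show "scaleC z (r *\<^sub>R x) = r *\<^sub>R scaleC z x" for r :: real and x :: 'h
    by (simp add: scaleC_of_real[symmetric] scaleC_scaleC mult.commute)
  show "norm (scaleC z x) \<le> norm x * cmod z" for x :: 'h by (simp add: norm_scaleC mult.commute)
qed (rule scaleC_add_right)

lemma bounded_operators_scale: "blinfun_apply (scale bounded_operators z T) x = scaleC z (blinfun_apply T x)"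
proof -
  have "bounded_linear (\<lambda>x. scaleC z (blinfun_apply T x))"
    by (intro bounded_linear_compose[OF bounded_linear_scaleC] blinfun.bounded_linear_right)
  thus ?thesis by (simp add: bounded_operators_def bounded_linear_Blinfun_apply)
qed

lemma in_bounded_operators: "T \<in> carrier bounded_operators \<longleftrightarrow> (\<forall>z x. blinfun_apply T (scaleC z x) = scaleC z (blinfun_apply T x))"
  by (simp add: bounded_operators_def)

text \<open>
  Riesz is applied to the real part of \<open>y \<mapsto> \<langle>T y, x\<rangle>\<close>. Replacing \<open>y\<close> by \<open>\<i> y\<close> recovers the imaginary
  part, which is where complex linearity of \<open>T\<close> enters.
\<close>

lemma adjoint_exists:
  fixes T :: "'h::complex_hilbert \<Rightarrow>\<^sub>L 'h"
  assumes T: "T \<in> carrier bounded_operators"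
  obtains S where "S \<in> carrier bounded_operators" "\<And>x y. cinner (blinfun_apply S x) y = cinner x (blinfun_apply T y)"
proof -
  have "\<exists>s. \<forall>y. Re (cinner (T y) x) = Re (cinner y s)" for x
  proof -
    have "bounded_linear (\<lambda>y. Re (cinner (T y) x))"
    proof (rule bounded_linear_intro)
      show "norm (Re (cinner (T y) x)) \<le> norm y * (norm T * norm x)" for y
      proof -
        have "\<bar>Re (cinner (T y) x)\<bar> \<le> norm (T y) * norm x"
          using Re_cinner_le[of "T y" x] Re_cinner_le[of "- T y" x] by (auto simp: cinner_minus_left abs_le_iff)
        also have "\<dots> \<le> (norm T * norm y) * norm x" by (intro mult_right_mono norm_blinfun) simp
        finally show ?thesis by (simp add: mult_ac)
      qed
    qed (auto simp: blinfun.add_right blinfun.scaleR_right cinner_add_left cinner_scaleR_left)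
    from riesz_real[OF this] show ?thesis by blast
  qed
  then obtain s where s: "\<And>x y. Re (cinner (T y) x) = Re (cinner y (s x))" by metis
  have cs: "cinner (T y) x = cinner y (s x)" for x y
  proof (rule complex_eqI)
    show "Re (cinner (T y) x) = Re (cinner y (s x))" by (rule s)
    have "Re (cinner (T (scaleC \<i> y)) x) = Re (cinner (scaleC \<i> y) (s x))" by (rule s)
    thus "Im (cinner (T y) x) = Im (cinner y (s x))" using T by (simp add: in_bounded_operators cinner_scaleC_left)
  qed
  have cs': "cinner (s x) y = cinner x (T y)" for x y
    by (subst (1 2) cinner_commute) (simp add: cs)
  have add: "s (x + y) = s x + s y" for x y
    by (rule cinner_ext) (simp add: cs' cinner_add_left)
  have sc: "s (scaleC z x) = scaleC z (s x)" for z x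
    by (rule cinner_ext) (simp add: cs' cinner_scaleC_left)
  have bd: "norm (s x) \<le> norm x * norm T" for x
  proof -
    have "(norm (s x))\<^sup>2 = Re (cinner (s x) (s x))" by (simp add: cinner_self)
    also have "\<dots> = Re (cinner x (T (s x)))" by (simp add: cs')
    also have "\<dots> \<le> norm x * norm (T (s x))" by (rule Re_cinner_le)
    also have "\<dots> \<le> norm x * (norm T * norm (s x))" by (intro mult_left_mono norm_blinfun) simp
    finally have "norm (s x) * norm (s x) \<le> (norm x * norm T) * norm (s x)" by (simp add: power2_eq_square mult_ac)
    thus ?thesis by (cases "norm (s x) = 0") (auto simp: mult_le_cancel_right)
  qed
  have lin: "bounded_linear s"
  proof (rule bounded_linear_intro)
    show "s (r *\<^sub>R x) = r *\<^sub>R s x" for r x using sc[of "of_real r" x] by (simp add: scaleC_of_real)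
  qed (use add bd in auto)
  show ?thesis
    by (rule that[of "Blinfun s"]) (use lin sc cs' in \<open>auto simp: in_bounded_operators bounded_linear_Blinfun_apply\<close>)
qed

text \<open>
  The adjoint of the algebra of operators is given by a definite description, so it has its defining
  property only once existence and uniqueness are known.
\<close>

lemma star_bounded_operators:
  fixes T :: "'h::complex_hilbert \<Rightarrow>\<^sub>L 'h"
  assumes T: "T \<in> carrier bounded_operators"
  shows "star bounded_operators T \<in> carrier bounded_operators"
    and "cinner (blinfun_apply (star bounded_operators T) x) y = cinner x (blinfun_apply T y)"
proof -
  obtain S where S: "S \<in> carrier bounded_operators" "\<And>x y. cinner (blinfun_apply S x) y = cinner x (blinfun_apply T y)"
    using adjoint_exists[OF T] by blast
  have "star bounded_operators T = (THE S. \<forall>x y. cinner (blinfun_apply S x) y = cinner x (blinfun_apply T y))"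
    by (simp add: bounded_operators_def)
  also have "\<dots> = S"
  proof (rule the_equality)
    fix S' assume "\<forall>x y. cinner (blinfun_apply S' x) y = cinner x (blinfun_apply T y)"
    thus "S' = S" using S(2) by (intro blinfun_eqI cinner_ext) simp
  qed (use S in blast)
  finally show "star bounded_operators T \<in> carrier bounded_operators"
    "cinner (blinfun_apply (star bounded_operators T) x) y = cinner x (blinfun_apply T y)" using S by simp_all
qed

lemma star_bounded_operators_eqI:
  fixes T :: "'h::complex_hilbert \<Rightarrow>\<^sub>L 'h"
  assumes T: "T \<in> carrier bounded_operators"
    and S: "\<And>x y. cinner (blinfun_apply S x) y = cinner x (blinfun_apply T y)"
  shows "star bounded_operators T = S"
  by (intro blinfun_eqI cinner_ext) (simp add: S star_bounded_operators(2)[OF T])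

theorem cstar_algebra_bounded_operators: "cstar_algebra (bounded_operators :: ('h::complex_hilbert \<Rightarrow>\<^sub>L 'h) star_alg)"
proof -
  let ?B = "bounded_operators :: ('h \<Rightarrow>\<^sub>L 'h) star_alg"
  note sc = bounded_operators_scale and inB = in_bounded_operators and st = star_bounded_operators
  have m: "mult ?B = blinfun_compose" and n: "nrm ?B = norm" by (simp_all add: bounded_operators_def)
  have vs: "vector_space (scale ?B)"
    by unfold_locales
      (auto intro!: blinfun_eqI simp: sc scaleC_add_right scaleC_add_left scaleC_scaleC blinfun.add_left
         scaleC_of_real[of 1, simplified])
  interpret V: vector_space "scale ?B" by (rule vs)
  have z0: "scaleC z (0 :: 'h) = 0" for z
    using norm_scaleC[of z "0 :: 'h"] by simp
  have sub: "V.subspace (carrier ?B)"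
    by (auto simp: V.subspace_def inB blinfun.add_left sc scaleC_add_right scaleC_scaleC z0 mult.commute)
  have norm_st: "norm (star ?B T) \<le> norm T" if T: "T \<in> carrier ?B" for T
  proof (rule norm_blinfun_bound)
    fix x
    let ?s = "blinfun_apply (star ?B T) x"
    have "(norm ?s)\<^sup>2 = Re (cinner ?s ?s)" by (simp add: cinner_self)
    also have "\<dots> = Re (cinner x (T ?s))" by (simp add: st(2)[OF T])
    also have "\<dots> \<le> norm x * norm (T ?s)" by (rule Re_cinner_le)
    also have "\<dots> \<le> norm x * (norm T * norm ?s)" by (intro mult_left_mono norm_blinfun) simp
    finally have "norm ?s * norm ?s \<le> (norm T * norm x) * norm ?s" by (simp add: power2_eq_square mult_ac)
    thus "norm ?s \<le> norm T * norm x" by (cases "norm ?s = 0") (auto simp: mult_le_cancel_right)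
  qed simp
  \<comment> \<open>The C*-identity: \<open>\<parallel>T x\<parallel>\<^sup>2 = \<langle>T\<^sup>* T x, x\<rangle>\<close> gives the lower bound.\<close>
  have cst: "norm (blinfun_compose (star ?B T) T) = (norm T)\<^sup>2" if T: "T \<in> carrier ?B" for T
  proof (rule antisym)
    have "norm (blinfun_compose (star ?B T) T) \<le> norm (star ?B T) * norm T" by (rule norm_blinfun_compose)
    also have "\<dots> \<le> norm T * norm T" by (intro mult_right_mono norm_st T) simp
    finally show "norm (blinfun_compose (star ?B T) T) \<le> (norm T)\<^sup>2" by (simp add: power2_eq_square)
    let ?c = "norm (blinfun_compose (star ?B T) T)"
    have "norm T \<le> sqrt ?c"
    proof (rule norm_blinfun_bound)
      fix x
      have "(norm (T x))\<^sup>2 = Re (cinner (T x) (T x))" by (simp add: cinner_self)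
      also have "\<dots> = Re (cinner (blinfun_apply (blinfun_compose (star ?B T) T) x) x)" by (simp add: st(2)[OF T])
      also have "\<dots> \<le> norm (blinfun_apply (blinfun_compose (star ?B T) T) x) * norm x" by (rule Re_cinner_le)
      also have "\<dots> \<le> (?c * norm x) * norm x" by (intro mult_right_mono norm_blinfun) simp
      finally have "norm (T x) \<le> sqrt (?c * (norm x)\<^sup>2)" by (intro real_le_rsqrt) (simp add: power2_eq_square mult_ac)
      thus "norm (T x) \<le> sqrt ?c * norm x" by (simp add: real_sqrt_mult)
    qed simp
    hence "(norm T)\<^sup>2 \<le> (sqrt ?c)\<^sup>2" by (intro power_mono) auto
    thus "(norm T)\<^sup>2 \<le> ?c" by simp
  qed
  have stst: "star ?B (star ?B T) = T" if T: "T \<in> carrier ?B" for T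
    by (rule star_bounded_operators_eqI[OF st(1)[OF T]])
      (subst (1 2) cinner_commute, simp add: st(2)[OF T])
  have cl: "blinfun_compose S T \<in> carrier ?B" if "S \<in> carrier ?B" "T \<in> carrier ?B" for S T
    using that by (simp add: inB)
  have add: "S + T \<in> carrier ?B" if "S \<in> carrier ?B" "T \<in> carrier ?B" for S T
    using that sub by (auto simp: V.subspace_def)
  have scl: "scale ?B z T \<in> carrier ?B" if "T \<in> carrier ?B" for z T
    using that sub by (auto simp: V.subspace_def)
  have norm_sc: "norm (scale ?B z T) = cmod z * norm T" for z T
  proof -
    have le: "norm (scale ?B z T) \<le> cmod z * norm T" for z T
    proof (rule norm_blinfun_bound)
      show "norm (blinfun_apply (scale ?B z T) x) \<le> cmod z * norm T * norm x" for x
        using mult_left_mono[OF norm_blinfun[of T x], of "cmod z"] by (simp add: sc norm_scaleC mult.assoc)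
    qed simp
    show ?thesis
    proof (cases "z = 0")
      case False
      have "scale ?B (inverse z) (scale ?B z T) = T" using False by simp
      hence "norm T \<le> cmod (inverse z) * norm (scale ?B z T)" using le[of "inverse z" "scale ?B z T"] by simp
      hence "cmod z * norm T \<le> cmod z * (cmod (inverse z) * norm (scale ?B z T))" by (rule mult_left_mono) simp
      also have "\<dots> = norm (scale ?B z T)" unfolding mult.assoc[symmetric] norm_mult[symmetric] using False by simp
      finally have "cmod z * norm T \<le> norm (scale ?B z T)" .
      thus ?thesis using le[of z T] by linarith
    qed simp
  qed
  have compl: "\<exists>l\<in>carrier ?B. (\<lambda>n. norm (f n - l)) \<longlonglongrightarrow> 0"
    if fB: "\<And>n. f n \<in> carrier ?B" and C: "\<And>e. e > 0 \<Longrightarrow> \<exists>N. \<forall>m\<ge>N. \<forall>n\<ge>N. norm (f m - f n) < e" for f :: "nat \<Rightarrow> 'h \<Rightarrow>\<^sub>L 'h"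
  proof -
    have "Cauchy f" using C by (rule CauchyI)
    then obtain l where l: "f \<longlonglongrightarrow> l" using Cauchy_convergent convergent_def by blast
    have "blinfun_apply l (scaleC z x) = scaleC z (blinfun_apply l x)" for z x
    proof (rule LIMSEQ_unique)
      show "(\<lambda>n. blinfun_apply (f n) (scaleC z x)) \<longlonglongrightarrow> blinfun_apply l (scaleC z x)"
        by (intro tendsto_intros l)
      have "(\<lambda>n. scaleC z (blinfun_apply (f n) x)) \<longlonglongrightarrow> scaleC z (blinfun_apply l x)"
        by (intro bounded_linear.tendsto[OF bounded_linear_scaleC] tendsto_intros l)
      thus "(\<lambda>n. blinfun_apply (f n) (scaleC z x)) \<longlonglongrightarrow> scaleC z (blinfun_apply l x)"
        using fB by (simp add: inB)
    qed
    hence "l \<in> carrier ?B" by (simp add: inB)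
    moreover have "(\<lambda>n. norm (f n - l)) \<longlonglongrightarrow> 0" using l by (simp add: LIM_zero tendsto_norm_zero)
    ultimately show ?thesis by blast
  qed
  show ?thesis
  proof (rule cstar_algebra.intro)
    show "vector_space (scale ?B)" by (rule vs)
    show "V.subspace (carrier ?B)" by (rule sub)
    show "star ?B (a + b) = star ?B a + star ?B b" if "a \<in> carrier ?B" "b \<in> carrier ?B" for a b
      by (rule star_bounded_operators_eqI[OF add[OF that]])
        (simp add: blinfun.add_left cinner_add_left cinner_add_right st(2) that)
    show "star ?B (scale ?B z a) = scale ?B (cnj z) (star ?B a)" if "a \<in> carrier ?B" for a z
      by (rule star_bounded_operators_eqI[OF scl[OF that]])
        (simp add: sc cinner_scaleC_left cinner_scaleC_right st(2) that)
    show "star ?B (mult ?B a b) = mult ?B (star ?B b) (star ?B a)" if "a \<in> carrier ?B" "b \<in> carrier ?B" for a b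
      unfolding m by (rule star_bounded_operators_eqI[OF cl[OF that]]) (simp add: st(2) that)
    show "\<exists>l\<in>carrier ?B. (\<lambda>n. nrm ?B (f n - l)) \<longlonglongrightarrow> 0"
      if "\<And>n. f n \<in> carrier ?B" "\<And>e. e > 0 \<Longrightarrow> \<exists>N. \<forall>m\<ge>N. \<forall>n\<ge>N. nrm ?B (f m - f n) < e" for f
      using compl[of f] that unfolding n by blast
    show "mult ?B (mult ?B a b) c = mult ?B a (mult ?B b c)" for a b c
      unfolding m by (rule blinfun_eqI) simp
    show "mult ?B (a + b) c = mult ?B a c + mult ?B b c" for a b c
      unfolding m by (rule blinfun_eqI) (simp add: blinfun.add_left)
    show "mult ?B a (b + c) = mult ?B a b + mult ?B a c" for a b c
      unfolding m by (rule blinfun_eqI) (simp add: blinfun.add_left blinfun.add_right)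
    show "mult ?B (scale ?B z a) b = scale ?B z (mult ?B a b)" for z a b
      unfolding m by (rule blinfun_eqI) (simp add: sc)
    show "mult ?B a (scale ?B z b) = scale ?B z (mult ?B a b)" if "a \<in> carrier ?B" for z a b
      unfolding m using that by (intro blinfun_eqI) (simp add: sc inB)
  qed (simp_all add: m n cl st(1) stst cst norm_sc norm_triangle_ineq norm_blinfun_compose)
qed

section \<open>Homomorphisms of finite-dimensional C*-algebras\<close>

context cstar_algebra
begin

sublocale V: vector_space "scale A" by (rule vector_space)

lemma zero_closed: "0 \<in> carrier A" using subspace by (rule V.subspace_0)
lemma add_closed: "a \<in> carrier A \<Longrightarrow> b \<in> carrier A \<Longrightarrow> a + b \<in> carrier A"
  using subspace by (rule V.subspace_add)
lemma scale_closed: "a \<in> carrier A \<Longrightarrow> z \<odot> a \<in> carrier A" using subspace by (rule V.subspace_scale)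
lemma diff_closed: "a \<in> carrier A \<Longrightarrow> b \<in> carrier A \<Longrightarrow> a - b \<in> carrier A"
  using subspace by (rule V.subspace_diff)
lemma neg_closed: "a \<in> carrier A \<Longrightarrow> - a \<in> carrier A" using subspace by (rule V.subspace_neg)
lemma sum_closed: "(\<And>x. x \<in> S \<Longrightarrow> f x \<in> carrier A) \<Longrightarrow> sum f S \<in> carrier A"
  using subspace by (rule V.subspace_sum)

lemmas closed = zero_closed add_closed neg_closed scale_closed diff_closed sum_closed

lemma nrm_zero: "nrm A 0 = 0" using nrm_eq_0_iff[OF zero_closed] by simp

lemma nrm_triangle_diff: "a \<in> carrier A \<Longrightarrow> b \<in> carrier A \<Longrightarrow> nrm A (a - b) \<le> nrm A a + nrm A b"
  using nrm_triangle[of a "(-1) \<odot> b"] nrm_scale[of b "-1"] by (simp add: closed)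

lemma nrm_sum: "(\<And>x. x \<in> S \<Longrightarrow> f x \<in> carrier A) \<Longrightarrow> nrm A (sum f S) \<le> (\<Sum>x\<in>S. nrm A (f x))"
proof (induction S rule: infinite_finite_induct)
  case (insert x S)
  have "nrm A (f x + sum f S) \<le> nrm A (f x) + nrm A (sum f S)" using insert by (intro nrm_triangle closed) auto
  thus ?case using insert by force
qed (simp_all add: nrm_zero)

text \<open>
  On a finite-dimensional normed space the coordinates are bounded functionals. Inductively, the span
  of the old basis vectors is complete, so the new vector has positive distance \<open>d\<close> from it, and this
  distance controls the new coordinate.
\<close>

lemma coordinates_bounded:
  assumes "finite B" "B \<subseteq> carrier A" "V.independent B"
  shows "\<exists>C>0. \<forall>c. (\<Sum>b\<in>B. cmod (c b)) \<le> C * nrm A (\<Sum>b\<in>B. c b \<odot> b)"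
  using assms
proof (induction B rule: finite_induct)
  case empty
  thus ?case by (intro exI[of _ 1]) (simp add: nrm_zero)
next
  case (insert b B)
  have BA: "B \<subseteq> carrier A" "b \<in> carrier A" using insert by auto
  have "V.independent B" using insert by (simp add: V.independent_insert)
  then obtain C where C: "C > 0" "\<And>c. (\<Sum>x\<in>B. cmod (c x)) \<le> C * nrm A (\<Sum>x\<in>B. c x \<odot> x)"
    using insert BA by auto
  have nspan: "b \<notin> V.span B" using insert by (simp add: V.independent_insert)
  have SA: "(\<Sum>x\<in>B. c x \<odot> x) \<in> carrier A" for c using BA by (intro closed) auto
  have "\<exists>d>0. \<forall>c. d \<le> nrm A (b + (\<Sum>x\<in>B. c x \<odot> x))"
  proof (rule ccontr)
    assume "\<not> ?thesis"
    hence "\<exists>c. nrm A (b + (\<Sum>x\<in>B. c x \<odot> x)) < 1 / real (Suc n)" for n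
      by (metis not_le of_nat_0_less_iff zero_less_Suc zero_less_divide_1_iff)
    then obtain c where c: "\<And>n. nrm A (b + (\<Sum>x\<in>B. c n x \<odot> x)) < 1 / real (Suc n)" by metis
    \<comment> \<open>If the distance were 0, the approximants would be Cauchy in every old coordinate; their limit would put \<open>b\<close> into the span.\<close>
    define y where "y n = (\<Sum>x\<in>B. c n x \<odot> x)" for n
    have yA: "y n \<in> carrier A" for n unfolding y_def by (rule SA)
    have diff: "(\<Sum>x\<in>B. cmod (c m x - c n x)) \<le> C * (1 / real (Suc m) + 1 / real (Suc n))" for m n
    proof -
      have "(\<Sum>x\<in>B. cmod (c m x - c n x)) \<le> C * nrm A (\<Sum>x\<in>B. (c m x - c n x) \<odot> x)" by (rule C(2))
      also have "(\<Sum>x\<in>B. (c m x - c n x) \<odot> x) = (b + y m) - (b + y n)"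
        by (simp add: y_def V.scale_left_diff_distrib sum_subtractf)
      also have "nrm A \<dots> \<le> nrm A (b + y m) + nrm A (b + y n)" using BA yA by (intro nrm_triangle_diff closed)
      also have "\<dots> \<le> 1 / real (Suc m) + 1 / real (Suc n)" using c[of m] c[of n] unfolding y_def by linarith
      finally show ?thesis using C(1) by simp
    qed
    have "Cauchy (\<lambda>n. c n x)" if x: "x \<in> B" for x
    proof (rule CauchyI)
      fix e :: real assume e: "e > 0"
      obtain M :: nat where M: "2 * C / e < real M" using reals_Archimedean2 by blast
      have M0: "0 < real M" using M C(1) e by (smt (verit) divide_pos_pos)
      have "cmod (c m x - c n x) < e" if "m \<ge> M" "n \<ge> M" for m n
      proof -
        have "cmod (c m x - c n x) \<le> (\<Sum>x\<in>B. cmod (c m x - c n x))"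
          using insert x by (intro member_le_sum) auto
        also note diff
        also have "C * (1 / real (Suc m) + 1 / real (Suc n)) \<le> C * (1 / real M + 1 / real M)"
          using that M0 C(1) by (intro mult_left_mono add_mono divide_left_mono) auto
        also have "\<dots> < e" using M M0 e by (simp add: field_simps)
        finally show ?thesis .
      qed
      thus "\<exists>M. \<forall>m\<ge>M. \<forall>n\<ge>M. norm (c m x - c n x) < e" by blast
    qed
    hence conv: "convergent (\<lambda>n. c n x)" if "x \<in> B" for x using that by (intro Cauchy_convergent)
    define l where "l x = lim (\<lambda>n. c n x)" for x
    have l: "(\<lambda>n. c n x) \<longlonglongrightarrow> l x" if "x \<in> B" for x
      unfolding l_def using conv[OF that] by (simp add: convergent_LIMSEQ_iff)
    define y0 where "y0 = (\<Sum>x\<in>B. l x \<odot> x)"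
    have y0A: "y0 \<in> carrier A" unfolding y0_def by (rule SA)
    have le: "nrm A (b + y0) \<le> 1 / real (Suc n) + (\<Sum>x\<in>B. cmod (c n x - l x) * nrm A x)" for n
    proof -
      have "nrm A (b + y0) = nrm A ((b + y n) - (y n - y0))" by simp
      also have "\<dots> \<le> nrm A (b + y n) + nrm A (y n - y0)" using BA yA y0A by (intro nrm_triangle_diff closed)
      also have "y n - y0 = (\<Sum>x\<in>B. (c n x - l x) \<odot> x)"
        by (simp add: y_def y0_def V.scale_left_diff_distrib sum_subtractf)
      also have "nrm A \<dots> \<le> (\<Sum>x\<in>B. nrm A ((c n x - l x) \<odot> x))"
        by (intro nrm_sum scale_closed subsetD[OF BA(1)])
      also have "\<dots> = (\<Sum>x\<in>B. cmod (c n x - l x) * nrm A x)" by (intro sum.cong refl nrm_scale subsetD[OF BA(1)])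
      finally show ?thesis using c[of n] unfolding y_def by linarith
    qed
    have "(\<lambda>n. 1 / real (Suc n) + (\<Sum>x\<in>B. cmod (c n x - l x) * nrm A x)) \<longlonglongrightarrow> 0 + (\<Sum>x\<in>B. 0 * nrm A x)"
      using l by (intro tendsto_add tendsto_sum tendsto_mult tendsto_const LIMSEQ_Suc[OF lim_1_over_n] tendsto_norm_zero LIM_zero) auto
    hence "nrm A (b + y0) \<le> 0" using le by (intro LIMSEQ_le_const[where X = "\<lambda>n. 1 / real (Suc n) + (\<Sum>x\<in>B. cmod (c n x - l x) * nrm A x)"]) auto
    hence "b + y0 = 0" using nrm_nonneg[of "b + y0"] nrm_eq_0_iff[of "b + y0"] BA y0A by (simp add: closed)
    hence "b = - y0" by (simp add: eq_neg_iff_add_eq_0)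
    also have "- y0 \<in> V.span B" unfolding y0_def by (intro V.span_neg V.span_sum V.span_scale V.span_base)
    finally show False using nspan by simp
  qed
  then obtain d where d: "d > 0" "\<And>c. d \<le> nrm A (b + (\<Sum>x\<in>B. c x \<odot> x))" by auto
  \<comment> \<open>The first term bounds the new coordinate; the second bounds the old ones after the new component has been subtracted.\<close>
  define K where "K = 1 / d + C * (1 + nrm A b / d)"
  have nb: "nrm A b \<ge> 0" using BA by (intro nrm_nonneg)
  have K: "K > 0" unfolding K_def using C(1) d(1) nb by (intro add_pos_nonneg) auto
  have "(\<Sum>x\<in>insert b B. cmod (c x)) \<le> K * nrm A (\<Sum>x\<in>insert b B. c x \<odot> x)" for c
  proof -
    let ?S = "\<Sum>x\<in>B. c x \<odot> x"
    let ?N = "nrm A (c b \<odot> b + ?S)"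
    have N0: "?N \<ge> 0" by (intro nrm_nonneg add_closed scale_closed BA(2) SA)
    have 1: "cmod (c b) \<le> ?N / d"
    proof (cases "c b = 0")
      case False
      have "c b \<odot> b + ?S = c b \<odot> (b + (\<Sum>x\<in>B. (c x / c b) \<odot> x))"
        using False by (simp add: V.scale_right_distrib V.scale_sum_right)
      hence "?N = cmod (c b) * nrm A (b + (\<Sum>x\<in>B. (c x / c b) \<odot> x))"
        using BA SA by (simp add: nrm_scale closed)
      also have "\<dots> \<ge> cmod (c b) * d" using d(2) by (intro mult_left_mono) auto
      finally show ?thesis using d(1) by (simp add: field_simps)
    qed (use N0 d in auto)
    have "nrm A ?S = nrm A ((c b \<odot> b + ?S) - c b \<odot> b)" by simp
    also have "\<dots> \<le> ?N + nrm A (c b \<odot> b)" by (intro nrm_triangle_diff add_closed scale_closed BA(2) SA)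
    also have "\<dots> = ?N + cmod (c b) * nrm A b" using BA by (simp add: nrm_scale)
    also have "\<dots> \<le> ?N + ?N / d * nrm A b" using 1 nb by (intro add_left_mono mult_right_mono)
    finally have "C * nrm A ?S \<le> C * (?N + ?N / d * nrm A b)" using C(1) by (intro mult_left_mono) auto
    hence "(\<Sum>x\<in>B. cmod (c x)) \<le> C * (?N + ?N / d * nrm A b)" using C(2)[of c] by linarith
    hence "cmod (c b) + (\<Sum>x\<in>B. cmod (c x)) \<le> ?N / d + C * (?N + ?N / d * nrm A b)" using 1 by linarith
    also have "\<dots> = K * ?N" by (simp add: K_def algebra_simps)
    finally show ?thesis using insert by simp
  qed
  thus ?case using K by blast
qed

lemma finite_basis:
  assumes "finite_dimensional A"
  obtains B where "finite B" "B \<subseteq> carrier A" "V.independent B" "V.span B = carrier A"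
proof -
  obtain S where S: "finite S" "V.span S = carrier A" using assms by (auto simp: finite_dimensional_def)
  obtain B where B: "B \<subseteq> S" "V.independent B" "S \<subseteq> V.span B" using V.maximal_independent_subset[of S] by blast
  have "V.span S \<subseteq> V.span B" using B(3) V.subspace_span by (rule V.span_minimal)
  moreover have "V.span B \<subseteq> V.span S" using B(1) by (rule V.span_mono)
  ultimately have "V.span B = carrier A" using S by simp
  moreover have "B \<subseteq> carrier A" using B(1) S V.span_superset by blast
  moreover have "finite B" using B(1) S(1) by (rule finite_subset)
  ultimately show ?thesis using that B(2) by simp
qed

end

lemma linear_map_sum:
  assumes A: "cstar_algebra A" and f: "linear_map A B f" and x: "\<And>k. k \<in> S \<Longrightarrow> x k \<in> carrier A"
  shows "f (\<Sum>k\<in>S. x k) = (\<Sum>k\<in>S. f (x k))"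
proof -
  interpret A: cstar_algebra A by fact
  have add: "f (a + b) = f a + f b" if "a \<in> carrier A" "b \<in> carrier A" for a b
    using f that by (auto simp: linear_map_def)
  have f0: "f 0 = 0" using add[of 0 0] by (simp add: A.zero_closed)
  show ?thesis using x
    by (induction S rule: infinite_finite_induct) (auto simp: f0 add A.sum_closed)
qed

lemma linear_map_bounded:
  assumes A: "cstar_algebra A" and fd: "finite_dimensional A" and B: "cstar_algebra B" and f: "linear_map A B f"
  obtains K where "\<And>a. a \<in> carrier A \<Longrightarrow> nrm B (f a) \<le> K * nrm A a"
proof -
  interpret A: cstar_algebra A by fact
  interpret B: cstar_algebra B by fact
  obtain S where S: "finite S" "S \<subseteq> carrier A" "A.V.independent S" "A.V.span S = carrier A"
    using A.finite_basis[OF fd] by blast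
  obtain C where C: "C > 0" "\<And>c. (\<Sum>b\<in>S. cmod (c b)) \<le> C * nrm A (\<Sum>b\<in>S. scale A (c b) b)"
    using A.coordinates_bounded[OF S(1-3)] by blast
  have fB: "f a \<in> carrier B" if "a \<in> carrier A" for a using f that by (auto simp: linear_map_def)
  define M where "M = (\<Sum>b\<in>S. nrm B (f b))"
  have nn: "nrm B (f b) \<ge> 0" if "b \<in> S" for b using S that by (intro B.nrm_nonneg fB) auto
  have M: "nrm B (f b) \<le> M" if "b \<in> S" for b
    unfolding M_def using S(1) that nn by (intro member_le_sum) auto
  have M0: "M \<ge> 0" unfolding M_def using nn by (rule sum_nonneg)
  have "nrm B (f a) \<le> (M * C) * nrm A a" if a: "a \<in> carrier A" for a
  proof -
    obtain c where c: "a = (\<Sum>b\<in>S. scale A (c b) b)"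
      using a S(4) A.V.span_finite[OF S(1)] by auto
    have "f a = (\<Sum>b\<in>S. f (scale A (c b) b))"
      unfolding c using S by (intro linear_map_sum[OF A f] A.closed) auto
    also have "\<dots> = (\<Sum>b\<in>S. scale B (c b) (f b))"
      using f S by (intro sum.cong) (auto simp: linear_map_def)
    finally have "nrm B (f a) \<le> (\<Sum>b\<in>S. nrm B (scale B (c b) (f b)))"
      using S by (auto intro!: B.nrm_sum B.closed fB)
    also have "\<dots> = (\<Sum>b\<in>S. cmod (c b) * nrm B (f b))"
      using S by (intro sum.cong refl B.nrm_scale fB) auto
    also have "\<dots> \<le> (\<Sum>b\<in>S. cmod (c b) * M)" using M by (intro sum_mono mult_left_mono) auto
    also have "\<dots> = M * (\<Sum>b\<in>S. cmod (c b))" by (simp add: sum_distrib_left mult.commute)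
    also have "\<dots> \<le> M * (C * nrm A a)" using C(2)[of c] M0 unfolding c by (intro mult_left_mono)
    finally show ?thesis by (simp add: mult.assoc)
  qed
  thus ?thesis using that by blast
qed

text \<open>
  Taking \<open>2^n\<close>-th roots turns the constant \<open>K\<close> into \<open>K^(1/2^n)\<close>, which tends to 1.
\<close>

lemma le_of_power_le:
  fixes x y K :: real
  assumes "x \<ge> 0" "y \<ge> 0" and le: "\<And>n. x ^ (2 ^ n) \<le> K * y ^ (2 ^ n)"
  shows "x \<le> y"
proof (rule ccontr)
  assume "\<not> x \<le> y"
  hence xy: "y < x" by simp
  show False
  proof (cases "y = 0")
    case True
    thus False using le[of 0] xy by simp
  next
    case False
    hence y: "y > 0" using assms by simp
    have r: "x / y > 1" using xy y by simp
    obtain n where n: "K < (x / y) ^ n" using real_arch_pow[OF r] by blast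
    have "(x / y) ^ n \<le> (x / y) ^ (2 ^ n)" using r by (intro power_increasing) (auto intro: less_imp_le less_exp)
    also have "\<dots> \<le> K" using le[of n] y by (simp add: power_divide field_simps)
    finally show False using n by simp
  qed
qed

text \<open>
  For self-adjoint \<open>h\<close> the C*-identity reads \<open>\<parallel>h\<^sup>2\<parallel> = \<parallel>h\<parallel>\<^sup>2\<close>, both in \<open>A\<close> and for the image in \<open>B\<close>. Iterating
  it from \<open>a\<^sup>* a\<close>, the norms of \<open>a\<close> and of \<open>f a\<close> are \<open>2^n\<close>-th roots of norms of elements related by the
  bounded map \<open>f\<close>, so the bound of \<open>f\<close> disappears in the limit.
\<close>

theorem star_hom_contractive:
  assumes A: "cstar_algebra A" and fd: "finite_dimensional A" and B: "cstar_algebra B" and f: "star_hom A B f"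
  shows "contractive A B f"
  unfolding contractive_def
proof
  fix a assume a: "a \<in> carrier A"
  interpret A: cstar_algebra A by fact
  interpret B: cstar_algebra B by fact
  have lin: "linear_map A B f" using f by (simp add: star_hom_def)
  have fB: "f x \<in> carrier B" if "x \<in> carrier A" for x using lin that by (auto simp: linear_map_def)
  have fm: "f (mult A x y) = mult B (f x) (f y)" if "x \<in> carrier A" "y \<in> carrier A" for x y
    using f that by (auto simp: star_hom_def)
  have fs: "f (star A x) = star B (f x)" if "x \<in> carrier A" for x using f that by (auto simp: star_hom_def)
  obtain K where K: "\<And>x. x \<in> carrier A \<Longrightarrow> nrm B (f x) \<le> K * nrm A x"
    using linear_map_bounded[OF A fd B lin] by blast
  \<comment> \<open>\<open>h n\<close> is \<open>(a\<^sup>* a)^(2^n)\<close>; every \<open>h n\<close> is self-adjoint.\<close>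
  define h where "h = rec_nat (mult A (star A a) a) (\<lambda>_ x. mult A x x)"
  have h0: "h 0 = mult A (star A a) a" and hS: "h (Suc n) = mult A (h n) (h n)" for n by (simp_all add: h_def)
  have h: "h n \<in> carrier A \<and> star A (h n) = h n \<and> nrm A (h n) = (nrm A a) ^ (2 ^ Suc n)
      \<and> nrm B (f (h n)) = (nrm B (f a)) ^ (2 ^ Suc n)" for n
  proof (induction n)
    case 0
    have "nrm B (f (h 0)) = nrm B (mult B (star B (f a)) (f a))" using a by (simp add: h0 fm fs A.star_closed)
    thus ?case using a fB[OF a]
      by (simp add: h0 A.star_closed A.mult_closed A.star_mult A.star_star A.cstar_identity B.cstar_identity)
  next
    case (Suc n)
    hence hn: "h n \<in> carrier A" "star A (h n) = h n" by auto
    have p: "(x ^ (2 ^ Suc n))\<^sup>2 = x ^ (2 ^ Suc (Suc n))" for x :: real by (simp flip: power_mult add: mult.commute)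
    have "nrm A (h (Suc n)) = (nrm A (h n))\<^sup>2"
      using A.cstar_identity[OF hn(1)] hn by (simp add: hS)
    moreover have "f (h (Suc n)) = mult B (star B (f (h n))) (f (h n))"
      using hn fs[OF hn(1)] by (simp add: hS fm)
    hence "nrm B (f (h (Suc n))) = (nrm B (f (h n)))\<^sup>2" using B.cstar_identity[OF fB[OF hn(1)]] by simp
    ultimately have "nrm A (h (Suc n)) = nrm A a ^ (2 ^ Suc (Suc n))" "nrm B (f (h (Suc n))) = nrm B (f a) ^ (2 ^ Suc (Suc n))"
      using Suc p by simp_all
    thus ?case using hn by (simp add: hS A.mult_closed A.star_mult)
  qed
  have "(nrm B (f a))\<^sup>2 \<le> (nrm A a)\<^sup>2"
  proof (rule le_of_power_le[of _ _ K])
    fix n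
    have "(nrm B (f a)) ^ (2 ^ Suc n) \<le> K * (nrm A a) ^ (2 ^ Suc n)" using K[of "h n"] h[of n] by auto
    thus "((nrm B (f a))\<^sup>2) ^ (2 ^ n) \<le> K * ((nrm A a)\<^sup>2) ^ (2 ^ n)" by (simp flip: power_mult)
  qed auto
  thus "nrm B (f a) \<le> nrm A a" using A.nrm_nonneg[OF a] by (rule power2_le_imp_le)
qed

lemma star_hom_completely_positive:
  assumes A: "cstar_algebra A" and f: "star_hom A B f"
  shows "completely_positive A B f"
  unfolding completely_positive_def
proof (intro conjI allI impI)
  interpret A: cstar_algebra A by fact
  show lin: "linear_map A B f" using f by (simp add: star_hom_def)
  fix n X assume "positive_matrix A n X"
  then obtain Y where "\<forall>i<n. \<forall>j<n. Y i j \<in> carrier A"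
    "\<forall>i<n. \<forall>j<n. X i j = (\<Sum>k<n. mult A (star A (Y k i)) (Y k j))"
    unfolding positive_matrix_def by blast
  hence Y: "\<And>i j. i < n \<Longrightarrow> j < n \<Longrightarrow> Y i j \<in> carrier A"
    "\<And>i j. i < n \<Longrightarrow> j < n \<Longrightarrow> X i j = (\<Sum>k<n. mult A (star A (Y k i)) (Y k j))"
    by blast+
  have "f (X i j) = (\<Sum>k<n. mult B (star B (f (Y k i))) (f (Y k j)))" if ij: "i < n" "j < n" for i j
  proof -
    have "f (X i j) = (\<Sum>k<n. f (mult A (star A (Y k i)) (Y k j)))"
      unfolding Y(2)[OF ij] using Y(1) ij by (intro linear_map_sum[OF A lin] A.mult_closed A.star_closed) auto
    also have "\<dots> = (\<Sum>k<n. mult B (star B (f (Y k i))) (f (Y k j)))"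
      using f Y(1) ij by (intro sum.cong refl) (simp add: star_hom_def A.star_closed)
    finally show ?thesis .
  qed
  thus "positive_matrix B n (\<lambda>i j. f (X i j))"
    unfolding positive_matrix_def using Y(1) lin
    by (intro exI[of _ "\<lambda>i j. f (Y i j)"]) (auto simp: linear_map_def)
qed

section \<open>Transport of structure\<close>

text \<open>
  The C*-algebra structure on the image of an injective linear map that makes the map an isomorphism.
  The scalar multiplication of the target is prescribed, because it has to be defined on the whole
  ambient type and not only on the image.
\<close>

definition transport :: "'a star_alg \<Rightarrow> (complex \<Rightarrow> 'b \<Rightarrow> 'b) \<Rightarrow> ('a \<Rightarrow> 'b) \<Rightarrow> 'b star_alg" where
  "transport A sc \<phi> = (let \<psi> = inv_into (carrier A) \<phi> in
     \<lparr>carrier = \<phi> ` carrier A, scale = sc,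
      mult = (\<lambda>x y. \<phi> (mult A (\<psi> x) (\<psi> y))), star = (\<lambda>x. \<phi> (star A (\<psi> x))), nrm = (\<lambda>x. nrm A (\<psi> x))\<rparr>)"

context
  fixes A :: "'a::ab_group_add star_alg" and sc :: "complex \<Rightarrow> 'b::ab_group_add \<Rightarrow> 'b" and \<phi> :: "'a \<Rightarrow> 'b"
  assumes A: "cstar_algebra A" and sc: "vector_space sc"
    and add: "\<And>a b. a \<in> carrier A \<Longrightarrow> b \<in> carrier A \<Longrightarrow> \<phi> (a + b) = \<phi> a + \<phi> b"
    and scl: "\<And>z a. a \<in> carrier A \<Longrightarrow> \<phi> (scale A z a) = sc z (\<phi> a)"
    and inj: "inj_on \<phi> (carrier A)"
begin

interpretation A: cstar_algebra A by (rule A)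
interpretation W: vector_space sc by (rule sc)

lemma transport_inv: "a \<in> carrier A \<Longrightarrow> inv_into (carrier A) \<phi> (\<phi> a) = a"
  using inj by (rule inv_into_f_f)

lemma transport_diff: "a \<in> carrier A \<Longrightarrow> b \<in> carrier A \<Longrightarrow> \<phi> a - \<phi> b = \<phi> (a - b)"
  using add[of "a - b" b] by (simp add: A.closed)

lemma transport_simps:
  "carrier (transport A sc \<phi>) = \<phi> ` carrier A" "scale (transport A sc \<phi>) = sc"
  "a \<in> carrier A \<Longrightarrow> b \<in> carrier A \<Longrightarrow> mult (transport A sc \<phi>) (\<phi> a) (\<phi> b) = \<phi> (mult A a b)"
  "a \<in> carrier A \<Longrightarrow> star (transport A sc \<phi>) (\<phi> a) = \<phi> (star A a)"
  "a \<in> carrier A \<Longrightarrow> nrm (transport A sc \<phi>) (\<phi> a) = nrm A a"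
  by (simp_all add: transport_def Let_def transport_inv)

lemma transport_subspace: "W.subspace (\<phi> ` carrier A)"
proof (rule W.subspaceI)
  have "\<phi> 0 = 0" using add[of 0 0] by (simp add: A.closed)
  thus "0 \<in> \<phi> ` carrier A" using A.zero_closed by (metis imageI)
qed (auto simp: add[symmetric] scl[symmetric] A.closed)

theorem cstar_algebra_transport: "cstar_algebra (transport A sc \<phi>)"
proof (rule cstar_algebra.intro)
  have inj': "\<phi> a = \<phi> b \<longleftrightarrow> a = b" if "a \<in> carrier A" "b \<in> carrier A" for a b
    using inj that by (auto dest: inj_onD)
  have z: "\<phi> 0 = 0" using add[of 0 0] by (simp add: A.closed)
  note cl = A.closed A.mult_closed A.star_closed
  note S = transport_simps add[symmetric] scl[symmetric] cl
  show "vector_space (scale (transport A sc \<phi>))" by (simp add: transport_simps sc)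
  show "module.subspace (scale (transport A sc \<phi>)) (carrier (transport A sc \<phi>))"
    unfolding transport_simps by (rule transport_subspace)
  show "nrm (transport A sc \<phi>) a = 0 \<longleftrightarrow> a = 0" if a: "a \<in> carrier (transport A sc \<phi>)" for a
  proof -
    obtain b where b: "b \<in> carrier A" "a = \<phi> b" using a by (auto simp: transport_simps)
    thus ?thesis using inj'[OF b(1) A.zero_closed] by (simp add: transport_simps A.nrm_eq_0_iff z)
  qed
  fix f :: "nat \<Rightarrow> 'b" assume f: "\<And>n. f n \<in> carrier (transport A sc \<phi>)"
    "\<And>e. 0 < e \<Longrightarrow> \<exists>N. \<forall>m\<ge>N. \<forall>n\<ge>N. nrm (transport A sc \<phi>) (f m - f n) < e"
  have "\<exists>g. g \<in> carrier A \<and> f n = \<phi> g" for n using f(1)[of n] by (auto simp: S)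
  then obtain g where g: "\<And>n. g n \<in> carrier A" "\<And>n. f n = \<phi> (g n)" by metis
  have "\<exists>N. \<forall>m\<ge>N. \<forall>n\<ge>N. nrm A (g m - g n) < e" if "e > 0" for e
    using f(2)[OF that] by (simp add: g S transport_diff)
  then obtain l where "l \<in> carrier A" "(\<lambda>n. nrm A (g n - l)) \<longlonglongrightarrow> 0"
    using A.complete[of g] g(1) by blast
  thus "\<exists>l\<in>carrier (transport A sc \<phi>). (\<lambda>n. nrm (transport A sc \<phi>) (f n - l)) \<longlonglongrightarrow> 0"
    by (intro bexI[of _ "\<phi> l"]) (auto simp: g S transport_diff)
qed (auto simp: transport_simps add[symmetric] scl[symmetric] A.closed A.mult_closed A.star_closed
    A.mult_assoc A.mult_add_left A.mult_add_right A.mult_scale_left A.mult_scale_right A.star_star A.star_add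
    A.star_scale A.star_mult A.nrm_nonneg A.nrm_triangle A.nrm_scale A.nrm_mult A.cstar_identity)

lemma finite_dimensional_transport:
  assumes "finite_dimensional A"
  shows "finite_dimensional (transport A sc \<phi>)"
proof -
  obtain S where S: "finite S" "A.V.span S = carrier A" using assms by (auto simp: finite_dimensional_def)
  have SA: "S \<subseteq> carrier A" using S A.V.span_superset by blast
  have lin: "linear_map A (transport A sc \<phi>) \<phi>"
    by (auto simp: linear_map_def transport_simps add scl)
  have "W.span (\<phi> ` S) = \<phi> ` carrier A"
  proof
    show "W.span (\<phi> ` S) \<subseteq> \<phi> ` carrier A"
      using SA transport_subspace by (intro W.span_minimal) auto
    show "\<phi> ` carrier A \<subseteq> W.span (\<phi> ` S)"
    proof
      fix x assume "x \<in> \<phi> ` carrier A"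
      then obtain a where "x = \<phi> a" "a \<in> A.V.span S" using S(2) by auto
      then obtain c where c: "x = \<phi> (\<Sum>b\<in>S. scale A (c b) b)"
        unfolding A.V.span_finite[OF S(1)] by blast
      also have "\<dots> = (\<Sum>b\<in>S. \<phi> (scale A (c b) b))"
        using SA by (intro linear_map_sum[OF A lin] A.closed) auto
      also have "\<dots> = (\<Sum>b\<in>S. sc (c b) (\<phi> b))" using SA by (intro sum.cong refl scl) auto
      also have "\<dots> \<in> W.span (\<phi> ` S)" by (intro W.span_sum W.span_scale W.span_base) auto
      finally show "x \<in> W.span (\<phi> ` S)" .
    qed
  qed
  thus ?thesis using S(1) by (auto simp: finite_dimensional_def transport_simps)
qed

lemma star_hom_transport: "star_hom A (transport A sc \<phi>) \<phi>"
  by (auto simp: star_hom_def linear_map_def transport_simps add scl)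

lemma star_hom_transport_inv:
  assumes f: "star_hom A B f"
  shows "star_hom (transport A sc \<phi>) B (f \<circ> inv_into (carrier A) \<phi>)"
  using f unfolding star_hom_def linear_map_def
  by (auto simp: transport_simps transport_inv add[symmetric] scl[symmetric] A.closed A.mult_closed A.star_closed)

end

text \<open>
  Coordinates with respect to a finite basis, padded with zeros.
\<close>

lemma coordinate_embedding:
  assumes A: "cstar_algebra A" and fd: "finite_dimensional A"
  obtains \<phi> :: "'a::ab_group_add \<Rightarrow> nat \<Rightarrow> complex" where
    "\<And>a b. a \<in> carrier A \<Longrightarrow> b \<in> carrier A \<Longrightarrow> \<phi> (a + b) = \<phi> a + \<phi> b"
    "\<And>z a. a \<in> carrier A \<Longrightarrow> \<phi> (scale A z a) = (\<lambda>i. z * \<phi> a i)"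
    "inj_on \<phi> (carrier A)"
proof -
  interpret A: cstar_algebra A by fact
  obtain B where B: "finite B" "B \<subseteq> carrier A" "A.V.independent B" "A.V.span B = carrier A"
    using A.finite_basis[OF fd] by blast
  obtain e where e: "bij_betw e {..<card B} B"
    using ex_bij_betw_nat_finite[OF B(1)] by (auto simp: atLeast0LessThan)
  define \<phi> where "\<phi> a = (\<lambda>i. if i < card B then A.V.representation B a (e i) else 0)" for a
  show ?thesis
  proof (rule that[of \<phi>])
    show "\<phi> (a + b) = \<phi> a + \<phi> b" if "a \<in> carrier A" "b \<in> carrier A" for a b
      using that B by (auto simp: \<phi>_def A.V.representation_add fun_eq_iff)
    show "\<phi> (scale A z a) = (\<lambda>i. z * \<phi> a i)" if "a \<in> carrier A" for a z
      using that B by (auto simp: \<phi>_def A.V.representation_scale fun_eq_iff)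
    show "inj_on \<phi> (carrier A)"
    proof (rule inj_onI)
      fix a b assume ab: "a \<in> carrier A" "b \<in> carrier A" "\<phi> a = \<phi> b"
      have rep: "A.V.representation B a x = A.V.representation B b x" if "x \<in> B" for x
      proof -
        have "x \<in> e ` {..<card B}" using e that by (simp add: bij_betw_def)
        then obtain i where i: "i < card B" "x = e i" by auto
        thus ?thesis using fun_cong[OF ab(3), of i] by (simp add: \<phi>_def)
      qed
      have "a = (\<Sum>x\<in>B. scale A (A.V.representation B a x) x)"
        using A.V.sum_representation_eq[of B a B] B ab by simp
      also have "\<dots> = (\<Sum>x\<in>B. scale A (A.V.representation B b x) x)" using rep by simp
      also have "\<dots> = b" using A.V.sum_representation_eq[of B b B] B ab by simp
      finally show "a = b" .
    qed
  qed
qed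

section \<open>Vanishing of the entropy\<close>

text \<open>
  One triple, built from an isomorphic copy of \<open>A\<close>, serves for all finite sets and all tolerances.
\<close>

lemma CPA_uniform:
  fixes \<pi> :: "'a::ab_group_add \<Rightarrow> 'h::complex_hilbert \<Rightarrow>\<^sub>L 'h"
  assumes A: "cstar_algebra A" and fd: "finite_dimensional A" and \<pi>: "star_hom A bounded_operators \<pi>"
  obtains \<phi> \<psi> B where "\<And>\<Omega> \<delta>. \<Omega> \<subseteq> carrier A \<Longrightarrow> \<delta> > 0 \<Longrightarrow> (\<phi>, \<psi>, B) \<in> CPA A \<pi> \<Omega> \<delta>"
proof -
  obtain \<phi> :: "'a \<Rightarrow> nat \<Rightarrow> complex" where \<phi>: "\<And>a b. a \<in> carrier A \<Longrightarrow> b \<in> carrier A \<Longrightarrow> \<phi> (a + b) = \<phi> a + \<phi> b"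
    "\<And>z a. a \<in> carrier A \<Longrightarrow> \<phi> (scale A z a) = (\<lambda>i. z * \<phi> a i)" "inj_on \<phi> (carrier A)"
    using coordinate_embedding[OF A fd] by blast
  define sc where "sc z x = (\<lambda>i. z * x i)" for z :: complex and x :: "nat \<Rightarrow> complex"
  have vs: "vector_space sc"
    by unfold_locales (auto simp: sc_def fun_eq_iff algebra_simps)
  have scl: "\<phi> (scale A z a) = sc z (\<phi> a)" if "a \<in> carrier A" for z a using \<phi>(2)[OF that] by (simp add: sc_def)
  define B where "B = transport A sc \<phi>"
  define \<psi> where "\<psi> = \<pi> \<circ> inv_into (carrier A) \<phi>"
  note tr = A vs \<phi>(1) scl \<phi>(3)
  have B: "cstar_algebra B" unfolding B_def by (rule cstar_algebra_transport) (fact tr)+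
  have Bfd: "finite_dimensional B" unfolding B_def by (rule finite_dimensional_transport) (fact tr fd)+
  have h1: "star_hom A B \<phi>" unfolding B_def by (rule star_hom_transport) (fact tr)+
  have h2: "star_hom B bounded_operators \<psi>" unfolding B_def \<psi>_def by (rule star_hom_transport_inv) (fact tr \<pi>)+
  have "(\<phi>, \<psi>, B) \<in> CPA A \<pi> \<Omega> \<delta>" if "\<Omega> \<subseteq> carrier A" "\<delta> > 0" for \<Omega> \<delta>
  proof -
    have "\<psi> (\<phi> a) = \<pi> a" if "a \<in> carrier A" for a using that \<phi>(3) by (simp add: \<psi>_def inv_into_f_f)
    hence "\<forall>a\<in>\<Omega>. norm (\<psi> (\<phi> a) - \<pi> a) < \<delta>" using that by (auto simp: subset_iff)
    thus ?thesis unfolding CPA_def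
      using B Bfd h1 h2 star_hom_completely_positive[OF A h1] star_hom_completely_positive[OF B h2]
        star_hom_contractive[OF A fd B h1] star_hom_contractive[OF B Bfd cstar_algebra_bounded_operators h2]
      by simp
  qed
  thus ?thesis using that by blast
qed

lemma log_enat_mono: "r \<le> enat m \<Longrightarrow> log_enat r \<le> log_enat (enat m)"
  by (cases r) (auto simp: log_enat_def)

lemma log_enat_nonneg: "0 \<le> log_enat r"
  by (cases r) (auto simp: log_enat_def)

text \<open>
  The lower bound 0 holds because \<open>log_enat\<close> is nonnegative; the upper bound comes from the single
  triple above, whose rank does not depend on \<open>n\<close>.
\<close>

theorem ht_eq_0:
  fixes \<pi> :: "'a::ab_group_add \<Rightarrow> 'h::complex_hilbert \<Rightarrow>\<^sub>L 'h"
  assumes A: "cstar_algebra A" and fd: "finite_dimensional A" and \<pi>: "star_hom A bounded_operators \<pi>"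
    and \<alpha>: "\<alpha> ` carrier A \<subseteq> carrier A"
  shows "ht A \<pi> \<alpha> = 0"
proof -
  obtain \<phi> \<psi> B where CPA: "\<And>\<Omega> \<delta>. \<Omega> \<subseteq> carrier A \<Longrightarrow> \<delta> > 0 \<Longrightarrow> (\<phi>, \<psi>, B) \<in> CPA A \<pi> \<Omega> \<delta>"
    using CPA_uniform[OF A fd \<pi>] by blast
  have pow: "(\<alpha> ^^ i) a \<in> carrier A" if "a \<in> carrier A" for i a
    using \<alpha> that by (induction i) auto
  define c where "c = (if rank_alg B = 0 then 0 else ln (real (rank_alg B)))"
  have c: "log_enat (enat (rank_alg B)) = ereal c" by (simp add: log_enat_def c_def)
  have "ht_set_delta A \<pi> \<alpha> \<Omega> \<delta> = 0" if \<Omega>: "\<Omega> \<subseteq> carrier A" and \<delta>: "\<delta> > 0" for \<Omega> \<delta>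
  proof -
    define r where "r n = rcp A \<pi> (\<Union>i<n. (\<alpha> ^^ i) ` \<Omega>) \<delta>" for n
    have "(\<Union>i<n. (\<alpha> ^^ i) ` \<Omega>) \<subseteq> carrier A" for n using \<Omega> pow by auto
    hence "r n \<le> enat (rank_alg B)" for n
      unfolding r_def rcp_def using CPA[OF _ \<delta>] by (intro INF_lower2[of "(\<phi>, \<psi>, B)"]) auto
    hence "log_enat (r n) \<le> ereal c" for n using log_enat_mono c by metis
    hence up: "ereal (1 / real n) * log_enat (r n) \<le> ereal (c / real n)" for n
      using ereal_mult_left_mono[of "log_enat (r n)" "ereal c" "ereal (1 / real n)"] by simp
    have "limsup (\<lambda>n. ereal (1 / real n) * log_enat (r n)) \<le> limsup (\<lambda>n. ereal (c / real n))"
      using up by (intro Limsup_mono always_eventually allI)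
    also have "\<dots> = 0"
    proof (rule lim_imp_Limsup)
      have "(\<lambda>n. c / real n) \<longlonglongrightarrow> 0" by (rule lim_const_over_n)
      thus "(\<lambda>n. ereal (c / real n)) \<longlonglongrightarrow> 0" by (simp add: zero_ereal_def)
    qed simp
    finally have "limsup (\<lambda>n. ereal (1 / real n) * log_enat (r n)) \<le> 0" .
    moreover have "0 \<le> limsup (\<lambda>n. ereal (1 / real n) * log_enat (r n))"
      by (intro le_Limsup always_eventually allI) (auto simp: log_enat_nonneg)
    ultimately show ?thesis by (simp add: ht_set_delta_def r_def antisym)
  qed
  hence "ht_set A \<pi> \<alpha> \<Omega> = 0" if "\<Omega> \<subseteq> carrier A" for \<Omega>
    unfolding ht_set_def using that by (intro SUP_eq_const) (auto intro: gt_ex)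
  thus ?thesis unfolding ht_def by (intro SUP_eq_const) auto
qed

section \<open>Dirichlet series\<close>

text \<open>
  The term at \<open>n = 0\<close> vanishes by the convention \<open>0 powr z = 0\<close>, so the series may start at 0 and no
  index has to be shifted.
\<close>

definition dser :: "(nat \<Rightarrow> complex) \<Rightarrow> complex \<Rightarrow> complex" where
  "dser f s = (\<Sum>n. f n * of_nat n powr (-s))"

lemma norm_nat_powr: "cmod (of_nat n powr z) = real n powr Re z"
  by (simp add: norm_powr_real_powr)

lemma summable_nat_powr:
  assumes "x > 1"
  shows "summable (\<lambda>n. real n powr (-x))"
  using summable_real_powr_iff[of "-x"] assms by simp

lemma dser_abs_summable:
  assumes "\<And>n. cmod (f n) \<le> C" "Re s > 1"
  shows "summable (\<lambda>n. cmod (f n * of_nat n powr (-s)))"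
proof (rule summable_comparison_test'[of "\<lambda>n. C * real n powr (- Re s)" 0])
  show "summable (\<lambda>n. C * real n powr (- Re s))" using assms by (intro summable_mult summable_nat_powr)
qed (use assms in \<open>auto simp: norm_mult norm_nat_powr intro!: mult_right_mono\<close>)

lemma dser_sums:
  assumes "\<And>n. cmod (f n) \<le> C" "Re s > 1"
  shows "(\<lambda>n. f n * of_nat n powr (-s)) sums dser f s"
  unfolding dser_def by (rule summable_sums, rule summable_norm_cancel, rule dser_abs_summable[OF assms])

lemma dser_has_field_derivative:
  assumes "\<And>n. cmod (f n) \<le> C" "Re s > 1"
  shows "(\<lambda>n. f n * (- ln (of_nat n)) * of_nat n powr (-s)) sums deriv (dser f) s"
    and "(dser f has_field_derivative deriv (dser f) s) (at s)"
proof -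
  define S where "S = {s. Re s > 1}"
  have "\<exists>g g'. \<forall>x \<in> S. ((\<lambda>n. f n * of_nat n powr (-x)) sums g x) \<and> 
      ((\<lambda>n. f n * (- ln (of_nat n)) * of_nat n powr (-x)) sums g' x) \<and> (g has_field_derivative g' x) (at x)"
  proof (rule series_and_derivative_comparison_complex)
    show "open S" unfolding S_def by (rule open_halfspace_Re_gt)
    show "((\<lambda>x. f n * of_nat n powr (-x)) has_field_derivative f n * (- ln (of_nat n)) * of_nat n powr (-x)) (at x)" for n x
    proof (cases "n = 0")
      case False
      have "((\<lambda>x. of_nat n powr (-x)) has_field_derivative (ln (of_nat n) * of_nat n powr (-x)) * (-1)) (at x)"
        by (rule DERIV_chain2[of "\<lambda>z. of_nat n powr z", OF has_field_derivative_powr_right])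
          (use False in \<open>auto intro!: derivative_eq_intros\<close>)
      from DERIV_cmult[OF this, of "f n"] show ?thesis by (simp add: algebra_simps)
    qed auto
    fix x assume "x \<in> S"
    hence x: "Re x > 1" by (simp add: S_def)
    define d where "d = (Re x - 1) / 2"
    define h where "h n = complex_of_real (C * real n powr (- (1 + d)))" for n
    have C0: "C \<ge> 0" using assms(1)[of 0] norm_ge_zero[of "f 0"] by linarith
    have "cmod (f n * of_nat n powr (-y)) \<le> cmod (h n)" if "y \<in> ball x d" for n y
    proof (cases "n = 0")
      case False
      have "\<bar>Re x - Re y\<bar> < d" using that abs_Re_le_cmod[of "x - y"] by (simp add: dist_norm)
      hence "- Re y \<le> - (1 + d)" by (simp add: d_def field_simps abs_if split: if_splits)
      hence "cmod (f n) * real n powr (- Re y) \<le> C * real n powr (- (1 + d))"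
        using assms(1)[of n] False C0 by (intro mult_mono powr_mono) auto
      thus ?thesis using C0 by (simp add: h_def norm_mult norm_nat_powr)
    qed auto
    moreover have "summable h" unfolding h_def summable_complex_of_real
      using x by (intro summable_mult summable_nat_powr) (auto simp: d_def)
    moreover have "range h \<subseteq> \<real>\<^sub>\<ge>\<^sub>0" using C0 by (auto simp: h_def)
    moreover have "d > 0" using x by (simp add: d_def)
    ultimately show "\<exists>d h. 0 < d \<and> summable h \<and> range h \<subseteq> \<real>\<^sub>\<ge>\<^sub>0 \<and>
        (\<forall>\<^sub>F n in sequentially. \<forall>y\<in>ball x d \<inter> S. cmod (f n * of_nat n powr (-y)) \<le> cmod (h n))"
      by (intro exI[of _ d] exI[of _ h]) auto
  qed
  then obtain g g' where g: "\<And>x. Re x > 1 \<Longrightarrow> (\<lambda>n. f n * of_nat n powr (-x)) sums g x"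
    "\<And>x. Re x > 1 \<Longrightarrow> (\<lambda>n. f n * (- ln (of_nat n)) * of_nat n powr (-x)) sums g' x"
    "\<And>x. Re x > 1 \<Longrightarrow> (g has_field_derivative g' x) (at x)" unfolding S_def by blast
  have eq: "g x = dser f x" if "Re x > 1" for x
    using sums_unique[OF g(1)[OF that]] by (simp add: dser_def)
  have "(dser f has_field_derivative g' s) (at s)"
    by (rule has_field_derivative_transform_within_open[OF g(3)[OF assms(2)] open_halfspace_Re_gt[of 1]])
      (use assms eq in auto)
  moreover from this have "g' s = deriv (dser f) s" by (simp add: DERIV_imp_deriv)
  ultimately show "(\<lambda>n. f n * (- ln (of_nat n)) * of_nat n powr (-s)) sums deriv (dser f) s"
    "(dser f has_field_derivative deriv (dser f) s) (at s)" using g(2)[OF assms(2)] by simp_all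
qed

text \<open>
  Regrouping a double series by the value of the product of the two indices. Both the product of
  Dirichlet series and the Lambert series below are instances.
\<close>

lemma has_sum_divisors:
  fixes F :: "nat \<Rightarrow> nat \<Rightarrow> 'a::{comm_monoid_add,uniform_space,uniform_topological_group_add}"
  assumes "((\<lambda>(a, b). F a b) has_sum S) ({0<..} \<times> {0<..})"
  shows "((\<lambda>n. \<Sum>d | d dvd n. F d (n div d)) has_sum S) {0<..}"
proof (rule has_sum_Sigma'[where f = "\<lambda>(n, d). F d (n div d)" and B = "\<lambda>n. {d. d dvd n}"])
  show "((\<lambda>(n, d). F d (n div d)) has_sum S) (SIGMA n:{0<..}. {d. d dvd n})"
    using assms
    by (subst has_sum_reindex_bij_witness[where j = "\<lambda>(n, d). (d, n div d)" and i = "\<lambda>(a, b). (a * b, a)"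
          and T = "{0<..} \<times> {0<..}" and h = "\<lambda>(a, b). F a b"])
      (auto elim!: dvdE)
  fix n :: nat assume "n \<in> {0<..}"
  thus "((\<lambda>y. case (n, y) of (n, d) \<Rightarrow> F d (n div d)) has_sum (\<Sum>d | d dvd n. F d (n div d))) {d. d dvd n}"
    by (auto intro!: has_sum_finite)
qed

lemma has_sum_Times_product:
  fixes f g :: "nat \<Rightarrow> complex"
  assumes "summable (\<lambda>n. cmod (f n))" "summable (\<lambda>n. cmod (g n))" "f 0 = 0" "g 0 = 0"
  shows "((\<lambda>(a, b). f a * g b) has_sum (suminf f * suminf g)) ({0<..} \<times> {0<..})"
proof -
  have f: "(f has_sum suminf f) UNIV" "(g has_sum suminf g) UNIV"
    using assms summable_sums[OF summable_norm_cancel[OF assms(1)]] summable_sums[OF summable_norm_cancel[OF assms(2)]]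
    by (auto intro: norm_summable_imp_has_sum)
  have f': "(f has_sum suminf f) {0<..}"
    by (rule iffD1[OF has_sum_cong_neutral f(1)]) (use assms in auto)
  have g': "(g has_sum suminf g) {0<..}"
    by (rule iffD1[OF has_sum_cong_neutral f(2)]) (use assms in auto)
  have nf: "(\<lambda>n. norm (f n)) summable_on {0<..}" "(\<lambda>n. norm (g n)) summable_on {0<..}"
    using assms by (auto intro: summable_on_subset_banach[of _ UNIV] simp: summable_on_UNIV_nonneg_real_iff)
  have "(\<lambda>p. norm (case p of (a, b) \<Rightarrow> f a * g b)) summable_on ({0<..} \<times> {0<..})"
  proof (rule summable_on_SigmaI)
    show "((\<lambda>b. norm (case (a, b) of (a, b) \<Rightarrow> f a * g b)) has_sum (norm (f a) * infsum (\<lambda>n. norm (g n)) {0<..})) {0<..}"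
      for a using nf by (auto simp: norm_mult intro!: has_sum_cmult_right)
    show "(\<lambda>a. norm (f a) * infsum (\<lambda>n. norm (g n)) {0<..}) summable_on {0<..}"
      using nf by (intro summable_on_cmult_left)
  qed auto
  hence sm: "(\<lambda>(a,b). f a * g b) summable_on ({0<..} \<times> {0<..})"
    by (rule abs_summable_summable)
  show ?thesis
    by (rule has_sum_SigmaI[where g = "\<lambda>a. f a * suminf g"])
      (use f' g' sm in \<open>auto intro: has_sum_cmult_right has_sum_cmult_left\<close>)
qed

lemma dser_mult:
  assumes f: "summable (\<lambda>n. cmod (f n * of_nat n powr (-s)))"
    and g: "summable (\<lambda>n. cmod (g n * of_nat n powr (-s)))"
    and h: "\<And>n. n > 0 \<Longrightarrow> h n = (\<Sum>d | d dvd n. f d * g (n div d))"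
  shows "(\<lambda>n. h n * of_nat n powr (-s)) sums (dser f s * dser g s)"
proof -
  have "((\<lambda>n. \<Sum>d | d dvd n. (f d * of_nat d powr (-s)) * (g (n div d) * of_nat (n div d) powr (-s)))
      has_sum (dser f s * dser g s)) {0<..}"
    unfolding dser_def by (intro has_sum_divisors has_sum_Times_product f g) auto
  also have "?this \<longleftrightarrow> ((\<lambda>n. h n * of_nat n powr (-s)) has_sum (dser f s * dser g s)) {0<..}"
  proof (rule has_sum_cong)
    fix n :: nat assume n: "n \<in> {0<..}"
    have "(\<Sum>d | d dvd n. (f d * of_nat d powr (-s)) * (g (n div d) * of_nat (n div d) powr (-s)))
        = (\<Sum>d | d dvd n. f d * g (n div d) * of_nat n powr (-s))"
    proof (rule sum.cong)
      fix d assume "d \<in> {d. d dvd n}"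
      then obtain k where k: "n = d * k" by (auto elim: dvdE)
      show "(f d * of_nat d powr (-s)) * (g (n div d) * of_nat (n div d) powr (-s)) = f d * g (n div d) * of_nat n powr (-s)"
        using n unfolding k by (simp add: powr_times_real)
    qed auto
    thus "(\<Sum>d | d dvd n. (f d * of_nat d powr (-s)) * (g (n div d) * of_nat (n div d) powr (-s)))
        = h n * of_nat n powr (-s)" using h n by (simp add: sum_distrib_right)
  qed
  also have "\<dots> \<longleftrightarrow> ((\<lambda>n. h n * of_nat n powr (-s)) has_sum (dser f s * dser g s)) UNIV"
    by (rule has_sum_cong_neutral) auto
  finally show ?thesis by (rule has_sum_imp_sums)
qed

section \<open>Continuation to the right half-plane\<close>

lemma in_closed_segment_of_realE:
  assumes "z \<in> closed_segment (of_real x) (of_real y :: complex)" "x \<le> y"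
  obtains t where "z = of_real t" "x \<le> t" "t \<le> y"
  using assms by (auto simp: closed_segment_of_real closed_segment_eq_real_ivl)

text \<open>
  Mean value estimate for \<open>x \<mapsto> x powr (-s)\<close>: its derivative gains one power of \<open>x\<close>, which is what makes
  the rearranged series below converge for \<open>Re s > 0\<close>.
\<close>

lemma powr_neg_diff_bound:
  fixes x y :: real
  assumes "1 \<le> x" "x \<le> y" "Re s \<ge> 0"
  shows "cmod (of_real y powr (-s) - of_real x powr (-s)) \<le> cmod s * x powr (- Re s - 1) * (y - x)"
proof -
  let ?S = "closed_segment (of_real x) (of_real y :: complex)"
  have "cmod (of_real y powr (-s) - of_real x powr (-s)) \<le> (cmod s * x powr (- Re s - 1)) * cmod (of_real y - of_real x)"
  proof (rule field_differentiable_bound[of ?S _ "\<lambda>z. - s * z powr (-s - 1)"])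
    fix z assume "z \<in> ?S"
    then obtain t where t: "z = of_real t" "x \<le> t" "t \<le> y"
      using in_closed_segment_of_realE assms by blast
    show "((\<lambda>z. z powr - s) has_field_derivative - s * z powr (- s - 1)) (at z within ?S)"
      by (rule has_field_derivative_at_within, rule has_field_derivative_powr) (use t assms in auto)
    have "t powr (- Re s - 1) \<le> x powr (- Re s - 1)"
      using t assms by (intro powr_mono2') auto
    thus "cmod (- s * z powr (- s - 1)) \<le> cmod s * x powr (- Re s - 1)"
      using t assms by (simp add: norm_mult norm_powr_real_powr mult_left_mono)
  qed auto
  also have "cmod (of_real y - of_real x :: complex) = y - x"
    using assms by (simp flip: of_real_diff)
  finally show ?thesis .
qed

text \<open>
  Weierstrass' theorem in the form needed for continuations: near each point the majorant is a
  convergent series of real powers, and the factor \<open>P\<close> absorbs polynomial growth in \<open>s\<close>.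
\<close>

lemma holomorphic_on_suminf_halfplane:
  fixes u :: "nat \<Rightarrow> complex \<Rightarrow> complex" and P :: "real \<Rightarrow> real"
  assumes hol: "\<And>n. u n holomorphic_on {s. Re s > 0}"
    and bd: "\<And>n s. Re s > 0 \<Longrightarrow> cmod (u n s) \<le> P (cmod s) * real n powr (- 1 - Re s)"
    and P: "\<And>a b. 0 \<le> a \<Longrightarrow> a \<le> b \<Longrightarrow> P a \<le> P b"
  shows "\<And>s. Re s > 0 \<Longrightarrow> summable (\<lambda>n. u n s)"
    and "(\<lambda>s. \<Sum>n. u n s) holomorphic_on {s. Re s > 0}"
proof -
  let ?S = "{s. Re s > 0}"
  have "\<exists>g g'. \<forall>x \<in> ?S. ((\<lambda>n. u n x) sums g x) \<and> ((\<lambda>n. deriv (u n) x) sums g' x) \<and> (g has_field_derivative g' x) (at x)"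
  proof (rule series_and_derivative_comparison_complex)
    show "open ?S" by (rule open_halfspace_Re_gt)
    thus "(u n has_field_derivative deriv (u n) x) (at x)" if "x \<in> ?S" for n x
      using that hol by (intro holomorphic_derivI)
    fix x assume "x \<in> ?S"
    hence x: "Re x > 0" by simp
    define d where "d = Re x / 2"
    define K where "K = P (cmod x + d)"
    define h where "h n = complex_of_real (K * real n powr (- (1 + d)))" for n
    have d0: "d > 0" using x by (simp add: d_def)
    have K0: "P (cmod x) \<ge> 0"
      using bd[of x 1] x norm_ge_zero[of "u 1 x"] by (simp del: norm_ge_zero)
    hence K0: "K \<ge> 0" using P[of "cmod x" "cmod x + d"] d0 by (simp add: K_def)
    have "cmod (u n y) \<le> cmod (h n)" if y: "y \<in> ball x d" "Re y > 0" for n y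
    proof (cases "n = 0")
      case True
      thus ?thesis using bd[of y 0] y by simp
    next
      case False
      have "\<bar>Re x - Re y\<bar> < d" "cmod y \<le> cmod x + d"
        using y abs_Re_le_cmod[of "x - y"] norm_triangle_ineq4[of x "x - y"] by (auto simp: dist_norm)
      hence 1: "- 1 - Re y \<le> - (1 + d)" by (simp add: d_def field_simps abs_if split: if_splits)
      have "P (cmod y) \<le> K" unfolding K_def using \<open>cmod y \<le> _\<close> by (intro P) auto
      hence "P (cmod y) * real n powr (- 1 - Re y) \<le> K * real n powr (- (1 + d))"
        using 1 False K0 by (intro mult_mono powr_mono) auto
      also have "\<dots> = cmod (h n)" using K0 by (simp add: h_def norm_mult)
      finally show ?thesis using bd[of y n] y by simp
    qed
    moreover have "summable h" unfolding h_def summable_complex_of_real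
      using d0 by (intro summable_mult summable_nat_powr) auto
    moreover have "range h \<subseteq> \<real>\<^sub>\<ge>\<^sub>0" using K0 by (auto simp: h_def)
    ultimately show "\<exists>d h. 0 < d \<and> summable h \<and> range h \<subseteq> \<real>\<^sub>\<ge>\<^sub>0 \<and>
        (\<forall>\<^sub>F n in sequentially. \<forall>y\<in>ball x d \<inter> ?S. cmod (u n y) \<le> cmod (h n))"
      using d0 by (intro exI[of _ d] exI[of _ h]) auto
  qed
  then obtain g g' where g: "\<And>x. Re x > 0 \<Longrightarrow> (\<lambda>n. u n x) sums g x"
    "\<And>x. Re x > 0 \<Longrightarrow> (g has_field_derivative g' x) (at x)" by auto
  show "summable (\<lambda>n. u n s)" if "Re s > 0" for s using g(1)[OF that] by (rule sums_summable)
  have "g holomorphic_on ?S"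
    unfolding holomorphic_on_open[OF open_halfspace_Re_gt] using g(2) by auto
  thus "(\<lambda>s. \<Sum>n. u n s) holomorphic_on ?S"
    by (rule holomorphic_transform) (use g(1) in \<open>auto simp: sums_iff\<close>)
qed

text \<open>
  Summation by parts replaces \<open>f n\<close> by the bounded partial sums \<open>C n\<close> and \<open>n powr (-s)\<close> by its differences,
  which are smaller by a factor \<open>n\<close>.
\<close>

lemma dser_bounded_partial_sums:
  fixes f :: "nat \<Rightarrow> complex"
  assumes B: "\<And>N. cmod (\<Sum>k=1..N. f k) \<le> B"
  shows "\<And>s. Re s > 0 \<Longrightarrow> (\<lambda>n. f n * of_nat n powr (-s)) sums dser f s"
    and "dser f holomorphic_on {s. Re s > 0}"
proof -
  define C where "C N = (\<Sum>k=1..N. f k)" for N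
  define u where "u n s = C n * (of_nat n powr (-s) - of_nat (Suc n) powr (-s))" for n s
  have B0: "B \<ge> 0" using B[of 0] by simp
  have hol: "u n holomorphic_on {s. Re s > 0}" for n
    unfolding u_def by (cases "n = 0") (auto intro!: holomorphic_intros simp del: of_nat_Suc)
  have bd: "cmod (u n s) \<le> (B * cmod s) * real n powr (- 1 - Re s)" if "Re s > 0" for n s
  proof (cases "n = 0")
    case False
    have "cmod (of_nat n powr (-s) - of_nat (Suc n) powr (-s)) \<le> cmod s * real n powr (- Re s - 1)"
      using powr_neg_diff_bound[of "real n" "real (Suc n)" s] that False
      by (simp add: norm_minus_commute)
    moreover have "- Re s - 1 = - 1 - Re s" by simp
    ultimately have "cmod (of_nat n powr (-s) - of_nat (Suc n) powr (-s)) \<le> cmod s * real n powr (- 1 - Re s)"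
      by (simp only:)
    hence "cmod (u n s) \<le> B * (cmod s * real n powr (- 1 - Re s))"
      using B[of n] B0 unfolding u_def C_def norm_mult by (intro mult_mono) auto
    thus ?thesis by (simp add: mult.assoc)
  qed (auto simp: u_def C_def)
  have mo: "B * a \<le> B * b" if "0 \<le> a" "a \<le> b" for a b using B0 that by (intro mult_left_mono) auto
  have H1: "summable (\<lambda>n. u n s)" if "Re s > 0" for s
    by (rule holomorphic_on_suminf_halfplane(1)[of u "\<lambda>x. B * x"]) (fact hol bd mo that)+
  have H2: "(\<lambda>s. \<Sum>n. u n s) holomorphic_on {s. Re s > 0}"
    by (rule holomorphic_on_suminf_halfplane(2)[of u "\<lambda>x. B * x"]) (fact hol bd mo)+
  have part: "(\<Sum>n<Suc N. f n * of_nat n powr (-s)) = (\<Sum>n<Suc N. u n s) + C N * of_nat (Suc N) powr (-s)" for N s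
  proof (induction N)
    case (Suc N)
    have "C (Suc N) = C N + f (Suc N)" by (simp add: C_def)
    thus ?case using Suc by (simp add: u_def algebra_simps del: of_nat_Suc)
  qed (simp add: C_def u_def)
  have sums: "(\<lambda>n. f n * of_nat n powr (-s)) sums (\<Sum>n. u n s)" if s: "Re s > 0" for s
  proof -
    have "(\<lambda>N. C N * of_nat (Suc N) powr (-s)) \<longlonglongrightarrow> 0"
    proof (rule Lim_null_comparison)
      show "\<forall>\<^sub>F N in sequentially. cmod (C N * of_nat (Suc N) powr (-s)) \<le> B * real (Suc N) powr (- Re s)"
        using B by (intro always_eventually allI) (auto simp: C_def norm_mult norm_nat_powr simp del: of_nat_Suc intro!: mult_right_mono)
      show "(\<lambda>N. B * real (Suc N) powr (- Re s)) \<longlonglongrightarrow> 0" using s by real_asymp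
    qed
    moreover have "(\<lambda>N. \<Sum>n<Suc N. u n s) \<longlonglongrightarrow> (\<Sum>n. u n s)"
      using H1[OF s] summable_LIMSEQ LIMSEQ_Suc by blast
    ultimately have "(\<lambda>N. \<Sum>n<Suc N. f n * of_nat n powr (-s)) \<longlonglongrightarrow> (\<Sum>n. u n s) + 0"
      unfolding part by (intro tendsto_add)
    thus ?thesis unfolding sums_def by (subst filterlim_sequentially_Suc[symmetric]) simp
  qed
  thus "(\<lambda>n. f n * of_nat n powr (-s)) sums dser f s" if "Re s > 0" for s
    using that by (simp add: dser_def sums_iff)
  show "dser f holomorphic_on {s. Re s > 0}"
    by (rule holomorphic_transform[OF H2]) (use sums in \<open>auto simp: dser_def sums_iff\<close>)
qed

text \<open>
  This is \<open>(s - 1) \<zeta>(s)\<close>, written so that it makes sense for \<open>Re s > 0\<close>: each summand compares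
  \<open>(s - 1) n powr (-s)\<close> with the integral of \<open>(s - 1) x powr (-s)\<close> over \<open>[n, n + 1]\<close>.
\<close>

definition zeta_fac :: "complex \<Rightarrow> complex" where
  "zeta_fac s = 1 + (\<Sum>n. if n = 0 then 0 else (s - 1) * of_nat n powr (-s) + of_nat (Suc n) powr (1 - s) - of_nat n powr (1 - s))"

text \<open>
  The first order terms of the two contributions cancel; the mean value theorem is applied twice.
\<close>

lemma zeta_fac_term_bound:
  assumes "n > 0" "Re s > 0"
  shows "cmod ((s - 1) * of_nat n powr (-s) + of_nat (Suc n) powr (1 - s) - of_nat n powr (1 - s))
    \<le> (cmod s * cmod (s - 1)) * real n powr (- 1 - Re s)"
proof -
  let ?S = "closed_segment (of_real (real n)) (of_real (real (Suc n)) :: complex)"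
  let ?h = "\<lambda>z. z powr (1 - s) + (s - 1) * of_nat n powr (-s) * z"
  have "cmod (?h (of_real (real (Suc n))) - ?h (of_real (real n))) \<le> 
     (cmod s * cmod (s - 1) * real n powr (- 1 - Re s)) * cmod (of_real (real (Suc n)) - of_real (real n) :: complex)"
  proof (rule field_differentiable_bound[of ?S _ "\<lambda>z. (1 - s) * (z powr (-s) - of_nat n powr (-s))"])
    fix z assume "z \<in> ?S"
    then obtain t where t: "z = of_real t" "real n \<le> t" "t \<le> real (Suc n)"
      by (rule in_closed_segment_of_realE) auto
    have "((\<lambda>z. z powr (1 - s)) has_field_derivative (1 - s) * z powr (1 - s - 1)) (at z)"
      by (rule has_field_derivative_powr) (use t assms in auto)
    moreover have "((\<lambda>z. (s - 1) * of_nat n powr (-s) * z) has_field_derivative (s - 1) * of_nat n powr (-s)) (at z)"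
      by (auto intro!: derivative_eq_intros)
    ultimately have "(?h has_field_derivative (1 - s) * z powr (1 - s - 1) + (s - 1) * of_nat n powr (-s)) (at z)"
      by (rule DERIV_add)
    hence "(?h has_field_derivative (1 - s) * (z powr (-s) - of_nat n powr (-s))) (at z)"
      by (simp add: algebra_simps)
    thus "(?h has_field_derivative (1 - s) * (z powr (-s) - of_nat n powr (-s))) (at z within ?S)"
      by (rule has_field_derivative_at_within)
    have "cmod (of_real t powr (-s) - of_real (real n) powr (-s)) \<le> cmod s * real n powr (- Re s - 1) * (t - real n)"
      by (rule powr_neg_diff_bound) (use t assms in auto)
    also have "\<dots> \<le> cmod s * real n powr (- Re s - 1) * 1" using t by (intro mult_left_mono) auto
    finally have "cmod (1 - s) * cmod (z powr (-s) - of_nat n powr (-s)) \<le> cmod (1 - s) * (cmod s * real n powr (- Re s - 1))"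
      using t by (intro mult_left_mono) auto
    thus "cmod ((1 - s) * (z powr (-s) - of_nat n powr (-s))) \<le> cmod s * cmod (s - 1) * real n powr (- 1 - Re s)"
    proof -
      have "- Re s - 1 = - 1 - Re s" by simp
      hence "cmod (1 - s) * cmod (z powr (-s) - of_nat n powr (-s)) \<le> cmod (1 - s) * (cmod s * real n powr (- 1 - Re s))"
        using \<open>cmod (1 - s) * _ \<le> _\<close> by (simp only:)
      thus ?thesis unfolding norm_mult norm_minus_commute[of s 1] by (simp only: mult_ac)
    qed
  qed auto
  moreover have "?h (of_real (real (Suc n))) - ?h (of_real (real n)) =
      (s - 1) * of_nat n powr (-s) + of_nat (Suc n) powr (1 - s) - of_nat n powr (1 - s)"
    by (simp add: algebra_simps)
  moreover have "cmod (of_real (real (Suc n)) - of_real (real n) :: complex) = 1" by simp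
  ultimately show ?thesis by (simp only: mult_1_right)
qed

lemma zeta_fac_holomorphic: "zeta_fac holomorphic_on {s. Re s > 0}"
  and zeta_fac_1: "zeta_fac 1 = 1"
  and zeta_fac_eq: "Re s > 1 \<Longrightarrow> zeta_fac s = (s - 1) * dser (\<lambda>_. 1) s"
proof -
  define u where "u n s = (if n = 0 then 0 else (s - 1) * of_nat n powr (-s) + of_nat (Suc n) powr (1 - s) - of_nat n powr (1 - s))"
    for n :: nat and s :: complex
  have zf: "zeta_fac s = 1 + (\<Sum>n. u n s)" for s by (simp add: zeta_fac_def u_def)
  have bd: "cmod (u n s) \<le> ((cmod s + 1) * (cmod s + 1)) * real n powr (- 1 - Re s)" if "Re s > 0" for n s
  proof (cases "n = 0")
    case False
    have "cmod (u n s) \<le> (cmod s * cmod (s - 1)) * real n powr (- 1 - Re s)"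
      using zeta_fac_term_bound[of n s] False that by (simp add: u_def)
    also have "\<dots> \<le> ((cmod s + 1) * (cmod s + 1)) * real n powr (- 1 - Re s)"
      using norm_triangle_ineq4[of s 1] by (intro mult_right_mono mult_mono) auto
    finally show ?thesis .
  qed (auto simp: u_def)
  have mo: "(a + 1) * (a + 1) \<le> (b + 1) * (b + 1)" if "0 \<le> a" "a \<le> b" for a b :: real
    using that by (intro mult_mono) auto
  have hol: "u n holomorphic_on {s. Re s > 0}" for n
    unfolding u_def by (cases "n = 0") (auto intro!: holomorphic_intros simp del: of_nat_Suc)
  have H1: "summable (\<lambda>n. u n s)" if "Re s > 0" for s
    by (rule holomorphic_on_suminf_halfplane(1)[of u "\<lambda>x. (x + 1) * (x + 1)"]) (fact hol bd mo that)+
  have H2: "(\<lambda>s. \<Sum>n. u n s) holomorphic_on {s. Re s > 0}"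
    by (rule holomorphic_on_suminf_halfplane(2)[of u "\<lambda>x. (x + 1) * (x + 1)"]) (fact hol bd mo)+
  show "zeta_fac holomorphic_on {s. Re s > 0}"
    by (rule holomorphic_transform[of "\<lambda>s. 1 + (\<Sum>n. u n s)"])
      (auto simp: zf intro!: holomorphic_on_add holomorphic_on_const H2)
  have "u n 1 = 0" for n by (cases "n = 0") (simp_all add: u_def del: of_nat_Suc)
  thus "zeta_fac 1 = 1" by (simp add: zf)
  assume s: "Re s > 1"
  have part: "1 + (\<Sum>n<Suc N. u n s) = (s - 1) * (\<Sum>n<Suc N. 1 * of_nat n powr (-s)) + of_nat (Suc N) powr (1 - s)" for N
  proof (induction N)
    case (Suc N)
    have "u (Suc N) s = (s - 1) * of_nat (Suc N) powr (-s) + of_nat (Suc (Suc N)) powr (1 - s) - of_nat (Suc N) powr (1 - s)"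
      by (simp add: u_def)
    thus ?case using Suc.IH unfolding sum.lessThan_Suc[of _ "Suc N"] by algebra
  qed (simp add: u_def)
  have "(\<lambda>N. of_nat (Suc N) powr (1 - s) :: complex) \<longlonglongrightarrow> 0"
  proof (rule Lim_null_comparison)
    show "\<forall>\<^sub>F N in sequentially. cmod (of_nat (Suc N) powr (1 - s)) \<le> real (Suc N) powr (1 - Re s)"
      by (intro always_eventually allI) (auto simp: norm_nat_powr simp del: of_nat_Suc)
    show "(\<lambda>N. real (Suc N) powr (1 - Re s)) \<longlonglongrightarrow> 0" using s by real_asymp
  qed
  moreover have "(\<lambda>N. \<Sum>n<Suc N. 1 * of_nat n powr (-s)) \<longlonglongrightarrow> dser (\<lambda>_. 1) s"
    using dser_sums[of "\<lambda>_. 1" 1 s] s unfolding sums_def by (intro LIMSEQ_Suc) auto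
  ultimately have "(\<lambda>N. 1 + (\<Sum>n<Suc N. u n s)) \<longlonglongrightarrow> (s - 1) * dser (\<lambda>_. 1) s + 0"
    unfolding part by (intro tendsto_intros)
  moreover have "(\<lambda>N. 1 + (\<Sum>n<Suc N. u n s)) \<longlonglongrightarrow> 1 + (\<Sum>n. u n s)"
    using H1[of s] s by (intro tendsto_intros LIMSEQ_Suc summable_LIMSEQ) auto
  ultimately show "zeta_fac s = (s - 1) * dser (\<lambda>_. 1) s"
    unfolding zf using LIMSEQ_unique by fastforce
qed

section \<open>Newman's Tauberian theorem\<close>

lemma powr_diff_bounds:
  fixes a :: real
  assumes "a \<noteq> 0" "n > 0"
  shows "(real (Suc n) powr a - real n powr a) / a \<ge> min (real n powr (a - 1)) (real (Suc n) powr (a - 1))"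
proof -
  have "\<exists>z. real n < z \<and> z < real (Suc n) \<and>
      real (Suc n) powr a - real n powr a = (real (Suc n) - real n) * (a * z powr (a - 1))"
    using assms by (intro MVT2) (auto intro!: derivative_eq_intros simp: powr_diff field_simps)
  then obtain z where z: "real n < z" "z < real (Suc n)"
      "real (Suc n) powr a - real n powr a = a * z powr (a - 1)" by auto
  have "min (real n powr (a - 1)) (real (Suc n) powr (a - 1)) \<le> z powr (a - 1)"
  proof (cases "a \<ge> 1")
    case True
    hence "real n powr (a - 1) \<le> z powr (a - 1)" using z by (intro powr_mono2) auto
    thus ?thesis by simp
  next
    case False
    hence "real (Suc n) powr (a - 1) \<le> z powr (a - 1)" using z assms by (intro powr_mono2') auto
    thus ?thesis by linarith
  qed
  thus ?thesis using z assms by simp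
qed

lemma sum_powr_tail_le:
  fixes x :: real
  assumes "x > 0" "N > 0"
  shows "summable (\<lambda>n. real (n + Suc N) powr (- 1 - x))"
    and "(\<Sum>n. real (n + Suc N) powr (- 1 - x)) \<le> real N powr (- x) / x"
proof -
  have step: "real (n + Suc N) powr (- 1 - x) \<le> (real (n + N) powr (-x) - real (Suc (n + N)) powr (-x)) / x" for n
  proof -
    have "min (real (n+N) powr (- x - 1)) (real (Suc (n+N)) powr (- x - 1)) = real (Suc (n+N)) powr (- x - 1)"
      using assms by (intro min_absorb2 powr_mono2') auto
    thus ?thesis using powr_diff_bounds[of "-x" "n + N"] assms
      by (simp add: field_simps minus_diff_commute)
  qed
  have lim: "(\<lambda>n. real (n + N) powr (-x)) \<longlonglongrightarrow> 0"
    using assms by real_asymp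
  have "(\<lambda>n. real (n + N) powr (-x) - real (Suc n + N) powr (-x)) sums (real (0 + N) powr (-x) - 0)"
    by (rule telescope_sums'[OF lim])
  hence S: "(\<lambda>n. (real (n + N) powr (-x) - real (Suc (n + N)) powr (-x)) / x) sums (real N powr (-x) / x)"
    using sums_divide[of _ _ x] by force
  show "summable (\<lambda>n. real (n + Suc N) powr (- 1 - x))"
    by (rule summable_comparison_test'[OF sums_summable[OF S], of 0]) (use step in auto)
  thus "(\<Sum>n. real (n + Suc N) powr (- 1 - x)) \<le> real N powr (- x) / x"
    using suminf_le[OF step _ sums_summable[OF S]] sums_unique[OF S] by simp
qed

text \<open>
  Comparison with the integral of \<open>x powr (y - 1)\<close>. The direction of monotonicity depends on the sign of
  \<open>y - 1\<close>; the last summand is added so that one bound covers both cases.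
\<close>

lemma sum_powr_head_le:
  fixes y :: real
  assumes "y > 0" "N > 0"
  shows "(\<Sum>n = 1..N. real n powr (y - 1)) \<le> real N powr y / y + real N powr (y - 1)"
proof (cases "y \<ge> 1")
  case True
  have step: "real n powr (y - 1) \<le> (real (Suc n) powr y - real n powr y) / y" if "n > 0" for n
  proof -
    have "min (real n powr (y - 1)) (real (Suc n) powr (y - 1)) = real n powr (y - 1)"
      using True by (intro min_absorb1 powr_mono2) auto
    thus ?thesis using powr_diff_bounds[of y n] that assms by simp
  qed
  have "(\<Sum>n = 1..N. real n powr (y - 1)) \<le> real N powr y / y + real N powr (y - 1)" if "N \<ge> 1" for N
    using that
  proof (induction N rule: dec_induct)
    case base thus ?case using assms by simp
  next
    case (step n)
    thus ?case using \<open>\<And>n. n > 0 \<Longrightarrow> _\<close>[of n] by (simp add: diff_divide_distrib)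
  qed
  thus ?thesis using assms by simp
next
  case False
  have step: "real (Suc n) powr (y - 1) \<le> (real (Suc n) powr y - real n powr y) / y" for n
  proof (cases "n = 0")
    case False
    hence "min (real n powr (y - 1)) (real (Suc n) powr (y - 1)) = real (Suc n) powr (y - 1)"
      using \<open>\<not> 1 \<le> y\<close> by (intro min_absorb2 powr_mono2') auto
    thus ?thesis using powr_diff_bounds[of y n] False assms by simp
  qed (use False assms in \<open>auto simp: field_simps\<close>)
  have "(\<Sum>n = 1..N. real n powr (y - 1)) \<le> real N powr y / y" for N
  proof (induction N)
    case (Suc n)
    thus ?case using step[of n] by (simp add: diff_divide_distrib)
  qed auto
  thus ?thesis by (smt (verit) powr_ge_zero)
qed

text \<open>
  A Riemann-Lebesgue estimate on a segment of the imaginary axis: \<open>N powr z\<close> has modulus 1 there and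
  derivative \<open>ln N\<close> times itself, so integration by parts gains a factor \<open>ln N\<close>.
\<close>

lemma riemann_lebesgue_chord:
  assumes G: "G holomorphic_on V" and V: "open V" and seg: "closed_segment a b \<subseteq> V"
    and a0: "Re a = 0" and b0: "Re b = 0"
  obtains K where "\<And>N::nat. N \<ge> 2 \<Longrightarrow>
    cmod (contour_integral (linepath a b) (\<lambda>z. G z * of_nat N powr z)) \<le> K / ln N"
proof -
  have G': "deriv G holomorphic_on V" using G V by (rule holomorphic_deriv)
  have cont: "continuous_on (closed_segment a b) G" "continuous_on (closed_segment a b) (deriv G)"
    using G G' seg by (auto intro: holomorphic_on_imp_continuous_on holomorphic_on_subset)
  obtain B where B: "\<And>z. z \<in> closed_segment a b \<Longrightarrow> cmod (G z) \<le> B"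
    using compact_imp_bounded[OF compact_continuous_image[OF cont(1)]] by (force simp: bounded_iff)
  obtain B' where B': "\<And>z. z \<in> closed_segment a b \<Longrightarrow> cmod (deriv G z) \<le> B'"
    using compact_imp_bounded[OF compact_continuous_image[OF cont(2)]] by (force simp: bounded_iff)
  have B0: "B' \<ge> 0" using B'[of a] norm_ge_zero[of "deriv G a"] by (simp del: norm_ge_zero)
  have Re0: "Re z = 0" if "z \<in> closed_segment a b" for z
    using that a0 b0 by (auto simp: closed_segment_def)
  define K where "K = 2 * B + B' * cmod (b - a)"
  have "cmod (contour_integral (linepath a b) (\<lambda>z. G z * of_nat N powr z)) \<le> K / ln N" if N: "N \<ge> 2" for N :: nat
  proof -
    let ?E = "\<lambda>z. of_nat N powr z :: complex"
    let ?I = "contour_integral (linepath a b) (\<lambda>z. G z * ?E z)"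
    have lnN: "ln (real N) > 0" using N by simp
    have En: "cmod (?E z) = 1" if "z \<in> closed_segment a b" for z
      using N Re0[OF that] by (simp add: norm_powr_real_powr)
    have cE: "continuous_on (closed_segment a b) ?E"
      using N by (intro continuous_intros) auto
    have int1: "(\<lambda>z. G z * ?E z) contour_integrable_on linepath a b"
      and int2: "(\<lambda>z. deriv G z * ?E z) contour_integrable_on linepath a b"
      by (intro contour_integrable_continuous_linepath continuous_intros cont cE)+
    have d: "((\<lambda>z. G z * ?E z) has_field_derivative (deriv G z * ?E z + ln (of_nat N) * (G z * ?E z)))
        (at z within closed_segment a b)" if "z \<in> closed_segment a b" for z
    proof -
      have "(G has_field_derivative deriv G z) (at z)"
        using G V seg that by (auto intro: holomorphic_derivI)
      moreover have "(?E has_field_derivative ln (of_nat N) * ?E z) (at z)"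
        using N by (intro has_field_derivative_powr_right) auto
      ultimately have "((\<lambda>z. G z * ?E z) has_field_derivative (G z * (ln (of_nat N) * ?E z) + deriv G z * ?E z)) (at z)"
        by (rule DERIV_mult')
      hence "((\<lambda>z. G z * ?E z) has_field_derivative (deriv G z * ?E z + ln (of_nat N) * (G z * ?E z))) (at z)"
        by (simp add: algebra_simps)
      thus ?thesis by (rule has_field_derivative_at_within)
    qed
    have "((\<lambda>z. deriv G z * ?E z + ln (of_nat N) * (G z * ?E z)) has_contour_integral
        (G (pathfinish (linepath a b)) * ?E (pathfinish (linepath a b))
          - G (pathstart (linepath a b)) * ?E (pathstart (linepath a b)))) (linepath a b)"
      by (rule contour_integral_primitive[of "closed_segment a b"]) (use d in auto)
    hence "contour_integral (linepath a b) (\<lambda>z. deriv G z * ?E z + ln (of_nat N) * (G z * ?E z))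
        = G b * ?E b - G a * ?E a" by (auto dest: contour_integral_unique)
    also have "contour_integral (linepath a b) (\<lambda>z. deriv G z * ?E z + ln (of_nat N) * (G z * ?E z))
        = contour_integral (linepath a b) (\<lambda>z. deriv G z * ?E z) + ln (of_nat N) * ?I"
      using int1 int2 by (subst contour_integral_add) (auto simp: contour_integrable_lmul contour_integral_lmul)
    finally have eq: "ln (of_nat N) * ?I = G b * ?E b - G a * ?E a - contour_integral (linepath a b) (\<lambda>z. deriv G z * ?E z)"
      by (simp add: algebra_simps)
    have b1: "cmod (contour_integral (linepath a b) (\<lambda>z. deriv G z * ?E z)) \<le> B' * cmod (b - a)"
      by (rule contour_integral_bound_linepath[OF int2 B0]) (use B' En in \<open>auto simp: norm_mult\<close>)
    have "cmod (G b * ?E b) \<le> B" "cmod (G a * ?E a) \<le> B" using B En by (auto simp: norm_mult)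
    hence "cmod (ln (of_nat N) * ?I) \<le> K" unfolding eq K_def
      using b1 norm_triangle_ineq4[of "G b * ?E b - G a * ?E a" "contour_integral (linepath a b) (\<lambda>z. deriv G z * ?E z)"]
       norm_triangle_ineq4[of "G b * ?E b" "G a * ?E a"] by linarith
    moreover have "cmod (ln (of_nat N)) = ln (real N)"
      using lnN N by (subst of_real_of_nat_eq[symmetric], subst Ln_of_real) auto
    ultimately show ?thesis using lnN by (simp add: norm_mult field_simps)
  qed
  thus ?thesis using that by blast
qed

text \<open>
  The contour below is composed of two half-circles; together they wind once around 0.
\<close>

lemma winding_number_half_circle:
  assumes "R > 0"
  shows "winding_number (part_circlepath 0 R a (a + pi)) 0 = 1 / 2"
proof -
  have "0 \<notin> path_image (part_circlepath 0 R a (a + pi))"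
    using in_path_image_part_circlepath[of 0 0 R a "a + pi"] assms by auto
  hence "winding_number (part_circlepath 0 R a (a + pi)) 0 =
      1/(2*pi*\<i>) * contour_integral (part_circlepath 0 R a (a + pi)) (\<lambda>w. 1/(w - 0))"
    by (intro winding_number_valid_path) auto
  also have "contour_integral (part_circlepath 0 R a (a + pi)) (\<lambda>w. 1/(w - 0)) = integral {a..a+pi} (\<lambda>t. \<i>)"
    using assms by (subst contour_integral_part_circlepath_eq) (auto simp: field_simps)
  finally show ?thesis by (simp add: scaleR_conv_of_real)
qed

text \<open>
  On the circle of radius \<open>R\<close> the inverse of \<open>z\<close> is its conjugate over \<open>R\<^sup>2\<close>, so Newman's kernel is
  \<open>2 Re z / R\<^sup>2\<close>. Its zeros at \<open>\<plusminus> \<i> R\<close> compensate the poles \<open>1 / Re z\<close> in the estimates for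
  tails and for partial sums.
\<close>

lemma circle_kernel:
  assumes "cmod z = R" "R > 0"
  shows "cmod ((1 + z\<^sup>2 / R\<^sup>2) / z) = 2 * \<bar>Re z\<bar> / R\<^sup>2"
proof -
  have z: "z \<noteq> 0" using assms by auto
  have "(of_real R)\<^sup>2 = z * cnj z" using assms complex_norm_square[of z] by simp
  hence "(1 + z\<^sup>2 / R\<^sup>2) / z = (z + cnj z) / R\<^sup>2"
    using z by (simp add: field_simps power2_eq_square)
  thus ?thesis using assms by (simp add: complex_add_cnj norm_divide norm_power norm_mult)
qed

text \<open>
  Newman's contour argument for \<open>F 1 = 0\<close>. The partial sum \<open>S\<close> is entire, so Cauchy's formula over the
  full circle gives \<open>S 0\<close>. On the right half of the circle \<open>F\<close> may be subtracted from \<open>S\<close>: the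
  corresponding integral of \<open>F\<close> equals an integral over the diameter, as \<open>F\<close> is holomorphic up to the
  line and \<open>F 1 = 0\<close> removes the pole of the kernel. What remains is a tail on the right, a partial sum
  on the left, both of size \<open>C / R\<close> up to \<open>C / N\<close>, and the diameter, where Riemann-Lebesgue applies.
\<close>

lemma newman_bound:
  fixes a :: "nat \<Rightarrow> complex"
  assumes a: "\<And>n. cmod (a n) \<le> C"
    and U: "open U" "{s. Re s \<ge> 1} \<subseteq> U" and F: "F holomorphic_on U" "F 1 = 0"
    and sums: "\<And>s. Re s > 1 \<Longrightarrow> (\<lambda>n. a n * of_nat n powr (-s)) sums F s"
    and R: "R > 0"
  obtains K where "\<And>N. N \<ge> 2 \<Longrightarrow> cmod (\<Sum>n=1..N. a n / n) \<le> 2 * C / R + C / N + K / ln N"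
proof -
  have C0: "C \<ge> 0" using a[of 0] norm_ge_zero[of "a 0"] by linarith
  define V where "V = (\<lambda>z. z + 1) -` U"
  have oV: "open V" unfolding V_def by (intro continuous_open_vimage U) (auto intro!: continuous_intros)
  have VS: "{z. Re z \<ge> 0} \<subseteq> V" using U(2) by (auto simp: V_def intro!: subsetD[OF U(2)])
  have FV: "(\<lambda>z. F (z + 1)) holomorphic_on V"
    using holomorphic_on_compose_gen[of "\<lambda>z. z + 1" V F U] F
    by (simp add: V_def o_def holomorphic_on_add holomorphic_on_id image_subset_iff)
  \<comment> \<open>The quotient \<open>F (z + 1) / z\<close> with its removable singularity filled in.\<close>
  define Q where "Q z = (if z = 0 then deriv (\<lambda>z. F (z + 1)) 0 else F (z + 1) / z)" for z
  have Q: "Q holomorphic_on V"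
    by (rule pole_theorem_open_0[OF FV oV, of 0]) (auto simp: Q_def F)
  define G where "G z = Q z * (1 + z\<^sup>2 / (of_real R)\<^sup>2)" for z
  have G: "G holomorphic_on V" unfolding G_def using R by (intro holomorphic_intros Q) auto
  define rt where "rt = part_circlepath 0 R (-pi/2) (-pi/2 + pi)"
  define lt where "lt = part_circlepath 0 R (pi/2) (pi/2 + pi)"
  have pi3: "pi / 2 + pi = 3 * pi / 2" "- pi / 2 + pi = pi / 2" by simp_all
  have "cis (3 * pi / 2) = -\<i>" 
  proof -
    have "3 * pi / 2 = 3 / 2 * pi" by simp
    thus ?thesis by (simp only: cos_3over2_pi sin_3over2_pi complex_eq_iff cis.sel) simp
  qed
  hence ends: "pathstart rt = - \<i> * R" "pathfinish rt = \<i> * R" "pathstart lt = \<i> * R" "pathfinish lt = - \<i> * R"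
    unfolding rt_def lt_def pathstart_part_circlepath pathfinish_part_circlepath pi3 cis_conv_exp[symmetric]
    by (simp_all add: cis_minus_pi_half)
  have vp: "valid_path rt" "valid_path lt" by (auto simp: rt_def lt_def)
  have ends_only: "z \<in> {-\<i>*R, \<i>*R}" if "cmod z = R" "Re z = 0" for z
  proof -
    have "\<bar>Im z\<bar> = R" using that cmod_eq_Im[of z] by simp
    thus ?thesis using that by (auto simp: complex_eq_iff abs_if split: if_splits)
  qed
  have rt_im: "z \<in> path_image rt \<Longrightarrow> cmod z = R \<and> Re z \<ge> 0 \<and> (Re z = 0 \<longrightarrow> z \<in> {-\<i>*R, \<i>*R})" for z
  proof -
    assume "z \<in> path_image rt"
    then obtain t where t: "z = of_real R * cis t" "t \<in> closed_segment (-pi/2) (-pi/2 + pi)"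
      unfolding rt_def path_image_part_circlepath' by auto
    hence "-pi/2 \<le> t" "t \<le> pi/2" by (simp_all add: closed_segment_eq_real_ivl)
    note t = this t(1)
    have "cos t \<ge> 0" using t by (intro cos_ge_zero) auto
    moreover have "cmod z = R" using t R by (simp add: norm_mult)
    ultimately show ?thesis using t R ends_only[of z] by simp
  qed
  have lt_im: "z \<in> path_image lt \<Longrightarrow> cmod z = R \<and> Re z \<le> 0 \<and> (Re z = 0 \<longrightarrow> z \<in> {-\<i>*R, \<i>*R})" for z
  proof -
    assume "z \<in> path_image lt"
    then obtain t where t: "z = of_real R * cis t" "t \<in> closed_segment (pi/2) (pi/2 + pi)"
      unfolding lt_def path_image_part_circlepath' by auto
    hence "pi/2 \<le> t" "t \<le> pi/2 + pi" by (simp_all add: closed_segment_eq_real_ivl)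
    note t = this t(1)
    have "cos (t - pi) \<ge> 0" using t by (intro cos_ge_zero) auto
    hence "cos t \<le> 0" by (simp add: cos_diff)
    moreover have "cmod z = R" using t R by (simp add: norm_mult)
    ultimately show ?thesis using t R ends_only[of z] by (simp add: mult_le_0_iff)
  qed
  obtain K where K: "\<And>N::nat. N \<ge> 2 \<Longrightarrow>
    cmod (contour_integral (linepath (\<i> * R) (- \<i> * R)) (\<lambda>z. G z * of_nat N powr z)) \<le> K / ln N"
  proof (rule riemann_lebesgue_chord[OF G oV])
    show "closed_segment (\<i> * R) (- \<i> * R) \<subseteq> V"
      using VS by (auto simp: closed_segment_def intro!: subsetD[OF VS])
  qed auto
  have "cmod (\<Sum>n=1..N. a n / n) \<le> 2 * C / R + C / N + (K / (2 * pi)) / ln N" if N: "N \<ge> 2" for N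
  proof -
    define S where "S z = (\<Sum>n=1..N. a n * of_nat n powr (-1 - z))" for z
    \<comment> \<open>\<open>g\<close> is the integrand over the full circle, \<open>H\<close> the one over the right half-disc.\<close>
    define g where "g z = S z * of_nat N powr z * (1 + z\<^sup>2 / (of_real R)\<^sup>2) / (z - 0)" for z
    define H where "H z = G z * of_nat N powr z" for z
    have Shol: "(\<lambda>z. S z * of_nat N powr z * (1 + z\<^sup>2 / (of_real R)\<^sup>2)) holomorphic_on UNIV"
      unfolding S_def using R N by (intro holomorphic_intros) auto
    have n0: "0 \<notin> path_image rt" "0 \<notin> path_image lt" using rt_im[of 0] lt_im[of 0] R by auto
    have w: "winding_number rt 0 = 1 / 2" "winding_number lt 0 = 1 / 2"
      unfolding rt_def lt_def by (rule winding_number_half_circle[OF R])+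
    have "winding_number (rt +++ lt) 0 = winding_number rt 0 + winding_number lt 0"
      using n0 vp ends by (intro winding_number_join) (auto simp: valid_path_imp_path)
    hence wind: "winding_number (rt +++ lt) 0 = 1" unfolding w by simp
    have "(g has_contour_integral (2*pi * \<i> * winding_number (rt +++ lt) 0 *
        (S 0 * of_nat N powr 0 * (1 + 0\<^sup>2 / (of_real R)\<^sup>2)))) (rt +++ lt)"
      unfolding g_def
      by (rule Cauchy_integral_formula_convex_simple[OF _ Shol])
        (use vp ends n0 in \<open>auto simp: path_image_join\<close>)
    hence full: "(g has_contour_integral (2*pi * \<i> * S 0)) (rt +++ lt)" using N by (simp add: wind)
    hence "g contour_integrable_on (rt +++ lt)" by (rule has_contour_integral_integrable)
    hence gi: "g contour_integrable_on rt" "g contour_integrable_on lt"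
      using vp ends by auto
    have split: "2*pi * \<i> * S 0 = contour_integral rt g + contour_integral lt g"
      using full contour_integral_unique[OF full] gi vp ends by (simp add: contour_integral_join)
    have Hhol: "H holomorphic_on V" unfolding H_def using N by (intro holomorphic_intros G) auto
    have H0: "(H has_contour_integral 0) (rt +++ linepath (\<i> * R) (- \<i> * R))"
    proof (rule Cauchy_theorem_convex[of "{z. Re z \<ge> 0}" _ "{}"])
      show "continuous_on {z. 0 \<le> Re z} H" 
        using Hhol VS by (auto intro: holomorphic_on_imp_continuous_on holomorphic_on_subset)
      show "convex {z. 0 \<le> Re z}" by (rule convex_halfspace_Re_ge)
      show "H field_differentiable at x" if "x \<in> interior {z. 0 \<le> Re z} - {}" for x
        using that Hhol oV VS interior_subset[of "{z. 0 \<le> Re z}"] by (auto simp: holomorphic_on_open field_differentiable_def)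
      show "path_image (rt +++ linepath (\<i> * R) (- \<i> * R)) \<subseteq> {z. 0 \<le> Re z}"
        using ends rt_im by (auto simp: path_image_join closed_segment_def)
    qed (use vp ends in auto)
    hence "H contour_integrable_on (rt +++ linepath (\<i> * R) (- \<i> * R))"
      by (rule has_contour_integral_integrable)
    hence Hi: "H contour_integrable_on rt" "H contour_integrable_on linepath (\<i> * R) (- \<i> * R)"
      using vp ends by auto
    have "contour_integral (rt +++ linepath (\<i> * R) (- \<i> * R)) H = 0"
      using H0 by (rule contour_integral_unique)
    hence Hs: "contour_integral rt H = - contour_integral (linepath (\<i> * R) (- \<i> * R)) H"
      using vp ends Hi by (simp add: contour_integral_join add_eq_0_iff2)
    have Nz: "cmod (of_nat N powr z) = real N powr Re z" for z :: complex
      using N by (simp add: norm_powr_real_powr)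
    have nz: "cmod (of_nat n powr z) = real n powr Re z" for z :: complex and n
      by (simp add: norm_powr_real_powr)
    have right: "cmod (contour_integral rt (\<lambda>z. g z - H z)) \<le> (2 * C / R\<^sup>2) * R * (-pi/2 + pi - (-pi/2))"
    proof (rule has_contour_integral_bound_part_circlepath_strong)
      show "((\<lambda>z. g z - H z) has_contour_integral contour_integral rt (\<lambda>z. g z - H z)) (part_circlepath 0 R (-pi/2) (-pi/2 + pi))"
        using gi Hi contour_integrable_diff[OF gi(1) Hi(1)] by (simp add: rt_def has_contour_integral_integral)
      show "finite {-\<i>*R, \<i>*R}" by simp
      fix z assume z: "z \<in> path_image (part_circlepath 0 R (- pi / 2) (- pi / 2 + pi)) - {-\<i>*R, \<i>*R}"
      have "z \<in> path_image rt" "z \<noteq> -\<i>*R" "z \<noteq> \<i>*R" using z unfolding rt_def by blast+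
      hence zz: "cmod z = R" "Re z > 0" "z \<noteq> 0" using rt_im[of z] R by (auto simp: order.order_iff_strict)
      \<comment> \<open>Near the imaginary axis this blows up like \<open>1 / Re z\<close>; the kernel cancels the factor.\<close>
      have tail: "cmod (S z - F (z + 1)) \<le> C * (real N powr (- Re z) / Re z)"
      proof -
        have "(\<lambda>n. a n * of_nat n powr (-(z+1))) sums F (z + 1)" using zz by (intro sums) auto
        hence "(\<lambda>n. a (n + Suc N) * of_nat (n + Suc N) powr (-(z+1))) sums
          (F (z + 1) - (\<Sum>n<Suc N. a n * of_nat n powr (-(z+1))))"
          by (rule sums_split_initial_segment)
        moreover have "(\<Sum>n<Suc N. a n * of_nat n powr (-(z+1))) = S z"
          unfolding S_def by (rule sum.mono_neutral_cong_right) (auto simp: Suc_le_eq  intro!: arg_cong2[of _ _ _ _ "(powr)"])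
        ultimately have s1: "(\<lambda>n. a (n + Suc N) * of_nat (n + Suc N) powr (-(z+1))) sums (F (z + 1) - S z)" by simp
        have le: "cmod (a (n + Suc N) * of_nat (n + Suc N) powr (-(z+1))) \<le> C * real (n + Suc N) powr (- 1 - Re z)" for n
        proof -
          have "Re (- (z + 1)) = - 1 - Re z" by simp
          thus ?thesis unfolding norm_mult nz using a C0 by (simp only:) (intro mult_mono, auto)
        qed
        have sm: "summable (\<lambda>n. C * real (n + Suc N) powr (- 1 - Re z))"
          using sum_powr_tail_le(1)[of "Re z" N] zz N by (intro summable_mult) auto
        have "cmod (F (z + 1) - S z) \<le> (\<Sum>n. C * real (n + Suc N) powr (- 1 - Re z))"
          unfolding sums_unique[OF s1] using le sm by (rule norm_suminf_le)
        also have "\<dots> = C * (\<Sum>n. real (n + Suc N) powr (- 1 - Re z))"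
          using sum_powr_tail_le(1)[of "Re z" N] zz N by (subst suminf_mult) auto
        also have "\<dots> \<le> C * (real N powr (- Re z) / Re z)"
          using sum_powr_tail_le(2)[of "Re z" N] zz N C0 by (intro mult_left_mono) auto
        finally show ?thesis by (simp add: norm_minus_commute)
      qed
      have "g z - H z = (S z - F (z + 1)) * of_nat N powr z * ((1 + z\<^sup>2 / R\<^sup>2) / z)"
        using zz by (simp add: g_def H_def G_def Q_def field_simps)
      hence "cmod (g z - H z) = cmod (S z - F (z + 1)) * real N powr Re z * (2 * Re z / R\<^sup>2)"
        using circle_kernel[OF zz(1) R] zz(2) by (simp only: norm_mult Nz abs_of_pos)
      also have "\<dots> \<le> C * (real N powr (- Re z) / Re z) * real N powr Re z * (2 * Re z / R\<^sup>2)"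
        using tail zz by (intro mult_right_mono) auto
      also have "\<dots> = 2 * C / R\<^sup>2" using zz N by (simp add: powr_minus field_simps)
      finally show "cmod (g z - H z) \<le> 2 * C / R\<^sup>2" .
    qed (use C0 R in auto)
    have left: "cmod (contour_integral lt g) \<le> (2 * C / R\<^sup>2 + 2 * C / (N * R)) * R * (pi/2 + pi - pi/2)"
    proof (rule has_contour_integral_bound_part_circlepath_strong)
      show "(g has_contour_integral contour_integral lt g) (part_circlepath 0 R (pi/2) (pi/2 + pi))"
        using gi by (simp add: lt_def has_contour_integral_integral)
      show "finite {-\<i>*R, \<i>*R}" by simp
      fix z assume z: "z \<in> path_image (part_circlepath 0 R (pi / 2) (pi / 2 + pi)) - {-\<i>*R, \<i>*R}"
      have "z \<in> path_image lt" "z \<noteq> -\<i>*R" "z \<noteq> \<i>*R" using z unfolding lt_def by blast+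
      hence zz: "cmod z = R" "Re z < 0" "z \<noteq> 0" using lt_im[of z] R by (auto simp: order.order_iff_strict)
      define y where "y = - Re z"
      have y: "y > 0" "y \<le> R" using zz abs_Re_le_cmod[of z] by (auto simp: y_def)
      have "cmod (S z) \<le> (\<Sum>n=1..N. C * real n powr (y - 1))"
        unfolding S_def
      proof (rule sum_norm_le)
        fix n
        have "Re (-1 - z) = y - 1" by (simp add: y_def)
        thus "cmod (a n * of_nat n powr (-1 - z)) \<le> C * real n powr (y - 1)"
          unfolding norm_mult nz using a C0 by (simp only:) (intro mult_mono, auto)
      qed
      also have "\<dots> = C * (\<Sum>n=1..N. real n powr (y - 1))" by (simp add: sum_distrib_left)
      also have "\<dots> \<le> C * (real N powr y / y + real N powr (y - 1))"
        using sum_powr_head_le[of y N] y N C0 by (intro mult_left_mono) auto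
      finally have Sb: "cmod (S z) \<le> C * (real N powr y / y + real N powr (y - 1))" .
      have "g z = S z * of_nat N powr z * ((1 + z\<^sup>2 / R\<^sup>2) / z)" by (simp add: g_def)
      hence "cmod (g z) = cmod (S z) * real N powr (-y) * (2 * y / R\<^sup>2)"
        using circle_kernel[OF zz(1) R] zz(2) by (simp only: norm_mult Nz y_def abs_of_neg minus_minus)
      also have "\<dots> \<le> (C * (real N powr y / y + real N powr (y - 1))) * real N powr (-y) * (2 * y / R\<^sup>2)"
        using Sb y by (intro mult_right_mono) auto
      also have "\<dots> = 2 * C / R\<^sup>2 + (2 * C / (N * R)) * (y / R)" using y N R
        by (simp add: powr_minus powr_diff field_simps power2_eq_square)
      also have "\<dots> \<le> 2 * C / R\<^sup>2 + (2 * C / (N * R)) * 1" using y R C0 N by (intro add_left_mono mult_left_mono) auto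
      finally show "cmod (g z) \<le> 2 * C / R\<^sup>2 + 2 * C / (N * R)" by simp
    qed (use C0 R in auto)
    have "contour_integral rt g = contour_integral rt (\<lambda>z. g z - H z) - contour_integral (linepath (\<i> * R) (- \<i> * R)) H"
      using gi Hi Hs by (simp add: contour_integral_diff)
    hence "2*pi * \<i> * S 0 = contour_integral rt (\<lambda>z. g z - H z) - contour_integral (linepath (\<i> * R) (- \<i> * R)) H
       + contour_integral lt g" using split by simp
    hence "cmod (2*pi * \<i> * S 0) \<le> cmod (contour_integral rt (\<lambda>z. g z - H z)) 
       + cmod (contour_integral (linepath (\<i> * R) (- \<i> * R)) H) + cmod (contour_integral lt g)"
      by (smt (verit) norm_triangle_ineq norm_triangle_ineq4)
    also have "\<dots> \<le> (2 * C / R\<^sup>2) * R * pi + K / ln N + (2 * C / R\<^sup>2 + 2 * C / (N * R)) * R * pi"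
    proof -
      have "H = (\<lambda>z. G z * of_nat N powr z)" by (simp add: fun_eq_iff H_def)
      hence "cmod (contour_integral (linepath (\<i> * R) (- \<i> * R)) H) \<le> K / ln N"
        using K[OF N] by (simp only:)
      thus ?thesis using left right by (intro add_mono) auto
    qed
    also have "\<dots> = 2 * pi * (2 * C / R + C / N + (K / (2 * pi)) / ln N)"
      using R N by (simp add: field_simps power2_eq_square)
    finally have "cmod (S 0) \<le> 2 * C / R + C / N + (K / (2 * pi)) / ln N"
      by (simp add: norm_mult)
    moreover have "S 0 = (\<Sum>n=1..N. a n / n)" unfolding S_def
      by (intro sum.cong) (auto simp: powr_minus field_simps)
    ultimately show ?thesis by simp
  qed
  thus ?thesis using that by blast
qed

text \<open>
  Changing the first coefficient by \<open>F 1\<close> reduces to the case \<open>F 1 = 0\<close>; then \<open>R\<close> is chosen large and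
  \<open>N\<close> afterwards.
\<close>

theorem newman_tauberian:
  fixes a :: "nat \<Rightarrow> complex"
  assumes a: "\<And>n. cmod (a n) \<le> C"
    and U: "open U" "{s. Re s \<ge> 1} \<subseteq> U" and F: "F holomorphic_on U"
    and sums: "\<And>s. Re s > 1 \<Longrightarrow> (\<lambda>n. a n * of_nat n powr (-s)) sums F s"
  shows "(\<lambda>N. \<Sum>n=1..N. a n / n) \<longlonglongrightarrow> F 1"
proof (rule LIMSEQ_I)
  fix e :: real assume e: "e > 0"
  define b where "b = a(1 := a 1 - F 1)"
  define C' where "C' = C + cmod (F 1) + 1"
  have C0: "C \<ge> 0" using a[of 0] norm_ge_zero[of "a 0"] by linarith
  have C'0: "C' > 0" using C0 by (simp add: C'_def add_nonneg_pos)
  have b: "cmod (b n) \<le> C'" for n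
    using a[of n] a[of 1] norm_triangle_ineq4[of "a 1" "F 1"] by (auto simp: b_def C'_def intro: order_trans)
  have bs: "(\<lambda>n. b n * of_nat n powr (-s)) sums (F s - F 1)" if "Re s > 1" for s
  proof -
    have "(\<lambda>n. a n * of_nat n powr (-s) - (if n = 1 then F 1 else 0)) sums (F s - F 1)"
      by (intro sums_diff sums that sums_single)
    also have "(\<lambda>n. a n * of_nat n powr (-s) - (if n = 1 then F 1 else 0)) = (\<lambda>n. b n * of_nat n powr (-s))"
      by (auto simp: b_def fun_eq_iff)
    finally show ?thesis .
  qed
  \<comment> \<open>With this radius the main term \<open>2 C' / R\<close> is a quarter of \<open>e\<close>.\<close>
  define R where "R = 8 * C' / e"
  have R: "R > 0" using C'0 e by (simp add: R_def)
  have holF: "(\<lambda>s. F s - F 1) holomorphic_on U" by (intro holomorphic_intros F)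
  obtain K where K: "\<And>N. N \<ge> 2 \<Longrightarrow> cmod (\<Sum>n=1..N. b n / n) \<le> 2 * C' / R + C' / N + K / ln N"
    by (rule newman_bound[OF b U holF _ bs R]) auto
  have "(\<lambda>N. 2 * C' / R + C' / real N + K / ln N) \<longlonglongrightarrow> 2 * C' / R + 0 + 0"
    by (intro tendsto_add tendsto_const) real_asymp+
  moreover have "2 * C' / R + 0 + 0 < e" using C'0 e by (simp add: R_def field_simps)
  ultimately have "eventually (\<lambda>N. 2 * C' / R + C' / real N + K / ln N < e) sequentially"
    by (rule order_tendstoD)
  hence "eventually (\<lambda>N. cmod ((\<Sum>n=1..N. a n / n) - F 1) < e) sequentially"
    using eventually_ge_at_top[of 2]
  proof eventually_elim
    case (elim N)
    have "(\<Sum>n=1..N. b n / n) = (\<Sum>n=1..N. a n / n - (if n = 1 then F 1 else 0))"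
      by (intro sum.cong) (auto simp: b_def)
    also have "\<dots> = (\<Sum>n=1..N. a n / n) - F 1"
      using elim by (simp add: sum_subtractf)
    finally show ?case using K[of N] elim by simp
  qed
  thus "\<exists>no. \<forall>n\<ge>no. cmod ((\<Sum>n=1..n. a n / n) - F 1) < e"
    by (simp add: eventually_sequentially)
qed

section \<open>The Moebius function\<close>

abbreviation moebius_mean :: "(nat \<Rightarrow> complex) \<Rightarrow> nat \<Rightarrow> complex" where
  "moebius_mean f N \<equiv> (\<Sum>n=1..N. of_int (moebius_mu n) * f n) / of_nat N"

lemma moebius_mu_1 [simp]: "moebius_mu 1 = 1" "moebius_mu (Suc 0) = 1"
  by (simp_all add: moebius_mu_def)

lemma abs_moebius_mu_le: "\<bar>moebius_mu n\<bar> \<le> 1"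
  by (simp add: moebius_mu_def)

lemma moebius_mu_mult_coprime:
  assumes "coprime a b"
  shows "moebius_mu (a * b) = moebius_mu a * moebius_mu b"
proof (cases "squarefree a \<and> squarefree b")
  case True
  hence nz: "a \<noteq> 0" "b \<noteq> 0" by (auto intro: Nat.gr0I)
  have "prime_factors a \<inter> prime_factors b = {}"
    using coprime_common_divisor[OF assms] in_prime_factors_imp_dvd in_prime_factors_imp_prime not_prime_unit
    by blast
  thus ?thesis using True nz assms
    by (simp add: moebius_mu_def squarefree_mult_coprime prime_factors_product card_Un_disjoint power_add)
next
  case False
  hence "\<not> squarefree (a * b)" by (meson dvd_triv_left dvd_triv_right squarefree_mono)
  thus ?thesis using False by (auto simp: moebius_mu_def)
qed

lemma moebius_mu_prime: "prime p \<Longrightarrow> moebius_mu p = -1"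
  by (simp add: moebius_mu_def squarefree_prime prime_factorization_prime)

lemma moebius_mu_prime_mult:
  assumes "prime p"
  shows "moebius_mu (p * m) = (if p dvd m then 0 else - moebius_mu m)"
proof (cases "p dvd m")
  case True
  then obtain k where "m = p * k" by auto
  hence "p\<^sup>2 dvd p * m" by (simp add: power2_eq_square)
  hence "\<not> squarefree (p * m)" using assms by (intro not_squarefreeI[of p]) auto
  thus ?thesis using True by (simp add: moebius_mu_def)
next
  case False
  hence "coprime p m" using assms by (simp add: prime_imp_coprime)
  thus ?thesis using False assms by (simp add: moebius_mu_mult_coprime moebius_mu_prime)
qed

text \<open>
  For a prime \<open>p\<close> dividing \<open>n\<close>, the divisors not divisible by \<open>p\<close> cancel against their multiples by \<open>p\<close>,
  and all other divisors are divisible by \<open>p\<^sup>2\<close>.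
\<close>

lemma sum_divisors_moebius_mu:
  assumes "n > 0"
  shows "(\<Sum>d | d dvd n. moebius_mu d) = (if n = 1 then 1 else 0)"
proof (cases "n = 1")
  case False
  then obtain p where p: "prime p" "p dvd n" using prime_factor_nat by blast
  define A where "A = {d. d dvd n \<and> \<not> p dvd d}"
  have fin: "finite {d. d dvd n}" using assms by simp
  have finA: "finite A" by (rule finite_subset[OF _ fin]) (auto simp: A_def)
  have p0: "p > 0" using p by (simp add: prime_gt_0_nat)
  have sub: "A \<union> (*) p ` A \<subseteq> {d. d dvd n}"
  proof
    fix x assume "x \<in> A \<union> (*) p ` A"
    thus "x \<in> {d. d dvd n}"
    proof
      assume "x \<in> (*) p ` A"
      then obtain e where e: "x = p * e" "e dvd n" "\<not> p dvd e" by (auto simp: A_def)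
      hence "coprime p e" using p by (simp add: prime_imp_coprime)
      thus ?thesis using e p by (simp add: divides_mult)
    qed (auto simp: A_def)
  qed
  have zero: "moebius_mu d = 0" if "d dvd n" "d \<notin> A" "d \<notin> (*) p ` A" for d
  proof -
    have "p dvd d" using that by (auto simp: A_def)
    then obtain e where e: "d = p * e" by (elim dvdE)
    hence "p dvd e" using that by (auto simp: A_def dest: dvd_mult_right)
    thus ?thesis using p e by (simp add: moebius_mu_prime_mult)
  qed
  have "(\<Sum>d | d dvd n. moebius_mu d) = (\<Sum>d\<in>A \<union> (*) p ` A. moebius_mu d)"
    using zero sub fin by (intro sum.mono_neutral_right) auto
  also have "\<dots> = (\<Sum>d\<in>A. moebius_mu d) + (\<Sum>d\<in>(*) p ` A. moebius_mu d)"
    using finA by (intro sum.union_disjoint) (auto simp: A_def)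
  also have "(\<Sum>d\<in>(*) p ` A. moebius_mu d) = (\<Sum>d\<in>A. moebius_mu (p * d))"
    using p0 by (subst sum.reindex) (auto simp: inj_on_def)
  also have "\<dots> = - (\<Sum>d\<in>A. moebius_mu d)"
    using p by (simp add: moebius_mu_prime_mult A_def sum_negf)
  finally show ?thesis using False by simp
qed simp

section \<open>Dirichlet characters\<close>

definition dirichlet_char :: "nat \<Rightarrow> (nat \<Rightarrow> complex) \<Rightarrow> bool" where
  "dirichlet_char q chi \<longleftrightarrow> q > 0 \<and> (\<forall>n. chi (n + q) = chi n) \<and> (\<forall>m n. chi (m * n) = chi m * chi n)
     \<and> (\<forall>n. chi n \<noteq> 0 \<longleftrightarrow> coprime n q)"

lemma periodic_mod:
  assumes "\<And>n::nat. f (n + q) = f n"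
  shows "f (n mod q) = f n"
proof -
  have "f (m + k * q) = f m" for k m
  proof (induction k)
    case (Suc k)
    have "f (m + Suc k * q) = f ((m + k * q) + q)" by (simp add: algebra_simps)
    thus ?case using assms Suc by simp
  qed simp
  from this[of "n mod q" "n div q"] show ?thesis by simp
qed

text \<open>
  Pigeonhole principle: two of the powers of \<open>h\<close> coincide modulo \<open>q\<close>, and \<open>h\<close> can be cancelled.
\<close>

lemma coprime_power_cong_1:
  fixes h q :: nat
  assumes "coprime h q" "q > 0"
  obtains k where "k > 0" "[h ^ k = 1] (mod q)"
proof -
  have "\<not> inj_on (\<lambda>i. h ^ i mod q) {..q}"
  proof
    assume "inj_on (\<lambda>i. h ^ i mod q) {..q}"
    hence "card ((\<lambda>i. h ^ i mod q) ` {..q}) = Suc q" by (simp add: card_image)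
    moreover have "card ((\<lambda>i. h ^ i mod q) ` {..q}) \<le> card {..<q}"
      using assms by (intro card_mono) auto
    ultimately show False by simp
  qed
  then obtain i j where ij: "i < j" "h ^ i mod q = h ^ j mod q"
    unfolding inj_on_def by (metis nat_neq_iff)
  hence "[h ^ i * 1 = h ^ i * h ^ (j - i)] (mod q)" by (simp add: cong_def flip: power_add)
  hence "[1 = h ^ (j - i)] (mod q)" using assms cong_mult_lcancel_nat[of "h ^ i" q 1 "h ^ (j - i)"] by simp
  thus ?thesis using that[of "j - i"] ij by (simp add: cong_sym_eq)
qed

lemma sum_roots_of_unity:
  fixes k i :: nat
  assumes "k > 0" "i < k"
  shows "(\<Sum>j<k. cis (2 * pi * real i * real j / real k)) = (if i = 0 then of_nat k else 0)"
proof (cases "i = 0")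
  case False
  let ?w = "cis (2 * pi * real i / real k)"
  have "?w \<noteq> 1"
  proof
    assume "?w = 1"
    then obtain m :: int where "2 * pi * real i / real k = of_int m * 2 * pi"
      by (auto simp: complex_eq_iff cos_one_2pi_int)
    hence "real i = of_int m * real k" using assms by (simp add: field_simps)
    hence "int i = m * int k" by (metis of_int_eq_iff of_int_mult of_int_of_nat_eq)
    hence "int k dvd int i" by simp
    thus False using assms False by (auto dest: dvd_imp_le)
  qed
  moreover have "?w ^ k = 1"
  proof -
    have "?w ^ k = cis (real k * (2 * pi * real i / real k))" by (rule Complex.DeMoivre)
    also have "real k * (2 * pi * real i / real k) = 2 * pi * real i" using assms by simp
    finally show ?thesis using cis_multiple_2pi[of "real i"] by simp
  qed
  moreover have "(\<Sum>j<k. cis (2 * pi * real i * real j / real k)) = (\<Sum>j<k. ?w ^ j)"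
    by (intro sum.cong) (auto simp: Complex.DeMoivre algebra_simps)
  ultimately show ?thesis using False by (simp add: geometric_sum)
qed simp

text \<open>
  Functions supported on the units modulo \<open>q\<close> are linear combinations of characters, stated as an
  induction principle. The translations \<open>f \<mapsto> f (h * _)\<close> by units commute and have finite order, so the
  projections \<open>P j\<close> onto their eigenspaces split \<open>f\<close> successively into simultaneous eigenfunctions.
  For an eigenfunction of all units, \<open>f (h * n) = w * f n\<close> at \<open>n = 1\<close> gives \<open>f h = w * f 1\<close>. So \<open>f\<close> is 0 or
  \<open>f 1\<close> times a character.
\<close>

theorem periodic_dirichlet_char_induct:
  fixes g :: "nat \<Rightarrow> complex"
  assumes q: "q > 0" and per: "\<And>n. g (n + q) = g n" and supp: "\<And>n. \<not> coprime n q \<Longrightarrow> g n = 0"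
    and zero: "Q (\<lambda>_. 0)"
    and add: "\<And>f g. Q f \<Longrightarrow> Q g \<Longrightarrow> Q (\<lambda>n. f n + g n)"
    and char: "\<And>c chi. dirichlet_char q chi \<Longrightarrow> Q (\<lambda>n. c * chi n)"
  shows "Q g"
proof -
  define V where "V = {f :: nat \<Rightarrow> complex. (\<forall>n. f (n + q) = f n) \<and> (\<forall>n. \<not> coprime n q \<longrightarrow> f n = 0)}"
  define E where "E h = {f :: nat \<Rightarrow> complex. \<exists>w. \<forall>n. f (h * n) = w * f n}" for h
  have Vcong: "f m = f n" if "f \<in> V" "[m = n] (mod q)" for f m n
    using that periodic_mod[of f q m] periodic_mod[of f q n] by (auto simp: V_def cong_def)
  have Qsum: "Q (\<lambda>n. \<Sum>i<k. f i n)" if "\<And>i. i < k \<Longrightarrow> Q (f i)" for f and k :: nat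
    using that by (induction k) (auto intro: zero add)
  \<comment> \<open>Induction on the set \<open>H\<close> of units for which \<open>f\<close> is not yet known to be an eigenfunction.\<close>
  have step: "Q f" if "finite H" "\<And>h. h \<in> H \<Longrightarrow> coprime h q" "f \<in> V" "\<And>h. coprime h q \<Longrightarrow> h < q \<Longrightarrow> h \<notin> H \<Longrightarrow> f \<in> E h"
    for H f using that
  proof (induction H arbitrary: f rule: finite_induct)
    case empty
    define c where "c = f 1"
    have e1: "f (h * n) = (if c = 0 then 0 else f h / c) * f n" if h: "coprime h q" for h n
    proof -
      have "coprime (h mod q) q" "h mod q < q" using h q by auto
      hence "f \<in> E (h mod q)" using empty.prems(3) by blast
      then obtain w where w: "\<And>n. f ((h mod q) * n) = w * f n" by (auto simp: E_def)
      have "f (h * n) = f ((h mod q) * n)" for n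
        using empty by (intro Vcong) (auto simp: cong_def mod_simps)
      hence *: "f (h * n) = w * f n" for n using w by simp
      have "f h = w * c" using *[of 1] by (simp add: c_def)
      show ?thesis
      proof (cases "c = 0")
        case True
        have "f (h * n) = 0"
        proof (cases "coprime (h * n) q")
          case hn: True
          have "coprime ((h * n) mod q) q" "(h * n) mod q < q" using hn q by simp_all
          hence "f \<in> E ((h * n) mod q)" using empty.prems(3) by blast
          then obtain w' where w': "\<And>m. f (((h * n) mod q) * m) = w' * f m" by (auto simp: E_def)
          have "f (h * n) = f (((h * n) mod q) * 1)"
            using empty by (intro Vcong) (auto simp: cong_def)
          thus ?thesis using w'[of 1] True by (simp add: c_def)
        qed (use empty in \<open>auto simp: V_def\<close>)
        thus ?thesis using True by simp
      qed (use * \<open>f h = w * c\<close> in auto)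
    qed
    show ?case
    proof (cases "c = 0")
      case True
      have "f n = 0" for n
        using e1[of n 1] True empty by (cases "coprime n q") (auto simp: V_def)
      hence "f = (\<lambda>_. 0)" by auto
      thus ?thesis using zero by simp
    next
      case False
      have f0: "f n = 0" if "\<not> coprime n q" for n using that empty by (auto simp: V_def)
      have mult: "f (m * n) / c = (f m / c) * (f n / c)" for m n
        using e1[of m n] f0[of m] f0[of "m * n"] False by (cases "coprime m q") auto
      have nz: "f n \<noteq> 0" if n: "coprime n q" for n
      proof -
        obtain k where k: "k > 0" "[n ^ k = 1] (mod q)" using coprime_power_cong_1[OF n q] by auto
        have "f (n ^ k) = c" unfolding c_def using empty k by (intro Vcong) auto
        moreover have "n ^ k = n * n ^ (k - 1)" using k by (simp flip: power_Suc)
        ultimately have "f (n * n ^ (k - 1)) = c" by simp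
        thus ?thesis using False mult[of n "n ^ (k - 1)"] by auto
      qed
      have "dirichlet_char q (\<lambda>n. f n / c)"
        unfolding dirichlet_char_def
      proof (intro conjI allI)
        show "f n / c \<noteq> 0 \<longleftrightarrow> coprime n q" for n using f0 nz False by auto
      qed (use q empty mult in \<open>auto simp: V_def\<close>)
      from char[OF this, of c] show ?thesis using False by simp
    qed
  next
    case (insert h H)
    have h: "coprime h q" using insert.prems by auto
    obtain k where k: "k > 0" "[h ^ k = 1] (mod q)" using coprime_power_cong_1[OF h q] by auto
    define W where "W i j = cis (2 * pi * real i * real j / real k)" for i j
    \<comment> \<open>The projection onto the eigenspace of translation by \<open>h\<close> for a \<open>k\<close>-th root of unity; translation by \<open>h\<close> has order dividing \<open>k\<close>.\<close>
    define P where "P j n = (\<Sum>i<k. W i j * f (h ^ i * n)) / of_nat k" for j n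
    have "f n = (\<Sum>j<k. P j n)" for n
    proof -
      have "(\<Sum>j<k. P j n) = (\<Sum>i<k. (\<Sum>j<k. W i j) * f (h ^ i * n)) / of_nat k"
        unfolding P_def by (subst sum_divide_distrib[symmetric], subst sum.swap) (simp add: sum_distrib_right)
      also have "(\<Sum>i<k. (\<Sum>j<k. W i j) * f (h ^ i * n)) = (\<Sum>i<k. if i = 0 then of_nat k * f (h ^ i * n) else 0)"
        unfolding W_def using k by (intro sum.cong refl) (simp add: sum_roots_of_unity)
      also have "\<dots> = of_nat k * f n" using k by (simp add: sum.delta)
      finally show ?thesis using k by simp
    qed
    hence feq: "f = (\<lambda>n. \<Sum>j<k. P j n)" by auto
    have "Q (P j)" if "j < k" for j
    proof (rule insert.IH)
      show "coprime h' q" if "h' \<in> H" for h' using insert.prems that by auto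
      have cop: "coprime (h ^ i * n) q \<longleftrightarrow> coprime n q" for i n using h by (simp add: coprime_power_left_iff)
      have "f (h ^ i * (n + q)) = f (h ^ i * n)" for i n
        using insert.prems(2) by (intro Vcong) (auto simp: cong_def algebra_simps)
      thus PV: "P j \<in> V" using insert.prems(2) cop by (auto simp: V_def P_def)
      fix h' assume h': "coprime h' q" "h' < q" "h' \<notin> H"
      show "P j \<in> E h'"
      proof (cases "h' = h")
        case False
        hence "f \<in> E h'" using insert.prems(3)[of h'] h' by auto
        then obtain w where w: "\<And>n. f (h' * n) = w * f n" by (auto simp: E_def)
        have "P j (h' * n) = w * P j n" for n
        proof -
          have "f (h ^ i * (h' * n)) = w * f (h ^ i * n)" for i
            using w[of "h ^ i * n"] by (simp add: mult_ac)
          thus ?thesis by (simp add: P_def sum_distrib_left sum_divide_distrib mult_ac)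
        qed
        thus ?thesis by (auto simp: E_def)
      next
        case True
        define w where "w = cis (- 2 * pi * real j / real k)"
        have "P j (h * n) = w * P j n" for n
        proof -
          define T where "T i = W i j * f (h ^ i * n)" for i
          have Tk: "T k = T 0"
          proof -
            have "f (h ^ k * n) = f n" using insert.prems(2) k
              by (intro Vcong) (auto intro: cong_scalar_right[of _ 1, simplified])
            moreover have "W k j = 1"
            proof -
              have "2 * pi * real k * real j / real k = 2 * pi * real j" using k by simp
              moreover have "cis (2 * pi * real j) = 1" by (rule cis_multiple_2pi) simp
              ultimately show ?thesis unfolding W_def by (simp only:)
            qed
            ultimately show ?thesis by (simp add: T_def W_def)
          qed
          have W1: "W i j = w * W (Suc i) j" for i
            unfolding W_def w_def cis_mult
            by (rule arg_cong[of _ _ cis]) (use k in \<open>simp add: field_simps\<close>)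
          have "(\<Sum>i<k. W i j * f (h ^ i * (h * n))) = (\<Sum>i<k. w * T (Suc i))"
          proof (intro sum.cong refl)
            fix i
            show "W i j * f (h ^ i * (h * n)) = w * T (Suc i)"
              unfolding T_def W1[of i] by (simp add: mult_ac)
          qed
          also have "\<dots> = w * (\<Sum>i<k. T (Suc i))" by (simp add: sum_distrib_left)
          also have "(\<Sum>i<k. T (Suc i)) = (\<Sum>i<k. T i)"
            using sum.lessThan_Suc_shift[of T k] sum.lessThan_Suc[of T k] Tk by simp
          finally show ?thesis by (simp add: P_def T_def)
        qed
        thus ?thesis using True by (auto simp: E_def)
      qed
    qed
    thus ?case unfolding feq by (intro Qsum)
  qed
  show ?thesis
    by (rule step[of "{h. h < q \<and> coprime h q}"]) (use per supp in \<open>auto simp: V_def\<close>)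
qed

section \<open>Real characters at 1\<close>

text \<open>
  Summation by parts against a decreasing sequence: only the first value of the sequence matters.
\<close>

lemma abel_bound:
  fixes c b :: "nat \<Rightarrow> real"
  assumes B: "\<And>N. \<bar>\<Sum>k=1..N. c k\<bar> \<le> B" and dec: "\<And>n. n \<ge> 1 \<Longrightarrow> b (Suc n) \<le> b n"
    and nn: "\<And>n. n \<ge> 1 \<Longrightarrow> b n \<ge> 0"
  shows "\<bar>\<Sum>n=1..N. c n * b n\<bar> \<le> B * b 1"
proof -
  define C where "C N = (\<Sum>k=1..N. c k)" for N
  have B0: "B \<ge> 0" using B[of 0] by simp
  have "\<bar>(\<Sum>n=1..N. c n * b n) - C N * b (Suc N)\<bar> \<le> B * (b 1 - b (Suc N))" for N
  proof (induction N)
    case (Suc N)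
    have "(\<Sum>n=1..Suc N. c n * b n) - C (Suc N) * b (Suc (Suc N)) =
      ((\<Sum>n=1..N. c n * b n) - C N * b (Suc N)) + C (Suc N) * (b (Suc N) - b (Suc (Suc N)))"
      by (simp add: C_def algebra_simps)
    moreover have "\<bar>C (Suc N) * (b (Suc N) - b (Suc (Suc N)))\<bar> \<le> B * (b (Suc N) - b (Suc (Suc N)))"
      using B[of "Suc N"] dec[of "Suc N"] unfolding abs_mult C_def by (intro mult_mono) auto
    ultimately have "\<bar>(\<Sum>n=1..Suc N. c n * b n) - C (Suc N) * b (Suc (Suc N))\<bar> \<le>
       B * (b 1 - b (Suc N)) + B * (b (Suc N) - b (Suc (Suc N)))" using Suc.IH by linarith
    thus ?case by (simp add: algebra_simps)
  qed (simp add: C_def)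
  from this[of N] have "\<bar>\<Sum>n=1..N. c n * b n\<bar> \<le> B * (b 1 - b (Suc N)) + \<bar>C N * b (Suc N)\<bar>" by linarith
  also have "\<bar>C N * b (Suc N)\<bar> \<le> B * b (Suc N)"
    using B[of N] nn[of "Suc N"] unfolding abs_mult C_def by (intro mult_mono) auto
  finally show ?thesis by (simp add: algebra_simps)
qed

context
  fixes c :: "nat \<Rightarrow> real"
  assumes vals: "\<And>n. c n \<in> {-1, 0, 1}" and mult: "\<And>m n. c (m * n) = c m * c n" and one: "c 1 = 1"
begin

text \<open>
  The coefficients of \<open>\<zeta>(s) L(s, c)\<close>.
\<close>

definition divsum :: "nat \<Rightarrow> real" where "divsum n = (\<Sum>d | d dvd n. c d)"

text \<open>
  The divisors of \<open>p^(k+1) m\<close> are those of \<open>m\<close> and the multiples by \<open>p\<close> of those of \<open>p^k m\<close>; this gives a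
  recursion in \<open>k\<close>.
\<close>

lemma divsum_prime_power_mult:
  assumes "prime p" "\<not> p dvd m" "m > 0"
  shows "divsum (p ^ k * m) = (if c p = 1 then real k + 1 else if c p = 0 then 1 else if even k then 1 else 0) * divsum m"
proof (induction k)
  case (Suc k)
  have p0: "p > 0" using assms by (simp add: prime_gt_0_nat)
  have eq: "{d. d dvd p ^ Suc k * m} = {d. d dvd m} \<union> (*) p ` {d. d dvd p ^ k * m}"
  proof (intro equalityI subsetI)
    fix d assume "d \<in> {d. d dvd p ^ Suc k * m}"
    hence d: "d dvd p ^ Suc k * m" by simp
    show "d \<in> {d. d dvd m} \<union> (*) p ` {d. d dvd p ^ k * m}"
    proof (cases "p dvd d")
      case True
      then obtain e where "d = p * e" by (elim dvdE)
      thus ?thesis using d p0 by (auto simp: mult.assoc)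
    next
      case False
      hence "coprime p d" using assms(1) by (intro prime_imp_coprime)
      hence "coprime (p ^ Suc k) d" by (simp del: power_Suc)
      hence "coprime d (p ^ Suc k)" by (rule coprime_commute[THEN iffD1])
      thus ?thesis using d by (simp add: coprime_dvd_mult_right_iff del: power_Suc)
    qed
  qed (auto simp: mult.assoc)
  have fin: "finite {d. d dvd m}" "finite {d. d dvd p ^ k * m}" using assms p0 by auto
  have "divsum (p ^ Suc k * m) = divsum m + (\<Sum>d\<in>(*) p ` {d. d dvd p ^ k * m}. c d)"
    unfolding divsum_def eq using fin assms by (intro sum.union_disjoint) (auto dest: dvd_mult_left)
  also have "(\<Sum>d\<in>(*) p ` {d. d dvd p ^ k * m}. c d) = (\<Sum>d | d dvd p ^ k * m. c (p * d))"
    using p0 by (subst sum.reindex) (auto simp: inj_on_def)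
  also have "\<dots> = c p * divsum (p ^ k * m)" by (simp add: divsum_def mult sum_distrib_left)
  finally show ?case using Suc vals[of p] by (auto simp: algebra_simps)
qed (use vals[of p] in auto)

lemma prime_power_split:
  fixes n :: nat
  assumes "n > 1"
  obtains p k m where "prime p" "k > 0" "\<not> p dvd m" "n = p ^ k * m" "m < n" "m > 0"
proof -
  obtain p where p: "prime p" "p dvd n" using prime_factor_nat[of n] assms by auto
  have "n \<noteq> 0" "\<not> is_unit p" using assms p by auto
  then obtain m where m: "n = p ^ multiplicity p n * m" "\<not> p dvd m"
    using multiplicity_decompose'[of n p] by blast
  have k: "multiplicity p n > 0" using p assms by (simp add: prime_multiplicity_gt_zero_iff)
  have "m > 0" using m assms by (intro Nat.gr0I) auto
  moreover have "m < n"
  proof -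
    have "p ^ multiplicity p n > 1" by (rule one_less_power[OF prime_gt_1_nat[OF p(1)] k])
    hence "1 * m < p ^ multiplicity p n * m" using \<open>m > 0\<close> by (intro mult_strict_right_mono)
    thus ?thesis using m by simp
  qed
  ultimately show ?thesis using that p m k by blast
qed

lemma divsum_1: "divsum (Suc 0) = 1"
  using one by (simp add: divsum_def)

lemma divsum_nonneg: "n > 0 \<Longrightarrow> divsum n \<ge> 0"
proof (induction n rule: less_induct)
  case (less n)
  show ?case
  proof (cases "n = 1")
    case False
    then obtain p k m where "prime p" "k > 0" "\<not> p dvd m" "n = p ^ k * m" "m < n" "m > 0"
      using prime_power_split[of n] less by auto
    thus ?thesis using less by (simp add: divsum_prime_power_mult)
  qed (simp add: divsum_1)
qed

lemma divsum_square: "n > 0 \<Longrightarrow> divsum (n ^ 2) \<ge> 1"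
proof (induction n rule: less_induct)
  case (less n)
  show ?case
  proof (cases "n = 1")
    case False
    then obtain p k m where *: "prime p" "k > 0" "\<not> p dvd m" "n = p ^ k * m" "m < n" "m > 0"
      using prime_power_split[of n] less by auto
    have "n ^ 2 = p ^ (2 * k) * m ^ 2" using * by (simp add: power_mult_distrib power_even_eq)
    moreover have "\<not> p dvd m ^ 2" using * prime_dvd_power by blast
    ultimately have "divsum (n ^ 2) = (if c p = 1 then real (2 * k) + 1 else 1) * divsum (m ^ 2)"
      using * by (simp add: divsum_prime_power_mult)
    also have "\<dots> \<ge> 1 * 1" using less.IH[of m] * by (intro mult_mono) auto
    finally show ?thesis by simp
  qed (simp add: divsum_1)
qed

text \<open>
  Both series are obtained from the double series of \<open>c a * x^(a b)\<close>: summing over \<open>b\<close> first is a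
  geometric series, grouping by \<open>a b\<close> gives the divisor sums.
\<close>

lemma lambert_series:
  assumes x: "0 < x" "x < 1"
  obtains S where "(\<lambda>a. c a * (x ^ a / (1 - x ^ a))) sums S" "((\<lambda>n. divsum n * x ^ n) has_sum S) {0<..}"
proof -
  have geo: "((\<lambda>b. x ^ (a * b)) has_sum (x ^ a / (1 - x ^ a))) {0<..}" if a: "a > 0" for a :: nat
  proof -
    have xa: "0 < x ^ a" "x ^ a < 1" using x a by (auto simp: power_less_one_iff)
    have "(\<lambda>b. x ^ a * (x ^ a) ^ b) sums (x ^ a * (1 / (1 - x ^ a)))"
      using xa by (intro sums_mult geometric_sums) auto
    hence "((\<lambda>b. x ^ a * (x ^ a) ^ b) has_sum (x ^ a / (1 - x ^ a))) UNIV"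
      using xa by (intro sums_nonneg_imp_has_sum) auto
    also have "?this \<longleftrightarrow> ((\<lambda>b. x ^ (a * b)) has_sum (x ^ a / (1 - x ^ a))) {0<..}"
      by (rule has_sum_reindex_bij_witness[of _ "\<lambda>b. b - 1" Suc]) (auto simp: power_add power_mult)
    finally show ?thesis .
  qed
  have sumx: "(\<lambda>a. x ^ a / (1 - x ^ a)) summable_on {0<..}"
  proof (rule summable_on_comparison_test)
    have "(\<lambda>a. x ^ a * (1 / (1 - x))) summable_on UNIV"
      using x by (intro summable_on_cmult_left) (auto simp: summable_on_UNIV_nonneg_real_iff summable_geometric)
    thus "(\<lambda>a. x ^ a * (1 / (1 - x))) summable_on {0<..}" by (rule summable_on_subset_banach) auto
    fix a :: nat assume "a \<in> {0<..}"
    hence xa: "0 < x ^ a" "x ^ a \<le> x ^ 1" using x power_decreasing[of 1 a x] by auto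
    show "x ^ a / (1 - x ^ a) \<le> x ^ a * (1 / (1 - x))" "0 \<le> x ^ a / (1 - x ^ a)"
      using xa x by (auto intro!: divide_left_mono)
  qed
  have cb: "\<bar>c a\<bar> \<le> 1" for a using vals[of a] by auto
  have pos: "(\<lambda>(a, b). x ^ (a * b)) summable_on ({0<..} \<times> {0<..})"
    by (rule summable_on_SigmaI[where g = "\<lambda>a. x ^ a / (1 - x ^ a)"]) (use geo sumx x in auto)
  have "(\<lambda>(a, b). c a * x ^ (a * b)) summable_on ({0<..} \<times> {0<..})"
  proof (rule abs_summable_summable, rule summable_on_comparison_test[OF pos])
    fix p show "norm (case p of (a, b) \<Rightarrow> c a * x ^ (a * b)) \<le> (case p of (a, b) \<Rightarrow> x ^ (a * b))"
      using cb x by (cases p) (auto simp: abs_mult mult_left_le_one_le)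
  qed auto
  then obtain S where S: "((\<lambda>(a, b). c a * x ^ (a * b)) has_sum S) ({0<..} \<times> {0<..})"
    by (auto simp: summable_on_def)
  have "((\<lambda>n. \<Sum>d | d dvd n. c d * x ^ (d * (n div d))) has_sum S) {0<..}"
    using S by (rule has_sum_divisors)
  also have "?this \<longleftrightarrow> ((\<lambda>n. divsum n * x ^ n) has_sum S) {0<..}"
    by (rule has_sum_cong) (simp add: divsum_def sum_distrib_right)
  finally have 1: "((\<lambda>n. divsum n * x ^ n) has_sum S) {0<..}" .
  have "((\<lambda>a. c a * (x ^ a / (1 - x ^ a))) has_sum S) {0<..}"
    using S
  proof (rule has_sum_Sigma')
    fix a :: nat assume "a \<in> {0<..}"
    hence "a > 0" by simp
    from has_sum_cmult_right[OF geo[OF this], of "c a"]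
    show "((\<lambda>b. case (a, b) of (a, b) \<Rightarrow> c a * x ^ (a * b)) has_sum (c a * (x ^ a / (1 - x ^ a)))) {0<..}"
      by simp
  qed
  also have "?this \<longleftrightarrow> ((\<lambda>a. c a * (x ^ a / (1 - x ^ a))) has_sum S) UNIV"
    by (rule has_sum_cong_neutral) auto
  finally show ?thesis using that 1 has_sum_imp_sums by blast
qed

text \<open>
  The arithmetic-geometric mean inequality for the pairs \<open>y^(2i)\<close>, \<open>y^(2(a-1-i))\<close>.
\<close>

lemma geometric_sum_ge:
  fixes y :: real
  assumes "0 < y" "a > 0"
  shows "(\<Sum>i<a. (y\<^sup>2) ^ i) \<ge> real a * y ^ (a - 1)"
proof -
  have "2 * (\<Sum>i<a. (y\<^sup>2) ^ i) = (\<Sum>i<a. (y\<^sup>2) ^ i) + (\<Sum>i<a. (y\<^sup>2) ^ (a - Suc i))"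
    by (simp add: sum.nat_diff_reindex)
  also have "\<dots> = (\<Sum>i<a. (y\<^sup>2) ^ i + (y\<^sup>2) ^ (a - Suc i))" by (simp add: sum.distrib)
  also have "\<dots> \<ge> (\<Sum>i<a. 2 * y ^ (a - 1))"
  proof (rule sum_mono)
    fix i assume i: "i \<in> {..<a}"
    have "y ^ (a - 1) = y ^ i * y ^ (a - Suc i)" using i by (simp flip: power_add)
    moreover have "0 \<le> (y ^ i - y ^ (a - Suc i))\<^sup>2" by simp
    moreover have "(y\<^sup>2) ^ j = (y ^ j)\<^sup>2" for j by (simp flip: power_mult add: mult.commute)
    ultimately show "2 * y ^ (a - 1) \<le> (y\<^sup>2) ^ i + (y\<^sup>2) ^ (a - Suc i)"
      by (simp add: power2_diff)
  qed
  finally show ?thesis by simp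
qed

text \<open>
  Monsky's proof that \<open>L(1, c) \<noteq> 0\<close> for a real character. Consider \<open>S(x) = \<Sum> c(n) x^n / (1 - x^n)\<close> as \<open>x\<close>
  tends to 1. As the sum of divisor sums, which are nonnegative and at least 1 at squares, \<open>S(x)\<close>
  tends to infinity. If \<open>L(1, c)\<close> were 0, subtracting \<open>c(n) / (n (1 - x))\<close> would not change \<open>S(x)\<close> and
  would leave a decreasing weight \<open>b n\<close> with \<open>b 1 = 1\<close>, so that \<open>S(x)\<close> would be bounded by the partial
  sums of \<open>c\<close>.
\<close>

theorem real_character_sum_nonzero:
  assumes B: "\<And>N. \<bar>\<Sum>k=1..N. c k\<bar> \<le> B"
  shows "\<not> (\<lambda>n. c n / real n) sums 0"
proof
  assume L0: "(\<lambda>n. c n / real n) sums 0"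
  have B0: "B \<ge> 0" using B[of 0] by simp
  have upper: "(\<Sum>j=1..K. x ^ (j ^ 2)) \<le> B" if x: "0 < x" "x < 1" for x :: real and K :: nat
  proof -
    obtain S where S: "(\<lambda>a. c a * (x ^ a / (1 - x ^ a))) sums S" "((\<lambda>n. divsum n * x ^ n) has_sum S) {0<..}"
      using lambert_series[OF x] by blast
    define b where "b a = 1 / (real a * (1 - x)) - x ^ a / (1 - x ^ a)" for a
    \<comment> \<open>Half-integral powers of \<open>x\<close> occur in the arithmetic-geometric mean inequality.\<close>
    define y where "y = sqrt x"
    have y: "0 < y" "y < 1" "y\<^sup>2 = x" using x by (auto simp: y_def)
    define G where "G a = (\<Sum>i<a. x ^ i)" for a
    have Gge: "G a \<ge> real a * y ^ (a - 1)" if "a > 0" for a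
      using geometric_sum_ge[OF y(1) that] by (simp add: G_def y)
    have Gpos: "G a > 0" if "a > 0" for a
      using Gge[OF that] that y by (smt (verit) mult_pos_pos of_nat_0_less_iff zero_less_power)
    have Gx: "1 - x ^ a = (1 - x) * G a" for a
      using one_diff_power_eq[of x a] by (simp add: G_def)
    have bG: "b a = (1 / real a - x ^ a / G a) / (1 - x)" for a
      by (simp add: b_def Gx diff_divide_distrib mult.commute)
    have dec: "b (Suc n) \<le> b n" if n: "n \<ge> 1" for n
    proof -
      have GS: "G (Suc n) = 1 + x * G n" 
        by (simp add: G_def sum.lessThan_Suc_shift sum_distrib_left del: sum.lessThan_Suc)
      have g: "G n > 0" "G (Suc n) > 0" using Gpos n by auto
      have "x ^ n / G n - x ^ Suc n / G (Suc n) = x ^ n / (G n * G (Suc n))"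
        using g by (simp add: field_simps) (simp add: GS algebra_simps)
      also have "\<dots> \<le> x ^ n / ((real n * y ^ (n - 1)) * (real (Suc n) * y ^ n))"
        using Gge[of n] Gge[of "Suc n"] g n y x
        by (intro divide_left_mono mult_mono mult_pos_pos) auto
      also have "\<dots> = y / (real n * real (Suc n))"
      proof -
        have "(n - 1) + n + 1 = 2 * n" using n by simp
        hence "x ^ n = y ^ ((n - 1) + n + 1)" using y(3) by (metis power_mult)
        hence "x ^ n = y ^ (n - 1) * y ^ n * y" by (simp only: power_add power_one_right)
        moreover define P where "P = y ^ (n - 1) * y ^ n"
        moreover have "P > 0" using y by (simp add: P_def)
        moreover have "(real n * y ^ (n - 1)) * (real (Suc n) * y ^ n) = P * (real n * real (Suc n))"
          by (simp add: P_def mult_ac)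
        ultimately have "x ^ n = P * y" "P > 0"
          "(real n * y ^ (n - 1)) * (real (Suc n) * y ^ n) = P * (real n * real (Suc n))" by simp_all
        thus ?thesis by (simp only:) (rule mult_divide_mult_cancel_left, simp)
      qed
      also have "\<dots> \<le> 1 / (real n * real (Suc n))" using y n by (intro divide_right_mono) auto
      also have "\<dots> = 1 / real n - 1 / real (Suc n)" using n by (simp add: field_simps)
      finally show ?thesis unfolding bG using x by (intro divide_right_mono) auto
    qed
    have nn: "b n \<ge> 0" if n: "n \<ge> 1" for n
    proof -
      have "x ^ n = y ^ (2 * n)" by (simp add: power_mult y)
      also have "\<dots> \<le> y ^ (n - 1)" using y by (intro power_decreasing) auto
      finally have "real n * x ^ n \<le> real n * y ^ (n - 1)" by (intro mult_left_mono) auto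
      hence "real n * x ^ n \<le> G n" using Gge[of n] n by linarith
      hence "x ^ n / G n \<le> 1 / real n" using Gpos[of n] n by (simp add: field_simps)
      thus ?thesis unfolding bG using x by simp
    qed
    have "(\<lambda>n. (c n / real n) * (1 / (1 - x)) - c n * (x ^ n / (1 - x ^ n))) sums (0 * (1 / (1 - x)) - S)"
      by (intro sums_diff sums_mult2 L0 S)
    also have "(\<lambda>n. (c n / real n) * (1 / (1 - x)) - c n * (x ^ n / (1 - x ^ n))) = (\<lambda>n. c n * b n)"
      by (simp add: fun_eq_iff b_def algebra_simps)
    finally have "(\<lambda>n. c n * b n) sums (- S)" by simp
    hence "(\<lambda>N. \<Sum>n\<le>N. c n * b n) \<longlonglongrightarrow> - S" by (simp add: sums_def_le)
    moreover have "(\<Sum>n\<le>N. c n * b n) = (\<Sum>n=1..N. c n * b n)" for N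
      by (rule sum.mono_neutral_right) (auto simp: b_def Suc_le_eq)
    ultimately have "(\<lambda>N. \<Sum>n=1..N. c n * b n) \<longlonglongrightarrow> - S" by simp
    hence "(\<lambda>N. \<bar>\<Sum>n=1..N. c n * b n\<bar>) \<longlonglongrightarrow> \<bar>- S\<bar>" by (rule tendsto_rabs)
    moreover have "\<bar>\<Sum>n=1..N. c n * b n\<bar> \<le> B * b 1" for N
      by (rule abel_bound[where c = c and b = b, OF B dec nn])
    ultimately have "\<bar>- S\<bar> \<le> B * b 1" by (intro LIMSEQ_le_const2) auto
    moreover have "b 1 = 1" using x by (simp add: b_def field_simps)
    ultimately have SB: "S \<le> B" by simp
    have "(\<Sum>j=1..K. x ^ (j ^ 2)) \<le> (\<Sum>j=1..K. divsum (j ^ 2) * x ^ (j ^ 2))"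
      using divsum_square x by (intro sum_mono) (auto intro!: mult_le_cancel_right1[THEN iffD2])
    also have "\<dots> = (\<Sum>n\<in>(\<lambda>j. j ^ 2) ` {1..K}. divsum n * x ^ n)"
      by (subst sum.reindex) (auto simp: inj_on_def)
    also have "\<dots> \<le> S"
    proof (rule has_sum_mono2[OF has_sum_finite S(2)])
      show "0 \<le> divsum n * x ^ n" if "n \<in> {0<..} - (\<lambda>j. j\<^sup>2) ` {1..K}" for n
        using divsum_nonneg[of n] that x by auto
    qed auto
    finally show ?thesis using SB by simp
  qed
  \<comment> \<open>More squares than the bound \<open>B\<close> permits.\<close>
  define K where "K = Suc (nat \<lceil>B\<rceil>)"
  have K: "real K > B" unfolding K_def by linarith
  have "((\<lambda>x. \<Sum>j=1..K. x ^ (j ^ 2)) \<longlongrightarrow> (\<Sum>j=1..K. 1 ^ (j ^ 2))) (at_left (1::real))"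
    by (intro tendsto_intros)
  hence "eventually (\<lambda>x::real. (\<Sum>j=1..K. x ^ (j ^ 2)) > B) (at_left 1)"
    using K by (intro order_tendstoD(1)) auto
  moreover have "eventually (\<lambda>x::real. 0 < x \<and> x < 1) (at_left 1)"
    using eventually_at_left_real[of 0 "1::real"] by (auto elim: eventually_mono)
  ultimately have "eventually (\<lambda>x::real. False) (at_left 1)"
    by eventually_elim (use upper in \<open>auto simp: not_le[symmetric]\<close>)
  thus False by simp
qed

end

section \<open>L-functions\<close>

lemma dirichlet_char_1: "dirichlet_char q chi \<Longrightarrow> chi 1 = 1"
  by (metis coprime_1_left dirichlet_char_def mult.right_neutral mult_cancel_left1)

lemma dirichlet_char_power: "dirichlet_char q chi \<Longrightarrow> chi (n ^ k) = chi n ^ k"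
  using dirichlet_char_1[of q chi] by (induction k) (auto simp: dirichlet_char_def)

lemma dirichlet_char_divisor:
  assumes "dirichlet_char q chi" "d dvd n" "n > 0"
  shows "chi d * chi (n div d) = chi n"
proof -
  obtain k where k: "n = d * k" using assms by (elim dvdE)
  thus ?thesis using assms by (simp add: dirichlet_char_def)
qed

lemma dirichlet_char_cong:
  "dirichlet_char q chi \<Longrightarrow> [m = n] (mod q) \<Longrightarrow> chi m = chi n"
  using periodic_mod[of chi q m] periodic_mod[of chi q n] by (simp add: dirichlet_char_def cong_def)

lemma dirichlet_char_norm:
  assumes "dirichlet_char q chi"
  shows "cmod (chi n) \<le> 1"
proof (cases "coprime n q")
  case True
  have "q > 0" using assms by (simp add: dirichlet_char_def)
  then obtain k where k: "k > 0" "[n ^ k = 1] (mod q)" using coprime_power_cong_1[OF True] by blast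
  have "chi n ^ k = 1"
    using dirichlet_char_cong[OF assms k(2)] dirichlet_char_1[OF assms] dirichlet_char_power[OF assms] by simp
  hence "cmod (chi n) ^ k = 1 ^ k" by (simp flip: norm_power)
  hence "cmod (chi n) = 1" using k by (subst (asm) power_eq_iff_eq_base) auto
  thus ?thesis by simp
next
  case False
  hence "chi n = 0" using assms by (auto simp: dirichlet_char_def)
  thus ?thesis by simp
qed

lemma dirichlet_char_square:
  assumes "dirichlet_char q chi"
  shows "dirichlet_char q (\<lambda>n. chi n ^ 2)"
  using assms by (simp add: dirichlet_char_def power_mult_distrib)

lemma dirichlet_char_trivial: "dirichlet_char 1 (\<lambda>_. 1)"
  by (simp add: dirichlet_char_def)

text \<open>
  Nonzero exactly for principal characters; it is the residue of the L-function at 1.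
\<close>

definition char_mean :: "nat \<Rightarrow> (nat \<Rightarrow> complex) \<Rightarrow> complex" where
  "char_mean q chi = (\<Sum>j<q. chi j) / of_nat q"

text \<open>
  The partial sums of a periodic function with mean zero are themselves periodic.
\<close>

lemma periodic_partial_sums_bounded:
  fixes f :: "nat \<Rightarrow> 'a::real_normed_vector"
  assumes per: "\<And>n. f (n + q) = f n" and zero: "(\<Sum>j<q. f j) = 0" and q: "q > 0"
  shows "norm (\<Sum>k=1..N. f k) \<le> (\<Sum>j<q. norm (f j)) + norm (f 0)"
proof -
  define S where "S N = (\<Sum>k<N. f k)" for N
  have "S (N + q) = S N" for N
    by (induction N) (use zero per in \<open>auto simp: S_def\<close>)
  hence "S N = S (N mod q)" for N by (rule periodic_mod[symmetric])
  moreover have "norm (S (N mod q)) \<le> (\<Sum>j<q. norm (f j))" for N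
    unfolding S_def using q
    by (intro order_trans[OF norm_sum] sum_mono2) (auto intro: less_trans)
  ultimately have S: "norm (S N) \<le> (\<Sum>j<q. norm (f j))" for N by metis
  have "S (Suc N) = f 0 + (\<Sum>k=1..N. f k)"
    unfolding S_def by (induction N) (auto simp: algebra_simps)
  hence "(\<Sum>k=1..N. f k) = S (Suc N) - f 0" by simp
  also have "norm \<dots> \<le> norm (S (Suc N)) + norm (f 0)" by (rule norm_triangle_ineq4)
  finally show ?thesis using S[of "Suc N"] by linarith
qed

lemma dirichlet_char_centered_bounded:
  assumes "dirichlet_char q chi"
  obtains B where "\<And>N. cmod (\<Sum>k=1..N. chi k - char_mean q chi) \<le> B"
proof (rule that, rule periodic_partial_sums_bounded)
  show "q > 0" "chi (n + q) - char_mean q chi = chi n - char_mean q chi" for n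
    using assms by (auto simp: dirichlet_char_def)
  thus "(\<Sum>j<q. chi j - char_mean q chi) = 0" by (simp add: sum_subtractf char_mean_def)
qed

text \<open>
  The continuation of \<open>L(s, \<chi>)\<close>: the mean of \<open>\<chi>\<close> contributes a multiple of the zeta function, the rest has
  bounded partial sums. If the mean is 0, this is the right value at \<open>s = 1\<close> as well.
\<close>

definition Lcont :: "nat \<Rightarrow> (nat \<Rightarrow> complex) \<Rightarrow> complex \<Rightarrow> complex" where
  "Lcont q chi s = char_mean q chi * (zeta_fac s / (s - 1)) + dser (\<lambda>n. chi n - char_mean q chi) s"

lemma Lcont_holomorphic:
  assumes "dirichlet_char q chi"
  shows "Lcont q chi holomorphic_on {s. Re s > 0} - {1}"
    and "char_mean q chi = 0 \<Longrightarrow> Lcont q chi holomorphic_on {s. Re s > 0}"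
    and "dser (\<lambda>n. chi n - char_mean q chi) holomorphic_on {s. Re s > 0}"
proof -
  obtain B where B: "\<And>N. cmod (\<Sum>k=1..N. chi k - char_mean q chi) \<le> B"
    using dirichlet_char_centered_bounded[OF assms] by blast
  show D: "dser (\<lambda>n. chi n - char_mean q chi) holomorphic_on {s. Re s > 0}"
    by (rule dser_bounded_partial_sums(2)[OF B])
  show "Lcont q chi holomorphic_on {s. Re s > 0} - {1}"
    unfolding Lcont_def[abs_def]
    by (intro holomorphic_intros holomorphic_on_subset[OF D] holomorphic_on_subset[OF zeta_fac_holomorphic]) auto
  assume "char_mean q chi = 0"
  thus "Lcont q chi holomorphic_on {s. Re s > 0}" using D by (simp add: Lcont_def[abs_def])
qed

lemma Lcont_eq_dser:
  assumes "dirichlet_char q chi" "Re s > 1"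
  shows "Lcont q chi s = dser chi s"
proof -
  let ?m = "char_mean q chi"
  obtain B where B: "\<And>N. cmod (\<Sum>k=1..N. chi k - ?m) \<le> B"
    using dirichlet_char_centered_bounded[OF assms(1)] by blast
  have "(\<lambda>n. (chi n - ?m) * of_nat n powr (-s)) sums dser (\<lambda>n. chi n - ?m) s"
    using dser_bounded_partial_sums(1)[OF B, of s] assms by simp
  moreover have "(\<lambda>n. ?m * (1 * of_nat n powr (-s))) sums (?m * dser (\<lambda>_. 1) s)"
    using assms by (intro sums_mult dser_sums[of _ 1]) auto
  ultimately have "(\<lambda>n. (chi n - ?m) * of_nat n powr (-s) + ?m * (1 * of_nat n powr (-s))) sums
      (dser (\<lambda>n. chi n - ?m) s + ?m * dser (\<lambda>_. 1) s)" by (rule sums_add)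
  hence "dser chi s = dser (\<lambda>n. chi n - ?m) s + ?m * dser (\<lambda>_. 1) s"
    unfolding dser_def[of chi] by (simp add: algebra_simps sums_iff)
  thus ?thesis using zeta_fac_eq[OF assms(2)] assms by (auto simp: Lcont_def)
qed

lemma dser_moebius_char:
  assumes "dirichlet_char q chi" "Re s > 1"
  shows "dser (\<lambda>n. of_int (moebius_mu n) * chi n) s * dser chi s = 1"
proof -
  have mu: "cmod (of_int (moebius_mu n) * chi n) \<le> 1" for n
    using dirichlet_char_norm[OF assms(1), of n] abs_moebius_mu_le[of n]
    by (auto simp: norm_mult intro!: mult_le_one)
  have "(\<lambda>n. (if n = 1 then 1 else 0) * of_nat n powr (-s)) sums
      (dser (\<lambda>n. of_int (moebius_mu n) * chi n) s * dser chi s)"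
  proof (rule dser_mult)
    fix n :: nat assume n: "n > 0"
    have "(\<Sum>d | d dvd n. of_int (moebius_mu d) * chi d * chi (n div d)) = (\<Sum>d | d dvd n. of_int (moebius_mu d) * chi n)"
    proof (rule sum.cong)
      fix d assume "d \<in> {d. d dvd n}"
      hence "chi d * chi (n div d) = chi n" using assms(1) n by (intro dirichlet_char_divisor) auto
      thus "of_int (moebius_mu d) * chi d * chi (n div d) = of_int (moebius_mu d) * chi n" by simp
    qed auto
    also have "\<dots> = of_int (\<Sum>d | d dvd n. moebius_mu d) * chi n" by (simp add: sum_distrib_right)
    finally show "(if n = 1 then 1 else 0) = (\<Sum>d | d dvd n. of_int (moebius_mu d) * chi d * chi (n div d))"
      using n dirichlet_char_1[OF assms(1)] by (simp add: sum_divisors_moebius_mu)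
  qed (intro dser_abs_summable[of _ 1] mu dirichlet_char_norm[OF assms(1)] assms)+
  moreover have "(\<lambda>n. (if n = 1 then 1 else 0) * of_nat n powr (-s)) sums (1 :: complex)"
    using sums_single[of 1 "\<lambda>n. of_nat n powr (-s) :: complex"] by (simp add: if_distrib[of "\<lambda>x. x * _"] cong: if_cong)
  ultimately show ?thesis using sums_unique2 by blast
qed

lemma Lcont_nonzero_gt_1: "dirichlet_char q chi \<Longrightarrow> Re s > 1 \<Longrightarrow> Lcont q chi s \<noteq> 0"
  using dser_moebius_char[of q chi s] by (auto simp: Lcont_eq_dser)

text \<open>
  The identity \<open>- L' = L \<cdot> \<Sum> \<Lambda>(n) \<chi>(n) n^(-s)\<close>, a consequence of \<open>\<Sum> \<Lambda>(d) = ln n\<close> over the divisors \<open>d\<close> of \<open>n\<close>.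
\<close>

lemma dser_mangoldt_char:
  assumes "dirichlet_char q chi" "Re s > 1"
  shows "(\<lambda>n. mangoldt n * chi n * of_nat n powr (-s)) sums (- deriv (Lcont q chi) s / Lcont q chi s)"
proof -
  \<comment> \<open>Half of the excess over 1 pays for the logarithm in \<open>\<Lambda>(n) \<le> ln n\<close>.\<close>
  define e where "e = (Re s - 1) / 2"
  have e: "e > 0" using assms by (simp add: e_def)
  have norm1: "cmod (chi n) \<le> 1" for n by (rule dirichlet_char_norm[OF assms(1)])
  have summ: "summable (\<lambda>n. cmod (mangoldt n * chi n * of_nat n powr (-s)))"
  proof (rule summable_comparison_test'[of "\<lambda>n. (1 / e) * real n powr (-(1 + e))" 0])
    show "summable (\<lambda>n. (1 / e) * real n powr (-(1 + e)))"
      using e by (intro summable_mult summable_nat_powr) auto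
    fix n :: nat
    show "norm (cmod (mangoldt n * chi n * of_nat n powr (-s))) \<le> (1 / e) * real n powr (-(1 + e))"
    proof (cases "n = 0")
      case False
      have "mangoldt n \<le> real n powr e / e" 
        using mangoldt_le[of n] False ln_powr_bound[of "real n" e] e by linarith
      hence "mangoldt n * cmod (chi n) * real n powr (- Re s) \<le> (real n powr e / e) * 1 * real n powr (- Re s)"
        using norm1[of n] e mangoldt_nonneg[of n] by (intro mult_mono) auto
      also have "\<dots> = (1 / e) * (real n powr e * real n powr (- Re s))" by simp
      also have "real n powr e * real n powr (- Re s) = real n powr (-(1 + e))"
        unfolding powr_add[symmetric] by (rule arg_cong[of _ _ "\<lambda>x. real n powr x"]) (simp add: e_def field_simps)
      finally have "mangoldt n * cmod (chi n) * real n powr (- Re s) \<le> (1 / e) * real n powr (-(1 + e))" .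
      moreover have "cmod (mangoldt n * chi n * of_nat n powr (-s)) = mangoldt n * cmod (chi n) * real n powr (- Re s)"
        by (simp add: norm_mult norm_nat_powr)
      ultimately show ?thesis by (subst real_norm_def, subst abs_norm_cancel) linarith
    qed simp
  qed
  have "(\<lambda>n. (chi n * ln (of_nat n)) * of_nat n powr (-s)) sums (dser (\<lambda>n. mangoldt n * chi n) s * dser chi s)"
  proof (rule dser_mult[OF summ])
    show "summable (\<lambda>n. cmod (chi n * of_nat n powr (-s)))" by (rule dser_abs_summable[OF norm1 assms(2)])
    fix n :: nat assume n: "n > 0"
    have "(\<Sum>d | d dvd n. mangoldt d * chi d * chi (n div d)) = (\<Sum>d | d dvd n. mangoldt d * chi n)"
    proof (rule sum.cong)
      fix d assume "d \<in> {d. d dvd n}"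
      hence "chi d * chi (n div d) = chi n" using assms(1) n by (intro dirichlet_char_divisor) auto
      thus "mangoldt d * chi d * chi (n div d) = mangoldt d * chi n" by simp
    qed auto
    also have "\<dots> = (\<Sum>d | d dvd n. mangoldt d) * chi n" by (simp add: sum_distrib_right)
    finally show "chi n * ln (of_nat n) = (\<Sum>d | d dvd n. mangoldt d * chi d * chi (n div d))"
      using n by (simp add: mangoldt_sum Ln_of_nat)
  qed
  hence "(\<lambda>n. - ((chi n * ln (of_nat n)) * of_nat n powr (-s))) sums - (dser (\<lambda>n. mangoldt n * chi n) s * dser chi s)"
    by (rule sums_minus)
  hence sums': "(\<lambda>n. chi n * (- ln (of_nat n)) * of_nat n powr (-s)) sums - (dser (\<lambda>n. mangoldt n * chi n) s * dser chi s)"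
    by (simp only: mult_minus_left mult_minus_right)
  have d: "- (dser (\<lambda>n. mangoldt n * chi n) s * dser chi s) = deriv (dser chi) s"
    by (rule sums_unique2[OF sums' dser_has_field_derivative(1)[OF norm1 assms(2)]])
  have "deriv (Lcont q chi) s = deriv (dser chi) s"
  proof (rule deriv_cong_ev)
    have "eventually (\<lambda>x. x \<in> {s. Re s > 1}) (nhds s)"
      using assms by (intro eventually_nhds_in_open open_halfspace_Re_gt) auto
    thus "\<forall>\<^sub>F x in nhds s. Lcont q chi x = dser chi x"
      by eventually_elim (use assms in \<open>auto intro: Lcont_eq_dser\<close>)
  qed auto
  hence "dser (\<lambda>n. mangoldt n * chi n) s = - deriv (Lcont q chi) s / Lcont q chi s"
  proof -
    have L0: "dser chi s \<noteq> 0" using Lcont_nonzero_gt_1[OF assms] Lcont_eq_dser[OF assms] by simp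
    have "- deriv (Lcont q chi) s / Lcont q chi s = - (- (dser (\<lambda>n. mangoldt n * chi n) s * dser chi s)) / dser chi s"
      unfolding \<open>deriv (Lcont q chi) s = _\<close> d Lcont_eq_dser[OF assms] ..
    thus ?thesis using L0 by simp
  qed
  moreover have "(\<lambda>n. mangoldt n * chi n * of_nat n powr (-s)) sums dser (\<lambda>n. mangoldt n * chi n) s"
    unfolding dser_def by (rule summable_sums, rule summable_norm_cancel, rule summ)
  ultimately show ?thesis by simp
qed

abbreviation log_deriv :: "(complex \<Rightarrow> complex) \<Rightarrow> complex \<Rightarrow> complex" where
  "log_deriv f s \<equiv> deriv f s / f s"

abbreviation neg_log_deriv :: "(complex \<Rightarrow> complex) \<Rightarrow> complex \<Rightarrow> complex" where
  "neg_log_deriv f s \<equiv> - deriv f s / f s"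

section \<open>Non-vanishing on the line Re s = 1\<close>

text \<open>
  The coefficients on the left are \<open>\<Lambda>(n) n^(-1-e) (3 + 4 Re w + Re w\<^sup>2)\<close> with \<open>w = \<chi>(n) n^(-it)\<close>, and
  \<open>3 + 4 Re w + Re w\<^sup>2 \<ge> 2 (1 + Re w)\<^sup>2\<close> whenever \<open>|w| \<le> 1\<close>.
\<close>

lemma three_four_one:
  fixes t e :: real
  assumes chi: "dirichlet_char q chi" and e: "e > 0"
  shows "3 * Re (neg_log_deriv (Lcont 1 (\<lambda>_. 1)) (1 + of_real e))
       + 4 * Re (neg_log_deriv (Lcont q chi) (1 + \<i> * t + of_real e))
       + Re (neg_log_deriv (Lcont q (\<lambda>n. chi n ^ 2)) (1 + 2 * \<i> * t + of_real e)) \<ge> 0"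
  (is "3 * Re ?a + 4 * Re ?b + Re ?c \<ge> 0")
proof -
  let ?A = "\<lambda>n. mangoldt n * 1 * of_nat n powr (-(1 + of_real e)) :: complex"
  let ?B = "\<lambda>n. mangoldt n * chi n * of_nat n powr (-(1 + \<i> * t + of_real e))"
  let ?C = "\<lambda>n. mangoldt n * chi n ^ 2 * of_nat n powr (-(1 + 2 * \<i> * t + of_real e))"
  have A: "?A sums ?a" using e by (intro dser_mangoldt_char dirichlet_char_trivial) auto
  have B: "?B sums ?b" using e by (intro dser_mangoldt_char chi) auto
  have C: "?C sums ?c" using e by (intro dser_mangoldt_char dirichlet_char_square chi) auto
  have S: "(\<lambda>n. 3 * Re (?A n) + 4 * Re (?B n) + Re (?C n)) sums (3 * Re ?a + 4 * Re ?b + Re ?c)"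
    by (intro sums_add sums_mult sums_Re A B C)
  have "3 * Re (?A n) + 4 * Re (?B n) + Re (?C n) \<ge> 0" for n
  proof (cases "n = 0")
    case False
    define w where "w = chi n * of_nat n powr (-\<i> * t)"
    have w: "cmod w \<le> 1"
      using dirichlet_char_norm[OF chi, of n] False by (simp add: w_def norm_mult norm_nat_powr)
    define p where "p = mangoldt n * real n powr (-(1 + e))"
    have p: "p \<ge> 0" by (simp add: p_def mangoldt_nonneg)
    have pc: "of_nat n powr (-(1 + of_real e)) = complex_of_real (real n powr (-(1 + e)))"
      using False powr_of_real[of "real n" "-(1 + e)"] by simp
    have a: "?A n = of_real p" by (simp only: pc p_def of_real_mult of_real_mangoldt) simp
    have "of_nat n powr (-(1 + \<i> * t + of_real e)) = of_nat n powr (-(1 + of_real e)) * (of_nat n powr (-\<i> * t) :: complex)"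
      unfolding powr_add[symmetric] by (rule arg_cong[of _ _ "\<lambda>z. of_nat n powr z"]) simp
    hence b: "?B n = of_real p * w" by (simp only: pc p_def of_real_mult of_real_mangoldt w_def mult_ac)
    have "of_nat n powr (-(1 + 2 * \<i> * t + of_real e)) =
       of_nat n powr (-(1 + of_real e)) * ((of_nat n powr (-\<i> * t)) * (of_nat n powr (-\<i> * t)) :: complex)"
      unfolding powr_add[symmetric] by (rule arg_cong[of _ _ "\<lambda>z. of_nat n powr z"]) simp
    hence c: "?C n = of_real p * w ^ 2"
      by (simp only: pc p_def of_real_mult of_real_mangoldt w_def mult_ac power2_eq_square)
    have "(Re w)\<^sup>2 + (Im w)\<^sup>2 \<le> 1" using w by (simp add: cmod_def)
    hence "Re (w ^ 2) \<ge> 2 * (Re w)\<^sup>2 - 1" by (simp add: power2_eq_square)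
    moreover have "2 * (1 + Re w)\<^sup>2 \<ge> 0" by simp
    ultimately have "3 + 4 * Re w + Re (w ^ 2) \<ge> 0" by (simp add: power2_sum power2_eq_square algebra_simps)
    hence "p * (3 + 4 * Re w + Re (w ^ 2)) \<ge> 0" using p by simp
    thus ?thesis unfolding a b c by (simp add: algebra_simps)
  qed simp
  thus ?thesis using sums_le[OF _ sums_zero S] by simp
qed

text \<open>
  Approached from the right, \<open>e g'(s0 + e) / g(s0 + e)\<close> tends to the order of the zero of \<open>g\<close> at \<open>s0\<close>.
\<close>

lemma log_deriv_limit:
  assumes g: "g holomorphic_on U" and U: "open U" "s0 \<in> U" and nz: "\<And>e. e > 0 \<Longrightarrow> g (s0 + of_real e) \<noteq> 0"
  obtains k :: nat where "((\<lambda>e. of_real e * log_deriv g (s0 + of_real e)) \<longlongrightarrow> of_nat k) (at_right (0::real))"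
    "k = 0 \<longleftrightarrow> g s0 \<noteq> 0"
proof -
  have lim0: "((\<lambda>e. s0 + of_real e) \<longlongrightarrow> s0) (at_right (0::real))"
    by (auto intro!: tendsto_eq_intros)
  have lime: "((\<lambda>e. complex_of_real e) \<longlongrightarrow> 0) (at_right 0)"
    by (auto intro!: tendsto_eq_intros)
  have cont: "((\<lambda>e. h (s0 + of_real e)) \<longlongrightarrow> h s0) (at_right (0::real))" if "h holomorphic_on V" "open V" "s0 \<in> V" for h V
  proof -
    have "isCont h s0" using that by (metis continuous_on_eq_continuous_at holomorphic_on_imp_continuous_on)
    thus ?thesis by (rule isCont_tendsto_compose[OF _ lim0])
  qed
  show ?thesis
  proof (cases "g s0 = 0")
    case False
    have "((\<lambda>e. of_real e * log_deriv g (s0 + of_real e)) \<longlongrightarrow> 0 * log_deriv g s0) (at_right (0::real))"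
      using False by (intro tendsto_intros lime cont[OF g U] cont[OF holomorphic_deriv[OF g U(1)] U]) auto
    thus ?thesis using that[of 0] False by simp
  next
    case True
    obtain R where R: "R > 0" "ball s0 R \<subseteq> U" using U by (auto simp: open_contains_ball)
    have "\<not> g constant_on ball s0 R"
    proof
      assume "g constant_on ball s0 R"
      hence "g (s0 + of_real (R/2)) = g s0" using R by (auto simp: constant_on_def dist_norm)
      thus False using nz[of "R/2"] R True by simp
    qed
    then obtain h r n where h: "0 < n" "0 < r" "ball s0 r \<subseteq> ball s0 R" "h holomorphic_on ball s0 r"
      "\<And>w. w \<in> ball s0 r \<Longrightarrow> g w = (w - s0) ^ n * h w" "\<And>w. w \<in> ball s0 r \<Longrightarrow> h w \<noteq> 0"
      using holomorphic_factor_zero_nonconstant[of g "ball s0 R" s0] g R True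
      by (metis centre_in_ball connected_ball holomorphic_on_subset open_ball)
    have "((\<lambda>e. of_nat n + of_real e * log_deriv h (s0 + of_real e)) \<longlongrightarrow>
        of_nat n + 0 * log_deriv h s0) (at_right (0::real))"
      using h by (intro tendsto_intros lime cont[OF h(4)] cont[OF holomorphic_deriv[OF h(4)]]) auto
    moreover have "eventually (\<lambda>e. of_nat n + of_real e * log_deriv h (s0 + of_real e) =
        of_real e * log_deriv g (s0 + of_real e)) (at_right (0::real))"
    proof -
      have "eventually (\<lambda>e::real. e \<in> {0<..<r}) (at_right 0)" using h by (intro eventually_at_right_real)
      thus ?thesis
      proof eventually_elim
        case (elim e)
        let ?w = "s0 + of_real e"
        have w: "?w \<in> ball s0 r" using elim by (simp add: dist_norm)
        have e: "complex_of_real e \<noteq> 0" using elim by simp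
        have "(h has_field_derivative deriv h ?w) (at ?w)" using h w by (auto intro: holomorphic_derivI)
        hence "((\<lambda>w. (w - s0) ^ n * h w) has_field_derivative
            (of_nat n * (?w - s0) ^ (n - 1) * h ?w + (?w - s0) ^ n * deriv h ?w)) (at ?w)"
          by (auto intro!: derivative_eq_intros)
        hence "(g has_field_derivative (of_nat n * (?w - s0) ^ (n - 1) * h ?w + (?w - s0) ^ n * deriv h ?w)) (at ?w)"
          by (rule has_field_derivative_transform_within_open[of _ _ _ "ball s0 r"]) (use w h in auto)
        hence d: "deriv g ?w = of_nat n * of_real e ^ (n - 1) * h ?w + of_real e ^ n * deriv h ?w"
          by (simp add: DERIV_imp_deriv)
        have "complex_of_real e ^ n = of_real e * of_real e ^ (n - 1)" using h(1) by (simp flip: power_Suc)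
        thus ?case unfolding d h(5)[OF w] using e h(6)[OF w] by (simp add: field_simps)
      qed
    qed
    ultimately have "((\<lambda>e. of_real e * log_deriv g (s0 + of_real e)) \<longlongrightarrow> of_nat n + 0 * log_deriv h s0) (at_right (0::real))"
      by (rule Lim_transform_eventually)
    thus ?thesis using that[of n] h(1) True by simp
  qed
qed

text \<open>
  The zeta function has a simple pole at 1.
\<close>

lemma Lcont_trivial_limit:
  "((\<lambda>e. of_real e * log_deriv (Lcont 1 (\<lambda>_. 1)) (1 + of_real e)) \<longlongrightarrow> -1) (at_right (0::real))"
proof -
  let ?L = "Lcont 1 (\<lambda>_. 1)" 
  have zf: "zeta_fac holomorphic_on {s. Re s > 0}" "open {s. Re s > 0}" "1 \<in> {s. Re s > 0}"
    by (auto intro: zeta_fac_holomorphic open_halfspace_Re_gt)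
  have Leq: "?L s = zeta_fac s / (s - 1)" for s
    by (simp add: Lcont_def char_mean_def dser_def)
  have nz: "zeta_fac (1 + of_real e) \<noteq> 0" if "e > 0" for e
    using Lcont_nonzero_gt_1[OF dirichlet_char_trivial, of "1 + of_real e"] that unfolding Leq by auto
  obtain k where k: "((\<lambda>e. of_real e * log_deriv zeta_fac (1 + of_real e)) \<longlongrightarrow> of_nat k) (at_right (0::real))"
    "k = 0 \<longleftrightarrow> zeta_fac 1 \<noteq> 0" using log_deriv_limit[OF zf nz] by blast
  have "k = 0" using k(2) zeta_fac_1 by simp
  hence "((\<lambda>e. of_real e * log_deriv zeta_fac (1 + of_real e) - 1) \<longlongrightarrow> 0 - 1) (at_right (0::real))"
    using k(1) by (intro tendsto_intros) simp
  moreover have "eventually (\<lambda>e. of_real e * log_deriv zeta_fac (1 + of_real e) - 1 =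
      of_real e * (deriv ?L (1 + of_real e) / ?L (1 + of_real e))) (at_right (0::real))"
    using eventually_at_right_less[of "0::real"]
  proof eventually_elim
    case (elim e)
    let ?s = "1 + complex_of_real e"
    have e: "complex_of_real e \<noteq> 0" using elim by simp
    have "(zeta_fac has_field_derivative deriv zeta_fac ?s) (at ?s)"
      using elim zf by (intro holomorphic_derivI) auto
    hence "((\<lambda>s. zeta_fac s / (s - 1)) has_field_derivative
        (deriv zeta_fac ?s * (?s - 1) - zeta_fac ?s * 1) / ((?s - 1) * (?s - 1))) (at ?s)"
      using e by (intro DERIV_divide) (auto intro!: derivative_eq_intros)
    hence "(?L has_field_derivative (deriv zeta_fac ?s * of_real e - zeta_fac ?s) / (of_real e * of_real e)) (at ?s)"
      unfolding Leq[abs_def] by simp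
    hence "deriv ?L ?s = (deriv zeta_fac ?s * of_real e - zeta_fac ?s) / (of_real e * of_real e)"
      by (rule DERIV_imp_deriv)
    thus ?case unfolding Leq using e nz[OF elim] by (simp only:) (simp add: field_simps)
  qed
  ultimately show ?thesis by (simp add: tendsto_cong)
qed

text \<open>
  If \<open>L(s, \<chi>)\<close> had a zero of order \<open>k \<ge> 1\<close> at \<open>1 + it\<close> and \<open>L(s, \<chi>\<^sup>2)\<close> one of order \<open>k2 \<ge> 0\<close> at \<open>1 + 2it\<close>,
  the previous inequality multiplied by \<open>e\<close> would give \<open>3 - 4 k - k2 \<ge> 0\<close> in the limit. The second
  assumption ensures that \<open>L(s, \<chi>\<^sup>2)\<close> has no pole at that point.
\<close>

lemma Lcont_nonzero_of_square:
  fixes t :: real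
  assumes chi: "dirichlet_char q chi"
    and 1: "t \<noteq> 0 \<or> char_mean q chi = 0" and 2: "t \<noteq> 0 \<or> char_mean q (\<lambda>n. chi n ^ 2) = 0"
  shows "Lcont q chi (1 + \<i> * t) \<noteq> 0"
proof
  assume zero: "Lcont q chi (1 + \<i> * t) = 0"
  let ?q = "\<lambda>n. chi n ^ 2"
  note chi2 = dirichlet_char_square[OF chi]
  \<comment> \<open>The domain of holomorphy of the continued L-function.\<close>
  define U where "U = (\<lambda>chi. if char_mean q chi = 0 then {s. Re s > 0} else {s. Re s > 0} - {1 :: complex})"
  have U: "open (U chi)" for chi
    unfolding U_def by (auto intro!: open_halfspace_Re_gt open_delete)
  have hol: "Lcont q f holomorphic_on U f" if "dirichlet_char q f" for f
    using Lcont_holomorphic[OF that] by (simp add: U_def)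
  have in1: "1 + \<i> * t \<in> U chi" using 1 by (auto simp: U_def complex_eq_iff)
  have in2: "1 + 2 * \<i> * t \<in> U ?q" using 2 by (auto simp: U_def complex_eq_iff)
  have nz1: "Lcont q chi (1 + \<i> * t + of_real e) \<noteq> 0" if "e > 0" for e
    by (rule Lcont_nonzero_gt_1[OF chi]) (use that in simp)
  have nz2: "Lcont q ?q (1 + 2 * \<i> * t + of_real e) \<noteq> 0" if "e > 0" for e
    by (rule Lcont_nonzero_gt_1[OF chi2]) (use that in simp)
  obtain k where k: "((\<lambda>e. of_real e * log_deriv (Lcont q chi) (1 + \<i> * t + of_real e)) \<longlongrightarrow> of_nat k) (at_right (0::real))"
    "k = 0 \<longleftrightarrow> Lcont q chi (1 + \<i> * t) \<noteq> 0"
    using log_deriv_limit[OF hol[OF chi] U in1 nz1] by blast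
  obtain k2 where k2: "((\<lambda>e. of_real e * log_deriv (Lcont q ?q) (1 + 2 * \<i> * t + of_real e)) \<longlongrightarrow> of_nat k2) (at_right (0::real))"
    using log_deriv_limit[OF hol[OF chi2] U in2 nz2] by blast
  have "((\<lambda>e. 3 * - Re (of_real e * log_deriv (Lcont 1 (\<lambda>_. 1)) (1 + of_real e))
      + 4 * - Re (of_real e * log_deriv (Lcont q chi) (1 + \<i> * t + of_real e))
      + - Re (of_real e * log_deriv (Lcont q ?q) (1 + 2 * \<i> * t + of_real e)))
      \<longlongrightarrow> 3 * - Re (-1) + 4 * - Re (of_nat k) + - Re (of_nat k2)) (at_right (0::real))"
    by (intro tendsto_add tendsto_mult tendsto_const tendsto_minus tendsto_Re k k2 Lcont_trivial_limit)
  moreover have "eventually (\<lambda>e. 0 \<le> 3 * - Re (of_real e * log_deriv (Lcont 1 (\<lambda>_. 1)) (1 + of_real e))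
      + 4 * - Re (of_real e * log_deriv (Lcont q chi) (1 + \<i> * t + of_real e))
      + - Re (of_real e * log_deriv (Lcont q ?q) (1 + 2 * \<i> * t + of_real e))) (at_right (0::real))"
    using eventually_at_right_less[of "0::real"]
  proof eventually_elim
    case (elim e)
    have "0 \<le> e * (3 * Re (neg_log_deriv (Lcont 1 (\<lambda>_. 1)) (1 + of_real e))
       + 4 * Re (neg_log_deriv (Lcont q chi) (1 + \<i> * t + of_real e))
       + Re (neg_log_deriv (Lcont q ?q) (1 + 2 * \<i> * t + of_real e)))"
      using three_four_one[OF chi elim, of t] elim by (intro mult_nonneg_nonneg) auto
    thus ?case by (simp only: minus_divide_left[symmetric] uminus_complex.sel Re_complex_of_real times_complex.sel
          Im_complex_of_real mult_zero_left diff_zero) (simp add: algebra_simps)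
  qed
  ultimately have "0 \<le> 3 * - Re (-1) + 4 * - Re (of_nat k) + - Re (of_nat k2 :: complex)"
    by (rule tendsto_lowerbound) simp
  hence "4 * real k + real k2 \<le> 3" by simp
  moreover have "k \<ge> 1" using k(2) zero by (cases k) auto
  ultimately show False by linarith
qed

text \<open>
  Multiplication by a unit \<open>a\<close> permutes the residues, so \<open>\<chi>(a)\<close> times the mean of \<open>\<chi>\<close> is that mean.
\<close>

lemma char_mean_nonzero_imp_1:
  assumes chi: "dirichlet_char q chi" and m: "char_mean q chi \<noteq> 0" and a: "coprime a q"
  shows "chi a = 1"
proof -
  have q: "q > 0" using chi by (simp add: dirichlet_char_def)
  have inj: "inj_on (\<lambda>j. a * j mod q) {..<q}"
  proof (rule inj_onI)
    fix i j assume "i \<in> {..<q}" "j \<in> {..<q}" "a * i mod q = a * j mod q"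
    moreover from this have "[a * i = a * j] (mod q)" by (simp add: cong_def)
    hence "[i = j] (mod q)" using cong_mult_lcancel_nat[OF a] by blast
    ultimately show "i = j" by (simp add: cong_def)
  qed
  have "(\<lambda>j. a * j mod q) ` {..<q} \<subseteq> {..<q}" using q by auto
  hence im: "(\<lambda>j. a * j mod q) ` {..<q} = {..<q}" using inj by (intro card_subset_eq) (auto simp: card_image)
  have "(\<Sum>j<q. chi j) = (\<Sum>j\<in>(\<lambda>j. a * j mod q) ` {..<q}. chi j)" by (simp add: im)
  also have "\<dots> = (\<Sum>j<q. chi (a * j mod q))" using inj by (subst sum.reindex) auto
  also have "\<dots> = (\<Sum>j<q. chi a * chi j)"
  proof (rule sum.cong)
    fix j
    have "chi (a * j mod q) = chi (a * j)" by (rule dirichlet_char_cong[OF chi]) (simp add: cong_def)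
    thus "chi (a * j mod q) = chi a * chi j" using chi by (simp add: dirichlet_char_def)
  qed simp
  also have "\<dots> = chi a * (\<Sum>j<q. chi j)" by (simp add: sum_distrib_left)
  finally show ?thesis using m by (auto simp: char_mean_def)
qed

text \<open>
  If \<open>\<chi>\<^sup>2\<close> is principal, \<open>\<chi>\<close> takes only the values 0, 1 and -1.
\<close>

lemma Lcont_nonzero_real_at_1:
  assumes chi: "dirichlet_char q chi" and m: "char_mean q chi = 0" and m2: "char_mean q (\<lambda>n. chi n ^ 2) \<noteq> 0"
  shows "Lcont q chi 1 \<noteq> 0"
proof
  assume L0: "Lcont q chi 1 = 0"
  have vals: "chi n \<in> {-1, 0, 1}" for n
  proof (cases "coprime n q")
    case True
    hence "chi n ^ 2 = 1" using char_mean_nonzero_imp_1[OF dirichlet_char_square[OF chi] m2] by simp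
    thus ?thesis by (auto simp: power2_eq_1_iff)
  next
    case False
    hence "chi n = 0" using chi unfolding dirichlet_char_def by blast
    thus ?thesis by simp
  qed
  define c where "c n = Re (chi n)" for n
  have cc: "chi n = of_real (c n)" for n using vals[of n] by (auto simp: c_def)
  have cv: "c n \<in> {-1, 0, 1}" for n using vals[of n] by (auto simp: c_def)
  have cm: "c (i * j) = c i * c j" for i j
  proof -
    have "chi (i * j) = chi i * chi j" using chi by (simp add: dirichlet_char_def)
    thus ?thesis unfolding cc by (simp flip: of_real_mult)
  qed
  have c1: "c 1 = 1" using dirichlet_char_1[OF chi] by (simp add: c_def)
  obtain B where B: "\<And>N. cmod (\<Sum>k=1..N. chi k) \<le> B"
    using dirichlet_char_centered_bounded[OF chi] m by auto
  have cB: "\<bar>\<Sum>k=1..N. c k\<bar> \<le> B" for N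
  proof -
    have "(\<Sum>k=1..N. chi k) = of_real (\<Sum>k=1..N. c k)" by (simp add: cc)
    thus ?thesis using B[of N] by (simp only: norm_of_real)
  qed
  have "(\<lambda>n. chi n * of_nat n powr (-1)) sums dser chi 1"
    by (rule dser_bounded_partial_sums(1)[OF B]) simp
  hence "(\<lambda>n. chi n * of_nat n powr (-1)) sums 0" using L0 m by (simp add: Lcont_def)
  also have "(\<lambda>n. chi n * of_nat n powr (-1)) = (\<lambda>n. complex_of_real (c n / real n))"
    by (auto simp: fun_eq_iff powr_minus cc field_simps)
  finally have "(\<lambda>n. complex_of_real (c n / real n)) sums 0" .
  from sums_Re[OF this] have "(\<lambda>n. c n / real n) sums 0" by (simp only: Re_complex_of_real zero_complex.sel)
  thus False using real_character_sum_nonzero[OF cv cm c1 cB] by blast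
qed

text \<open>
  The previous criterion fails only if \<open>t = 0\<close> and \<open>\<chi>\<^sup>2\<close> is principal, that is, for a real character at 1.
\<close>

theorem Lcont_nonzero:
  fixes t :: real
  assumes chi: "dirichlet_char q chi" and t: "t \<noteq> 0 \<or> char_mean q chi = 0"
  shows "Lcont q chi (1 + \<i> * t) \<noteq> 0"
proof (cases "t \<noteq> 0 \<or> char_mean q (\<lambda>n. chi n ^ 2) = 0")
  case True
  thus ?thesis using Lcont_nonzero_of_square[OF chi t] by blast
next
  case False
  thus ?thesis using Lcont_nonzero_real_at_1[OF chi] t by simp
qed

corollary Lcont_nonzero_ge_1:
  assumes chi: "dirichlet_char q chi" and s: "Re s \<ge> 1" "s \<noteq> 1 \<or> char_mean q chi = 0"
  shows "Lcont q chi s \<noteq> 0"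
proof (cases "Re s > 1")
  case False
  hence "s = 1 + \<i> * of_real (Im s)" using s by (simp add: complex_eq_iff)
  thus ?thesis using Lcont_nonzero[OF chi, of "Im s"] s by (metis add_0_right mult_zero_right of_real_0)
qed (use Lcont_nonzero_gt_1[OF chi] in simp)

section \<open>Moebius sums twisted by characters\<close>

lemma cesaro_mean:
  fixes u :: "nat \<Rightarrow> complex"
  assumes "u \<longlonglongrightarrow> l"
  shows "(\<lambda>N. (\<Sum>k<N. u k) / of_nat N) \<longlonglongrightarrow> l"
proof (rule LIMSEQ_I)
  fix e :: real assume e: "e > 0"
  obtain K where K: "\<And>k. k \<ge> K \<Longrightarrow> cmod (u k - l) < e / 2"
    using LIMSEQ_D[OF assms, of "e / 2"] e by auto
  define M where "M = (\<Sum>k<K. cmod (u k - l))"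
  have "(\<lambda>N. M / real N) \<longlonglongrightarrow> 0" by real_asymp
  hence "eventually (\<lambda>N. M / real N < e / 2) sequentially" using e by (intro order_tendstoD) auto
  hence "eventually (\<lambda>N. cmod ((\<Sum>k<N. u k) / of_nat N - l) < e) sequentially"
    using eventually_gt_at_top[of K]
  proof eventually_elim
    case (elim N)
    have N: "N > 0" using elim by simp
    have "(\<Sum>k<N. u k) / of_nat N - l = (\<Sum>k<N. u k - l) / of_nat N"
      using N by (simp add: sum_subtractf field_simps)
    moreover have "cmod (\<Sum>k<N. u k - l) \<le> M + real N * (e / 2)"
    proof -
      have "cmod (\<Sum>k<N. u k - l) \<le> (\<Sum>k<N. cmod (u k - l))" by (rule norm_sum)
      also have "\<dots> = (\<Sum>k\<in>{..<K} \<union> {K..<N}. cmod (u k - l))"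
        using elim by (intro sum.cong) auto
      also have "\<dots> = M + (\<Sum>k=K..<N. cmod (u k - l))"
        unfolding M_def by (rule sum.union_disjoint) auto
      also have "(\<Sum>k=K..<N. cmod (u k - l)) \<le> real (card {K..<N}) * (e / 2)"
        using K by (intro sum_bounded_above) (auto intro: less_imp_le)
      also have "\<dots> \<le> real N * (e / 2)" using e by (intro mult_right_mono) auto
      finally show ?thesis by simp
    qed
    ultimately have "cmod ((\<Sum>k<N. u k) / of_nat N - l) \<le> (M + real N * (e / 2)) / real N"
      using N by (simp add: norm_divide divide_right_mono)
    also have "\<dots> = M / real N + e / 2" using N by (simp add: field_simps)
    finally show ?case using elim by linarith
  qed
  thus "\<exists>no. \<forall>n\<ge>no. cmod ((\<Sum>k<n. u k) / of_nat n - l) < e" by (simp add: eventually_sequentially)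
qed

text \<open>
  Partial summation writes the mean of \<open>a\<close> as the difference between the weighted partial sum and the
  mean of these partial sums; both have the same limit.
\<close>

lemma kronecker_lemma:
  fixes a :: "nat \<Rightarrow> complex"
  assumes "(\<lambda>N. \<Sum>n=1..N. a n / of_nat n) \<longlonglongrightarrow> l"
  shows "(\<lambda>N. (\<Sum>n=1..N. a n) / of_nat N) \<longlonglongrightarrow> 0"
proof -
  define s where "s N = (\<Sum>n=1..N. a n / of_nat n)" for N
  have "(\<Sum>n=1..N. a n) = of_nat N * s N - (\<Sum>k<N. s k)" for N
  proof (induction N)
    case (Suc N)
    have "s (Suc N) = s N + a (Suc N) / of_nat (Suc N)" by (simp add: s_def)
    hence "of_nat (Suc N) * s (Suc N) = of_nat (Suc N) * s N + a (Suc N)"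
      by (simp add: distrib_left del: of_nat_Suc)
    thus ?case using Suc by (simp add: algebra_simps)
  qed (simp add: s_def)
  hence eq: "(\<Sum>n=1..N. a n) / of_nat N = s N - (\<Sum>k<N. s k) / of_nat N" if "N > 0" for N
    using that by (simp add: field_simps)
  have s: "s \<longlonglongrightarrow> l" using assms by (simp add: s_def[abs_def])
  have "(\<lambda>N. s N - (\<Sum>k<N. s k) / of_nat N) \<longlonglongrightarrow> l - l"
    by (intro tendsto_diff s cesaro_mean)
  hence "(\<lambda>N. s N - (\<Sum>k<N. s k) / of_nat N) \<longlonglongrightarrow> 0" by simp
  thus ?thesis
    by (rule Lim_transform_eventually)
      (use eventually_gt_at_top[of 0] in eventually_elim, simp only: eq)
qed

lemma open_nonvanishing:
  assumes "f holomorphic_on S" "open S"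
  shows "open {s \<in> S. f s \<noteq> (0::complex)}"
proof -
  have eq: "{s \<in> S. f s \<noteq> 0} = S \<inter> f -` (- {0})" by auto
  show ?thesis unfolding eq
    by (rule continuous_open_preimage[OF holomorphic_on_imp_continuous_on[OF assms(1)] assms(2)]) auto
qed

text \<open>
  The reciprocal of the L-function is holomorphic near the closed half-plane \<open>Re s \<ge> 1\<close>. For a
  principal character the pole at 1 becomes a zero, which the quotient \<open>(s - 1) / G s\<close> makes explicit.
\<close>

theorem moebius_dirichlet_char:
  assumes chi: "dirichlet_char q chi"
  shows "moebius_mean chi \<longlonglongrightarrow> 0"
proof -
  let ?m = "char_mean q chi"
  define a where "a n = of_int (moebius_mu n) * chi n" for n
  have a: "cmod (a n) \<le> 1" for n
    using dirichlet_char_norm[OF chi, of n] abs_moebius_mu_le[of n]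
    by (auto simp: a_def norm_mult intro!: mult_le_one)
  have sums: "(\<lambda>n. a n * of_nat n powr (-s)) sums (1 / Lcont q chi s)" if "Re s > 1" for s
  proof -
    have "dser a s = 1 / Lcont q chi s"
    proof -
      have "a = (\<lambda>n. of_int (moebius_mu n) * chi n)" by (simp add: a_def fun_eq_iff)
      hence "dser a s * Lcont q chi s = 1"
        using dser_moebius_char[OF chi that] Lcont_eq_dser[OF chi that] by (simp only:)
      thus ?thesis using Lcont_nonzero_gt_1[OF chi that] by (simp add: eq_divide_eq)
    qed
    thus ?thesis using dser_sums[where f = a, OF a that] by simp
  qed
  obtain U F where "open U" "{s. Re s \<ge> 1} \<subseteq> U" "F holomorphic_on U"
    "\<And>s. Re s > 1 \<Longrightarrow> F s = 1 / Lcont q chi s"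
  proof (cases "?m = 0")
    case True
    define U where "U = {s \<in> {s. Re s > 0}. Lcont q chi s \<noteq> 0}"
    have hol: "Lcont q chi holomorphic_on {s. Re s > 0}" by (rule Lcont_holomorphic(2)[OF chi True])
    have "open U" unfolding U_def by (rule open_nonvanishing[OF hol open_halfspace_Re_gt])
    moreover have "{s. Re s \<ge> 1} \<subseteq> U" using Lcont_nonzero_ge_1[OF chi] True by (auto simp: U_def)
    moreover have "(\<lambda>s. 1 / Lcont q chi s) holomorphic_on U"
      by (intro holomorphic_intros holomorphic_on_subset[OF hol]) (auto simp: U_def)
    ultimately show ?thesis by (intro that[of U "\<lambda>s. 1 / Lcont q chi s"]) auto
  next
    case False
    define G where "G s = ?m * zeta_fac s + (s - 1) * dser (\<lambda>n. chi n - ?m) s" for s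
    define U where "U = {s \<in> {s. Re s > 0}. G s \<noteq> 0}"
    have hol: "G holomorphic_on {s. Re s > 0}"
      unfolding G_def[abs_def] by (intro holomorphic_intros zeta_fac_holomorphic Lcont_holomorphic(3)[OF chi])
    have GL: "G s = (s - 1) * Lcont q chi s" if "s \<noteq> 1" for s
      using that by (simp add: G_def Lcont_def field_simps)
    have "open U" unfolding U_def by (rule open_nonvanishing[OF hol open_halfspace_Re_gt])
    moreover have "{s. Re s \<ge> 1} \<subseteq> U"
    proof
      fix s :: complex assume "s \<in> {s. Re s \<ge> 1}"
      thus "s \<in> U" using False Lcont_nonzero_ge_1[OF chi, of s]
        by (cases "s = 1") (auto simp: U_def GL, simp add: G_def zeta_fac_1)
    qed
    moreover have "(\<lambda>s. (s - 1) / G s) holomorphic_on U"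
      by (intro holomorphic_intros holomorphic_on_subset[OF hol]) (auto simp: U_def)
    moreover have "(s - 1) / G s = 1 / Lcont q chi s" if "Re s > 1" for s
    proof -
      have "s \<noteq> 1" using that by auto
      thus ?thesis by (simp add: GL)
    qed
    ultimately show ?thesis by (intro that[of U "\<lambda>s. (s - 1) / G s"]) auto
  qed
  note UF = this
  have "(\<lambda>n. a n * of_nat n powr (-s)) sums F s" if "Re s > 1" for s
    using sums[OF that] UF(4)[OF that] by simp
  hence "(\<lambda>N. \<Sum>n=1..N. a n / n) \<longlonglongrightarrow> F 1" by (rule newman_tauberian[OF a UF(1-3)])
  hence "(\<lambda>N. (\<Sum>n=1..N. a n) / of_nat N) \<longlonglongrightarrow> 0" by (rule kronecker_lemma)
  thus ?thesis by (simp add: a_def)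
qed

section \<open>Reciprocals of the primes\<close>

lemma real_div_nat_le: "real (n div k) \<le> real n / real k"
  by (rule of_nat_div_le_of_nat)

lemma card_multiples:
  assumes "d > 0"
  shows "card {n \<in> {1..N}. d dvd n} = N div d"
proof -
  have "{n \<in> {1..N}. d dvd n} = (*) d ` {1..N div d}"
  proof (intro equalityI subsetI)
    fix n assume "n \<in> {n \<in> {1..N}. d dvd n}"
    then obtain k where "n = d * k" "1 \<le> d * k" "d * k \<le> N" by auto
    thus "n \<in> (*) d ` {1..N div d}" using assms
      by (auto simp: less_eq_div_iff_mult_less_eq mult.commute intro!: image_eqI[of _ _ k])
  qed (use assms in \<open>auto simp: less_eq_div_iff_mult_less_eq mult.commute\<close>)
  moreover have "card ((*) d ` {1..N div d}) = card {1..N div d}"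
    using assms by (intro card_image) (auto simp: inj_on_def)
  ultimately show ?thesis by simp
qed

lemma squarefree_eq_prod_prime_factors:
  fixes n :: nat
  shows "squarefree_part n = \<Prod>(prime_factors (squarefree_part n))"
proof -
  let ?s = "squarefree_part n"
  have "?s = (\<Prod>p\<in>prime_factors ?s. p ^ multiplicity p ?s)"
    by (rule prime_factorization_nat) (rule Nat.gr0I, simp)
  also have "\<dots> = (\<Prod>p\<in>prime_factors ?s. p)"
  proof (rule prod.cong)
    fix p assume p: "p \<in> prime_factors ?s"
    hence "multiplicity p ?s \<le> Suc 0"
      by (intro prime_multiplicity_squarefree_part_le_Suc_0) auto
    moreover have "multiplicity p ?s > 0" using p by (simp add: prime_factors_multiplicity)
    ultimately have "multiplicity p ?s = 1" by linarith
    thus "p ^ multiplicity p ?s = p" by simp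
  qed simp
  finally show ?thesis .
qed

text \<open>
  Counting argument of Erdoes. If the reciprocals of the primes were summable, then for some \<open>K\<close> fewer than half of the
  numbers up to \<open>N\<close> would have a prime factor at least \<open>K\<close>. The others are products of a square and a
  squarefree number composed of primes below \<open>K\<close>; there are at most \<open>2^K \<surd>N\<close> of them, too few for large
  \<open>N\<close>.
\<close>

theorem prime_reciprocals_unbounded:
  obtains P where "finite P" "\<And>p. p \<in> P \<Longrightarrow> prime p" "(\<Sum>p\<in>P. 1 / real p) > L"
proof (rule ccontr)
  assume nt: "\<not> thesis"
  note result = that
  have bd: "(\<Sum>p\<in>P. 1 / real p) \<le> L" if "finite P" "\<And>p. p \<in> P \<Longrightarrow> prime p" for P :: "nat set"
    using that result[of P] nt by (meson not_le)
  define f where "f n = (if prime n then 1 / real n else 0)" for n :: nat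
  have "summable f"
  proof (rule bounded_imp_summable)
    show "(\<Sum>k\<le>n. f k) \<le> L" for n
    proof -
      have "(\<Sum>k\<le>n. f k) = (\<Sum>p\<in>{p \<in> {..n}. prime p}. 1 / real p)"
        unfolding f_def by (rule sum.inter_filter[symmetric]) simp
      also have "\<dots> \<le> L" by (rule bd) auto
      finally show ?thesis .
    qed
  qed (simp add: f_def)
  then obtain K where K: "\<And>m n. m \<ge> K \<Longrightarrow> norm (sum f {m..<n}) < 1 / 2"
    unfolding summable_Cauchy by (meson half_gt_zero_iff zero_less_one)
  \<comment> \<open>For this \<open>N\<close> the bound \<open>2^K \<surd>N\<close> is \<open>N / 4\<close>.\<close>
  define N :: nat where "N = 4 ^ (K + 2)"
  define A where "A = (\<Union>p\<in>{p \<in> {K..<Suc N}. prime p}. {n \<in> {1..N}. p dvd n})"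
  define B where "B = (\<lambda>(S, t). \<Prod>S * t ^ 2) ` (Pow {..<K} \<times> {1..2 ^ (K + 2)})"
  have "{1..N} \<subseteq> A \<union> B"
  proof
    fix n assume n: "n \<in> {1..N}"
    show "n \<in> A \<union> B"
    proof (cases "\<exists>p. prime p \<and> p dvd n \<and> p \<ge> K")
      case True
      then obtain p where "prime p" "p dvd n" "p \<ge> K" by blast
      thus ?thesis using n dvd_imp_le[of p n] by (auto simp: A_def)
    next
      case False
      let ?s = "squarefree_part n" and ?t = "square_part n"
      have dec: "n = ?s * ?t ^ 2" by (rule squarefree_decompose)
      have "prime_factors ?s \<subseteq> {..<K}"
      proof
        fix p assume p: "p \<in> prime_factors ?s"
        hence "p dvd ?s" by auto
        hence "p dvd n" by (subst dec) (rule dvd_mult2)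
        moreover have "prime p" using p by auto
        ultimately show "p \<in> {..<K}" using False by (meson lessThan_iff not_le)
      qed
      moreover have "?t \<in> {1..2 ^ (K + 2)}"
      proof -
        have "?t ^ 2 dvd n" by simp
        hence "?t ^ 2 \<le> N" using n dvd_imp_le[of "?t ^ 2" n] by simp
        also have "N = (2 ^ (K + 2)) ^ 2" unfolding N_def
          by (simp flip: power_mult add: mult.commute[of _ 2]) (simp add: power_mult)
        finally have "?t \<le> 2 ^ (K + 2)" by (rule power2_le_imp_le) simp
        moreover have "?t > 0" using n by (intro Nat.gr0I) auto
        ultimately show ?thesis by (simp add: Suc_le_eq)
      qed
      moreover have "n = \<Prod>(prime_factors ?s) * ?t ^ 2"
        using dec squarefree_eq_prod_prime_factors[of n] by simp
      ultimately have "n \<in> B" unfolding B_def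
        by (intro image_eqI[of _ _ "(prime_factors ?s, ?t)"]) auto
      thus ?thesis by simp
    qed
  qed
  hence "card {1..N} \<le> card (A \<union> B)"
    by (intro card_mono) (auto simp: A_def B_def)
  also have "\<dots> \<le> card A + card B" by (rule card_Un_le)
  finally have NAB: "real N \<le> real (card A) + real (card B)" by simp
  have "card A \<le> (\<Sum>p\<in>{p \<in> {K..<Suc N}. prime p}. card {n \<in> {1..N}. p dvd n})"
    unfolding A_def by (rule card_UN_le) simp
  also have "\<dots> = (\<Sum>p\<in>{p \<in> {K..<Suc N}. prime p}. N div p)"
    by (intro sum.cong card_multiples) (auto simp: prime_gt_0_nat)
  finally have "real (card A) \<le> (\<Sum>p\<in>{p \<in> {K..<Suc N}. prime p}. real (N div p))"
    by (metis of_nat_le_iff of_nat_sum)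
  also have "\<dots> \<le> (\<Sum>p\<in>{p \<in> {K..<Suc N}. prime p}. real N * (1 / real p))"
    using real_div_nat_le[of N] by (intro sum_mono) simp
  also have "\<dots> = real N * (\<Sum>p\<in>{p \<in> {K..<Suc N}. prime p}. 1 / real p)" by (simp add: sum_distrib_left)
  also have "(\<Sum>p\<in>{p \<in> {K..<Suc N}. prime p}. 1 / real p) = sum f {K..<Suc N}"
    unfolding f_def by (rule sum.inter_filter) simp
  also have "real N * \<dots> \<le> real N * (1 / 2)"
    using K[of K "Suc N"] by (intro mult_left_mono) (auto simp: abs_if split: if_splits)
  finally have A: "real (card A) \<le> real N / 2" by simp
  have "card B \<le> card (Pow {..<K} \<times> {1..2 ^ (K + 2) :: nat})"
    unfolding B_def by (rule card_image_le) auto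
  also have "\<dots> = 2 ^ K * 2 ^ (K + 2)" by (simp add: card_cartesian_product card_Pow)
  also have "(2 :: nat) ^ K * 2 ^ (K + 2) = 4 * (2 * 2) ^ K"
    unfolding power_add power_mult_distrib by simp
  finally have "4 * card B \<le> N" by (simp add: N_def power_add)
  hence "real (card B) \<le> real N / 4" by linarith
  moreover have "real N > 0" by (simp add: N_def)
  ultimately show False using NAB A by linarith
qed

section \<open>Katai's criterion\<close>

lemma sum_abs_le_sqrt:
  fixes x :: "nat \<Rightarrow> real"
  shows "(\<Sum>n=1..N. \<bar>x n\<bar>) \<le> sqrt (real N) * sqrt (\<Sum>n=1..N. (x n)\<^sup>2)"
proof -
  have "(\<Sum>n=1..N. \<bar>x n\<bar> * 1)\<^sup>2 \<le> (\<Sum>n=1..N. \<bar>x n\<bar>\<^sup>2) * (\<Sum>n=1..N. 1\<^sup>2)"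
    by (rule Cauchy_Schwarz_ineq_sum)
  hence "(\<Sum>n=1..N. \<bar>x n\<bar>)\<^sup>2 \<le> real N * (\<Sum>n=1..N. (x n)\<^sup>2)" by (simp add: mult.commute)
  hence "(\<Sum>n=1..N. \<bar>x n\<bar>) \<le> sqrt (real N * (\<Sum>n=1..N. (x n)\<^sup>2))" by (rule real_le_rsqrt)
  thus ?thesis by (simp add: real_sqrt_mult)
qed

context
  fixes P :: "nat set" and L :: real
  assumes fin: "finite P" and primes: "\<And>p. p \<in> P \<Longrightarrow> prime p" and L: "L = (\<Sum>p\<in>P. 1 / real p)"
begin

definition prime_divisor_count :: "nat \<Rightarrow> real" where
  "prime_divisor_count n = (\<Sum>p\<in>P. if p dvd n then 1 else 0)"

lemma L_nonneg: "L \<ge> 0"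
  unfolding L by (intro sum_nonneg) auto

text \<open>
  The number of primes in \<open>P\<close> dividing \<open>n\<close> has mean \<open>L\<close> and variance about \<open>L\<close>, because divisibility by
  different primes is almost independent.
\<close>

lemma turan_kubilius:
  "(\<Sum>n=1..N. (prime_divisor_count n - L)\<^sup>2) \<le> real N * L + 2 * L * real (card P)"
proof -
  have pos: "p > 0" if "p \<in> P" for p using primes[OF that] by (simp add: prime_gt_0_nat)
  have cnt: "(\<Sum>n=1..N. if d dvd n then 1 else 0) = real (N div d)" if "d > 0" for d
  proof -
    have "(\<Sum>n=1..N. if d dvd n then 1 else (0::real)) = (\<Sum>n\<in>{n \<in> {1..N}. d dvd n}. 1)"
      by (rule sum.inter_filter[symmetric]) simp
    thus ?thesis using card_multiples[OF that, of N] by simp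
  qed
  have "(\<Sum>n=1..N. prime_divisor_count n) = (\<Sum>p\<in>P. \<Sum>n=1..N. if p dvd n then 1 else 0)"
    unfolding prime_divisor_count_def by (rule sum.swap)
  also have "\<dots> = (\<Sum>p\<in>P. real (N div p))" using pos by (intro sum.cong cnt) auto
  also have "\<dots> \<ge> (\<Sum>p\<in>P. real N * (1 / real p) - 1)"
  proof (rule sum_mono)
    fix p assume "p \<in> P"
    hence p: "real p > 0" using pos by simp
    have "N \<le> p * (N div p) + p" using pos[OF \<open>p \<in> P\<close>] by (metis add_left_mono div_mult_mod_eq mod_less_divisor mult.commute nat_less_le)
    hence "real N \<le> real p * real (N div p) + real p" by (metis of_nat_add of_nat_le_iff of_nat_mult)
    thus "real N * (1 / real p) - 1 \<le> real (N div p)" using p by (simp add: field_simps)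
  qed
  finally have first: "(\<Sum>n=1..N. prime_divisor_count n) \<ge> real N * L - real (card P)"
    by (simp add: sum_subtractf sum_distrib_left L)
  have "(\<Sum>n=1..N. (prime_divisor_count n)\<^sup>2) = (\<Sum>n=1..N. \<Sum>p\<in>P. \<Sum>r\<in>P. if p dvd n \<and> r dvd n then 1 else 0)"
    unfolding prime_divisor_count_def power2_eq_square sum_product by (intro sum.cong refl) auto
  also have "\<dots> = (\<Sum>p\<in>P. \<Sum>r\<in>P. \<Sum>n=1..N. if p dvd n \<and> r dvd n then 1 else 0)"
    by (rule trans[OF sum.swap], rule sum.cong[OF refl], rule sum.swap)
  also have "\<dots> \<le> (\<Sum>p\<in>P. \<Sum>r\<in>P. real N * (1 / real p) * (1 / real r) + (if p = r then real N * (1 / real p) else 0))"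
  proof (intro sum_mono)
    fix p r assume pr: "p \<in> P" "r \<in> P"
    show "(\<Sum>n=1..N. if p dvd n \<and> r dvd n then 1 else 0) \<le>
        real N * (1 / real p) * (1 / real r) + (if p = r then real N * (1 / real p) else 0)"
    proof (cases "p = r")
      case True
      have "(\<Sum>n=1..N. if p dvd n \<and> r dvd n then 1 else 0) = real (N div p)"
        using True cnt[of p] pos pr by simp
      also have "\<dots> \<le> real N * (1 / real p)" using real_div_nat_le[of N p] by simp
      finally have le: "(\<Sum>n=1..N. if p dvd n \<and> r dvd n then 1 else 0) \<le> real N * (1 / real p)" .
      have "0 \<le> real N * (1 / real p) * (1 / real r)" by simp
      thus ?thesis unfolding if_P[OF True] using le by linarith
    next
      case False
      have "coprime p r" using primes pr False by (simp add: primes_coprime)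
      hence "p dvd n \<and> r dvd n \<longleftrightarrow> p * r dvd n" for n by (auto intro: divides_mult dest: dvd_mult_left dvd_mult_right)
      hence "(\<Sum>n=1..N. if p dvd n \<and> r dvd n then 1 else 0) = real (N div (p * r))"
        using cnt[of "p * r"] pos pr by simp
      also have "\<dots> \<le> real N / real (p * r)" by (rule real_div_nat_le)
      finally show ?thesis using False by simp
    qed
  qed
  also have "\<dots> = real N * L\<^sup>2 + real N * L"
    using fin by (simp add: sum.distrib L power2_eq_square sum_product sum_distrib_left sum.delta mult_ac)
  finally have second: "(\<Sum>n=1..N. (prime_divisor_count n)\<^sup>2) \<le> real N * L\<^sup>2 + real N * L" .
  have "(\<Sum>n=1..N. (prime_divisor_count n - L)\<^sup>2) = (\<Sum>n=1..N. (prime_divisor_count n)\<^sup>2) - 2 * L * (\<Sum>n=1..N. prime_divisor_count n) + real N * L\<^sup>2"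
    by (simp add: power2_diff sum.distrib sum_subtractf sum_distrib_left mult_ac)
  also have "\<dots> \<le> (real N * L\<^sup>2 + real N * L) - 2 * L * (real N * L - real (card P)) + real N * L\<^sup>2"
    using second mult_left_mono[OF first, of "2 * L"] L_nonneg by simp
  also have "\<dots> = real N * L + 2 * L * real (card P)" by (simp add: power2_eq_square algebra_simps)
  finally show ?thesis .
qed

context
  fixes F :: "nat \<Rightarrow> complex" and B :: "nat \<Rightarrow> nat \<Rightarrow> real"
  assumes F: "\<And>n. cmod (F n) \<le> 1"
    and B: "\<And>p r K. p \<in> P \<Longrightarrow> r \<in> P \<Longrightarrow> p \<noteq> r \<Longrightarrow> cmod (\<Sum>m=1..K. F (p * m) * cnj (F (r * m))) \<le> B p r"
begin

text \<open>
  The sum over the dilates of \<open>F\<close> against which \<open>\<mu>(m)\<close> is tested after the order of summation is changed.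
\<close>

definition dilate_sum :: "nat \<Rightarrow> nat \<Rightarrow> complex" where
  "dilate_sum N m = (\<Sum>p\<in>P. if p * m \<le> N then F (p * m) else 0)"

text \<open>
  Expanding the square, the diagonal gives \<open>N L\<close>, and the correlations of different dilates are bounded by
  assumption.
\<close>

lemma sum_dilate_sum_square:
  "(\<Sum>m=1..N. (cmod (dilate_sum N m))\<^sup>2) \<le> real N * L + (\<Sum>p\<in>P. \<Sum>r\<in>P. \<bar>B p r\<bar>)"
proof -
  have pos: "p > 0" if "p \<in> P" for p using primes[OF that] by (simp add: prime_gt_0_nat)
  define c where "c p r m = (if p * m \<le> N \<and> r * m \<le> N then F (p * m) * cnj (F (r * m)) else 0)" for p r m
  have "complex_of_real (\<Sum>m=1..N. (cmod (dilate_sum N m))\<^sup>2) = (\<Sum>m=1..N. dilate_sum N m * cnj (dilate_sum N m))"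
    by (simp only: of_real_sum complex_norm_square)
  also have "\<dots> = (\<Sum>m=1..N. \<Sum>p\<in>P. \<Sum>r\<in>P. c p r m)"
    unfolding dilate_sum_def cnj_sum sum_product c_def by (intro sum.cong refl) auto
  also have "\<dots> = (\<Sum>p\<in>P. \<Sum>r\<in>P. \<Sum>m=1..N. c p r m)"
    by (rule trans[OF sum.swap], rule sum.cong[OF refl], rule sum.swap)
  finally have eq: "complex_of_real (\<Sum>m=1..N. (cmod (dilate_sum N m))\<^sup>2) = (\<Sum>p\<in>P. \<Sum>r\<in>P. \<Sum>m=1..N. c p r m)" .
  have bound: "cmod (\<Sum>m=1..N. c p r m) \<le> \<bar>B p r\<bar> + (if p = r then real N * (1 / real p) else 0)"
    if pr: "p \<in> P" "r \<in> P" for p r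
  proof -
    define K where "K = N div max p r"
    have "(\<Sum>m=1..N. c p r m) = (\<Sum>m=1..K. F (p * m) * cnj (F (r * m)))"
    proof (rule sum.mono_neutral_cong_right)
      have iff: "p * m \<le> N \<and> r * m \<le> N \<longleftrightarrow> m \<le> K" for m
      proof -
        have "m \<le> K \<longleftrightarrow> m * max p r \<le> N"
          unfolding K_def using pos[OF pr(1)] by (intro less_eq_div_iff_mult_less_eq) simp
        moreover have "p * m \<le> m * max p r" "r * m \<le> m * max p r"
          by (simp_all add: mult.commute[of m])
        moreover have "m * max p r = p * m \<or> m * max p r = r * m"
          by (simp add: max_def mult.commute)
        ultimately show ?thesis by (metis order_trans)
      qed
      show "{1..K} \<subseteq> {1..N}" using div_le_dividend[of N "max p r"] by (auto simp: K_def)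
      show "\<forall>i\<in>{1..N} - {1..K}. c p r i = 0" using iff by (auto simp: c_def)
      show "c p r m = F (p * m) * cnj (F (r * m))" if "m \<in> {1..K}" for m using that iff[of m] by (simp add: c_def)
    qed simp
    also have "cmod \<dots> \<le> \<bar>B p r\<bar> + (if p = r then real N * (1 / real p) else 0)"
    proof (cases "p = r")
      case True
      have "cmod (\<Sum>m=1..K. F (p * m) * cnj (F (r * m))) \<le> (\<Sum>m=1..K. 1)"
        using F by (intro sum_norm_le) (auto simp: norm_mult intro!: mult_le_one)
      also have "\<dots> = real (N div p)" using True by (simp add: K_def)
      also have "\<dots> \<le> real N * (1 / real p)" using real_div_nat_le[of N p] by simp
      finally show ?thesis using True by simp
    next
      case False
      thus ?thesis using B[OF pr False, of K] by simp
    qed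
    finally show ?thesis .
  qed
  have "(\<Sum>m=1..N. (cmod (dilate_sum N m))\<^sup>2) = cmod (complex_of_real (\<Sum>m=1..N. (cmod (dilate_sum N m))\<^sup>2))"
    by (subst norm_of_real) (auto intro!: abs_of_nonneg[symmetric] sum_nonneg)
  also have "\<dots> \<le> (\<Sum>p\<in>P. \<Sum>r\<in>P. \<bar>B p r\<bar> + (if p = r then real N * (1 / real p) else 0))"
    unfolding eq by (intro sum_norm_le bound)
  also have "\<dots> = real N * L + (\<Sum>p\<in>P. \<Sum>r\<in>P. \<bar>B p r\<bar>)"
    using fin by (simp add: sum.distrib L sum_distrib_left sum.delta)
  finally show ?thesis .
qed

text \<open>
  By the variance bound, \<open>L\<close> times the Moebius sum of \<open>F\<close> may be replaced by the sum weighted by the number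
  of prime divisors in \<open>P\<close>. Writing such \<open>n\<close> as \<open>p m\<close>, the relation \<open>\<mu>(p m) = - \<mu>(m)\<close> for \<open>p\<close> not dividing
  \<open>m\<close> and the Cauchy-Schwarz inequality lead to the dilate sums. The exceptional \<open>m\<close> divisible by \<open>p\<close>
  contribute \<open>N / p\<^sup>2\<close>.
\<close>

lemma katai_bound:
  "L * cmod (\<Sum>n=1..N. of_int (moebius_mu n) * F n) \<le>
     sqrt (real N) * sqrt (real N * L + 2 * L * real (card P))
     + sqrt (real N) * sqrt (real N * L + (\<Sum>p\<in>P. \<Sum>r\<in>P. \<bar>B p r\<bar>))
     + real N * (\<Sum>n. 1 / (real n)\<^sup>2)"
proof -
  have pos: "p > 0" if "p \<in> P" for p using primes[OF that] by (simp add: prime_gt_0_nat)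
  define a where "a n = of_int (moebius_mu n) * F n" for n
  have mu: "cmod (of_int (moebius_mu n)) \<le> 1" for n
    using abs_moebius_mu_le[of n] by simp
  have a: "cmod (a n) \<le> 1" for n
    unfolding a_def norm_mult using mu F by (intro mult_le_one) auto
  have 1: "cmod (\<Sum>n=1..N. a n * of_real (prime_divisor_count n - L)) \<le> sqrt (real N) * sqrt (real N * L + 2 * L * real (card P))"
  proof -
    have "cmod (\<Sum>n=1..N. a n * of_real (prime_divisor_count n - L)) \<le> (\<Sum>n=1..N. \<bar>prime_divisor_count n - L\<bar>)"
    proof (rule sum_norm_le)
      show "cmod (a n * of_real (prime_divisor_count n - L)) \<le> \<bar>prime_divisor_count n - L\<bar>" for n
        unfolding norm_mult norm_of_real using a[of n] by (intro mult_left_le_one_le) auto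
    qed
    also have "\<dots> \<le> sqrt (real N) * sqrt (\<Sum>n=1..N. (prime_divisor_count n - L)\<^sup>2)" by (rule sum_abs_le_sqrt)
    also have "\<dots> \<le> sqrt (real N) * sqrt (real N * L + 2 * L * real (card P))"
      by (intro mult_left_mono real_sqrt_le_mono turan_kubilius) auto
    finally show ?thesis .
  qed
  have "(\<Sum>n=1..N. a n * of_real (prime_divisor_count n)) = (\<Sum>p\<in>P. \<Sum>n=1..N. if p dvd n then a n else 0)"
    unfolding prime_divisor_count_def of_real_sum sum_distrib_left
    by (subst sum.swap) (intro sum.cong refl, auto)
  also have "\<dots> = (\<Sum>p\<in>P. \<Sum>m=1..N. if p * m \<le> N then a (p * m) else 0)"
  proof (rule sum.cong)
    fix p assume p: "p \<in> P"
    have "(\<Sum>n=1..N. if p dvd n then a n else 0) = (\<Sum>n\<in>{n \<in> {1..N}. p dvd n}. a n)"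
      by (rule sum.inter_filter[symmetric]) simp
    also have "\<dots> = (\<Sum>m\<in>{m \<in> {1..N}. p * m \<le> N}. a (p * m))"
    proof (rule sum.reindex_bij_witness[of _ "\<lambda>m. p * m" "\<lambda>n. n div p"])
      fix n assume "n \<in> {n \<in> {1..N}. p dvd n}"
      then obtain k where k: "n = p * k" "1 \<le> p * k" "p * k \<le> N" by auto
      have "k \<le> p * k" using pos[OF p] by simp
      hence "k \<le> N" using k(3) by (rule order_trans)
      thus "n div p \<in> {m \<in> {1..N}. p * m \<le> N}" "p * (n div p) = n" "a (p * (n div p)) = a n" using k pos[OF p] by (auto simp: Suc_le_eq)
    qed (use pos[OF p] in auto)
    also have "\<dots> = (\<Sum>m=1..N. if p * m \<le> N then a (p * m) else 0)" by (rule sum.inter_filter) simp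
    finally show "(\<Sum>n=1..N. if p dvd n then a n else 0) = (\<Sum>m=1..N. if p * m \<le> N then a (p * m) else 0)" .
  qed simp
  also have "\<dots> = (\<Sum>p\<in>P. \<Sum>m=1..N. (if p * m \<le> N \<and> p dvd m then of_int (moebius_mu m) * F (p * m) else 0)
       - of_int (moebius_mu m) * (if p * m \<le> N then F (p * m) else 0))"
    using primes by (intro sum.cong refl) (auto simp: a_def moebius_mu_prime_mult)
  also have "\<dots> = (\<Sum>p\<in>P. \<Sum>m=1..N. if p * m \<le> N \<and> p dvd m then of_int (moebius_mu m) * F (p * m) else 0)
      - (\<Sum>m=1..N. of_int (moebius_mu m) * dilate_sum N m)"
  proof -
    have "(\<Sum>m=1..N. of_int (moebius_mu m) * dilate_sum N m) = (\<Sum>p\<in>P. \<Sum>m=1..N. of_int (moebius_mu m) * (if p * m \<le> N then F (p * m) else 0))"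
      unfolding dilate_sum_def sum_distrib_left by (rule sum.swap)
    thus ?thesis by (simp add: sum_subtractf)
  qed
  finally have main: "(\<Sum>n=1..N. a n * of_real (prime_divisor_count n)) =
      (\<Sum>p\<in>P. \<Sum>m=1..N. if p * m \<le> N \<and> p dvd m then of_int (moebius_mu m) * F (p * m) else 0)
      - (\<Sum>m=1..N. of_int (moebius_mu m) * dilate_sum N m)" (is "_ = ?E - ?M") .
  have E: "cmod ?E \<le> real N * (\<Sum>n. 1 / (real n)\<^sup>2)"
  proof -
    have "cmod ?E \<le> (\<Sum>p\<in>P. real N * (1 / (real p)\<^sup>2))"
    proof (rule sum_norm_le)
      fix p assume p: "p \<in> P"
      have "cmod (\<Sum>m=1..N. if p * m \<le> N \<and> p dvd m then of_int (moebius_mu m) * F (p * m) else 0)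
          \<le> (\<Sum>m=1..N. if p * m \<le> N \<and> p dvd m then 1 else 0)"
        using mu F by (intro sum_norm_le) (auto simp: norm_mult intro!: mult_le_one)
      also have "\<dots> = real (card {m \<in> {1..N}. p * m \<le> N \<and> p dvd m})"
        by (subst sum.inter_filter[symmetric]) auto
      also have "{m \<in> {1..N}. p * m \<le> N \<and> p dvd m} = {m \<in> {1..N div p}. p dvd m}"
      proof -
        have "x \<le> N" if "x * p \<le> N" for x
        proof -
          have "x \<le> x * p" using pos[OF p] by simp
          thus ?thesis using that by (rule order_trans)
        qed
        thus ?thesis using pos[OF p] by (auto simp: less_eq_div_iff_mult_less_eq mult.commute)
      qed
      also have "card {m \<in> {1..N div p}. p dvd m} = N div p div p" using pos[OF p] by (rule card_multiples)
      also have "N div p div p = N div (p * p)" by (simp add: div_mult2_eq)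
      also have "real (N div (p * p)) \<le> real N / real (p * p)" by (rule real_div_nat_le)
      finally show "cmod (\<Sum>m=1..N. if p * m \<le> N \<and> p dvd m then of_int (moebius_mu m) * F (p * m) else 0)
         \<le> real N * (1 / (real p)\<^sup>2)" by (simp add: power2_eq_square)
    qed
    also have "\<dots> = real N * (\<Sum>p\<in>P. 1 / (real p)\<^sup>2)" by (simp add: sum_distrib_left)
    also have "\<dots> \<le> real N * (\<Sum>n. 1 / (real n)\<^sup>2)"
      using inverse_power_summable[of 2, where 'a = real] fin
      by (intro mult_left_mono sum_le_suminf) (auto simp: field_simps)
    finally show ?thesis .
  qed
  have M: "cmod ?M \<le> sqrt (real N) * sqrt (real N * L + (\<Sum>p\<in>P. \<Sum>r\<in>P. \<bar>B p r\<bar>))"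
  proof -
    have "cmod ?M \<le> (\<Sum>m=1..N. \<bar>cmod (dilate_sum N m)\<bar>)"
      using mu by (intro sum_norm_le) (auto simp: norm_mult intro!: mult_left_le_one_le)
    also have "\<dots> \<le> sqrt (real N) * sqrt (\<Sum>m=1..N. (cmod (dilate_sum N m))\<^sup>2)" by (rule sum_abs_le_sqrt)
    also have "\<dots> \<le> sqrt (real N) * sqrt (real N * L + (\<Sum>p\<in>P. \<Sum>r\<in>P. \<bar>B p r\<bar>))"
      by (intro mult_left_mono real_sqrt_le_mono sum_dilate_sum_square) auto
    finally show ?thesis .
  qed
  have "of_real L * (\<Sum>n=1..N. a n) = (\<Sum>n=1..N. a n * of_real (prime_divisor_count n)) - (\<Sum>n=1..N. a n * of_real (prime_divisor_count n - L))"
    by (simp add: sum_distrib_left sum_distrib_right algebra_simps flip: sum_subtractf)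
  hence "of_real L * (\<Sum>n=1..N. a n) = ?E - ?M - (\<Sum>n=1..N. a n * of_real (prime_divisor_count n - L))" unfolding main .
  hence "cmod (of_real L * (\<Sum>n=1..N. a n)) \<le> cmod ?E + cmod ?M + cmod (\<Sum>n=1..N. a n * of_real (prime_divisor_count n - L))"
    by (smt (verit) norm_triangle_ineq4)
  moreover have "cmod (of_real L * (\<Sum>n=1..N. a n)) = L * cmod (\<Sum>n=1..N. a n)"
    using L_nonneg by (simp add: norm_mult)
  ultimately show ?thesis using 1 E M unfolding a_def by linarith
qed

end
end

text \<open>
  Dividing the previous bound by \<open>N L\<close> leaves \<open>(2 \<surd>L + Z) / L\<close> as \<open>N\<close> grows, which is small for large \<open>L\<close>.
\<close>

theorem katai_criterion:
  fixes F :: "nat \<Rightarrow> complex"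
  assumes F: "\<And>n. cmod (F n) \<le> 1"
    and B: "\<And>p r K. prime p \<Longrightarrow> prime r \<Longrightarrow> p \<noteq> r \<Longrightarrow> cmod (\<Sum>m=1..K. F (p * m) * cnj (F (r * m))) \<le> B p r"
  shows "moebius_mean F \<longlonglongrightarrow> 0"
proof (rule LIMSEQ_I)
  fix e :: real assume e: "e > 0"
  define Z where "Z = (\<Sum>n. 1 / (real n)\<^sup>2)"
  have "((\<lambda>L. (2 * sqrt L + Z) / L) \<longlongrightarrow> 0) at_top" by real_asymp
  hence "eventually (\<lambda>L. (2 * sqrt L + Z) / L < e) at_top" using e by (rule order_tendstoD)
  then obtain L0 where L0: "\<And>L. L \<ge> L0 \<Longrightarrow> (2 * sqrt L + Z) / L < e" by (auto simp: eventually_at_top_linorder)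
  obtain P where P: "finite P" "\<And>p. p \<in> P \<Longrightarrow> prime p" "(\<Sum>p\<in>P. 1 / real p) > max L0 1"
    using prime_reciprocals_unbounded by blast
  define L where "L = (\<Sum>p\<in>P. 1 / real p)"
  have L: "L > 0" "L \<ge> L0" using P(3) by (auto simp: L_def)
  define C where "C = (\<Sum>p\<in>P. \<Sum>r\<in>P. \<bar>B p r\<bar>)"
  have bound: "L * cmod (\<Sum>n=1..N. of_int (moebius_mu n) * F n) \<le>
     sqrt (real N) * sqrt (real N * L + 2 * L * real (card P)) + sqrt (real N) * sqrt (real N * L + C) + real N * Z" for N
    unfolding Z_def C_def by (rule katai_bound[OF P(1,2) L_def F]) (use B P in auto)
  define b where "b N = (sqrt (L + 2 * L * real (card P) / real N) + sqrt (L + C / real N) + Z) / L" for N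
  have le: "cmod (moebius_mean F N) \<le> b N" if N: "N > 0" for N
  proof -
    have s: "sqrt (real N) * sqrt (real N * L + c) = real N * sqrt (L + c / real N)" for c
    proof -
      have "real N * L + c = real N * (L + c / real N)" using N by (simp add: field_simps)
      thus ?thesis by (simp only: real_sqrt_mult mult.assoc[symmetric]) simp
    qed
    have "L * cmod (\<Sum>n=1..N. of_int (moebius_mu n) * F n) \<le> real N * (b N * L)"
    proof -
      have "b N * L = sqrt (L + 2 * L * real (card P) / real N) + sqrt (L + C / real N) + Z"
        using L by (simp add: b_def)
      thus ?thesis using bound[of N] unfolding s by (simp only: distrib_left)
    qed
    hence "cmod (\<Sum>n=1..N. of_int (moebius_mu n) * F n) \<le> real N * b N"
      using L by (simp add: mult.commute[of L] mult.assoc[symmetric])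
    thus ?thesis using N by (simp add: norm_divide divide_le_eq mult.commute)
  qed
  have "b \<longlonglongrightarrow> (sqrt (L + 0) + sqrt (L + 0) + Z) / L"
    unfolding b_def[abs_def] using L
    by (intro tendsto_divide tendsto_add tendsto_const tendsto_real_sqrt) (real_asymp | simp)+
  moreover have "(sqrt (L + 0) + sqrt (L + 0) + Z) / L < e" using L0[OF L(2)] by simp
  ultimately have "eventually (\<lambda>N. b N < e) sequentially" by (rule order_tendstoD)
  hence "eventually (\<lambda>N. cmod (moebius_mean F N) < e) sequentially"
    using eventually_gt_at_top[of 0] by eventually_elim (use le in \<open>auto intro: le_less_trans\<close>)
  thus "\<exists>no. \<forall>N\<ge>no. cmod ((\<Sum>n=1..N. of_int (moebius_mu n) * F n) / of_nat N - 0) < e"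
    by (simp add: eventually_sequentially)
qed

section \<open>Davenport's theorem\<close>

text \<open>
  The correlations of the dilates of \<open>n \<mapsto> \<zeta>^n\<close> by different primes are geometric sums of ratio different from 1.
\<close>

lemma moebius_not_root_of_unity:
  assumes lam: "cmod \<zeta> = 1" and nr: "\<And>q. q > 0 \<Longrightarrow> \<zeta> ^ q \<noteq> 1"
  shows "moebius_mean (\<lambda>n. \<zeta> ^ n) \<longlonglongrightarrow> 0"
proof (rule katai_criterion)
  show "cmod (\<zeta> ^ n) \<le> 1" for n using lam by (simp add: norm_power)
  fix p r K :: nat assume pr: "p \<noteq> r"
  define w where "w = \<zeta> ^ p * cnj (\<zeta> ^ r)"
  have l1: "\<zeta> * cnj \<zeta> = 1" using lam by (simp add: complex_norm_square[symmetric])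
  have w1: "w \<noteq> 1"
  proof
    assume "w = 1"
    hence "\<zeta> ^ p * cnj (\<zeta> ^ r) * \<zeta> ^ r = \<zeta> ^ r" by (simp add: w_def)
    moreover have "cnj (\<zeta> ^ r) * \<zeta> ^ r = 1" using l1 by (simp flip: power_mult_distrib add: mult.commute)
    ultimately have eq: "\<zeta> ^ p = \<zeta> ^ r" by (metis mult.assoc mult.right_neutral)
    have l0: "\<zeta> \<noteq> 0" using lam by auto
    have "\<zeta> ^ (max p r - min p r) = 1"
      using eq l0 by (subst power_diff) (auto simp: max_def min_def)
    thus False using nr[of "max p r - min p r"] pr by (auto simp: max_def min_def split: if_splits)
  qed
  have wn: "cmod w = 1" using lam by (simp add: w_def norm_mult norm_power)
  have "(\<Sum>m=1..K. \<zeta> ^ (p * m) * cnj (\<zeta> ^ (r * m))) = (\<Sum>m=1..K. w ^ m)"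
    by (simp add: w_def power_mult power_mult_distrib)
  also have "\<dots> = w * (\<Sum>m<K. w ^ m)" 
    by (simp add: sum_distrib_left sum.atLeast1_atMost_eq)
  also have "cmod \<dots> = cmod (\<Sum>m<K. w ^ m)" by (simp only: norm_mult wn mult_1_left)
  also have "(\<Sum>m<K. w ^ m) = (w ^ K - 1) / (w - 1)" using w1 by (rule geometric_sum)
  also have "cmod ((w ^ K - 1) / (w - 1)) \<le> 2 / cmod (w - 1)"
    using norm_triangle_ineq4[of "w ^ K" 1] wn by (simp add: norm_divide norm_power divide_right_mono)
  finally show "cmod (\<Sum>m=1..K. \<zeta> ^ (p * m) * cnj (\<zeta> ^ (r * m))) \<le> 2 / cmod (\<zeta> ^ p * cnj (\<zeta> ^ r) - 1)"
    by (simp add: w_def)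
qed

lemma moebius_mean_div:
  fixes a :: "nat \<Rightarrow> complex"
  assumes "(\<lambda>N. (\<Sum>n=1..N. a n) / of_nat N) \<longlonglongrightarrow> 0" and d: "d > 0"
  shows "(\<lambda>N. (\<Sum>n=1..N div d. a n) / of_nat N) \<longlonglongrightarrow> 0"
proof -
  have "filterlim (\<lambda>N. N div d) at_top at_top"
    unfolding filterlim_at_top
  proof
    fix Z show "\<forall>\<^sub>F N in sequentially. Z \<le> N div d"
      using eventually_ge_at_top[of "Z * d"] by eventually_elim (use d in \<open>simp add: less_eq_div_iff_mult_less_eq\<close>)
  qed
  hence lim: "(\<lambda>N. (\<Sum>n=1..N div d. a n) / of_nat (N div d)) \<longlonglongrightarrow> 0"
    by (rule filterlim_compose[OF assms(1)])
  show ?thesis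
  proof (rule Lim_null_comparison)
    show "(\<lambda>N. cmod ((\<Sum>n=1..N div d. a n) / of_nat (N div d))) \<longlonglongrightarrow> 0"
      using lim by (rule tendsto_norm_zero)
    show "\<forall>\<^sub>F N in sequentially. norm ((\<Sum>n=1..N div d. a n) / of_nat N) \<le> cmod ((\<Sum>n=1..N div d. a n) / of_nat (N div d))"
    proof (intro always_eventually allI)
      fix N show "norm ((\<Sum>n=1..N div d. a n) / of_nat N) \<le> cmod ((\<Sum>n=1..N div d. a n) / of_nat (N div d))"
      proof (cases "N div d = 0")
        case False
        hence f1: "0 < N div d" by simp
        have f2: "N div d \<le> N" by (rule div_le_dividend)
        have f3: "0 < N" using f1 f2 by (rule less_le_trans)
        show ?thesis unfolding norm_divide norm_of_nat
          by (intro divide_left_mono mult_pos_pos) (simp_all only: of_nat_0_less_iff of_nat_le_iff norm_ge_zero f1 f2 f3)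
      qed simp
    qed
  qed
qed

text \<open>
  The numbers \<open>n\<close> whose greatest common divisor with \<open>q\<close> is \<open>d\<close> are treated separately. Such an \<open>n = d m\<close>
  has \<open>\<mu>(n) = \<mu>(d) \<mu>(m)\<close> if \<open>m\<close> is coprime to \<open>q\<close>. Otherwise \<open>\<mu>(n) = 0\<close>: a prime dividing \<open>m\<close> and \<open>q\<close> must
  divide \<open>d\<close> by maximality of the greatest common divisor, and its square divides \<open>n\<close>. So only functions supported on the units
  modulo \<open>q\<close> remain, and these are sums of characters.
\<close>

theorem moebius_periodic:
  fixes g :: "nat \<Rightarrow> complex"
  assumes q: "q > 0" and per: "\<And>n. g (n + q) = g n"
  shows "moebius_mean g \<longlonglongrightarrow> 0"
proof -
  define h where "h d m = (if coprime m q then g (d * m) else 0)" for d m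
  have hlim: "moebius_mean (h d) \<longlonglongrightarrow> 0" for d
  proof (rule periodic_dirichlet_char_induct[of q "h d"])
    have "g (d * (n + q)) = g (d * n)" for n
      using periodic_mod[of g q "d * (n + q)", OF per] periodic_mod[of g q "d * n", OF per]
      by (simp add: distrib_left)
    moreover have "coprime (n + q) q \<longleftrightarrow> coprime n q" for n
      by (simp add: coprime_iff_gcd_eq_1)
    ultimately show "h d (n + q) = h d n" for n by (simp add: h_def)
    show "moebius_mean (\<lambda>n. f1 n + f2 n) \<longlonglongrightarrow> 0"
      if "moebius_mean f1 \<longlonglongrightarrow> 0"
        "moebius_mean f2 \<longlonglongrightarrow> 0" for f1 f2 :: "nat \<Rightarrow> complex"
      using tendsto_add[OF that] by (simp add: distrib_left sum.distrib add_divide_distrib)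
    show "moebius_mean (\<lambda>n. c * chi n) \<longlonglongrightarrow> 0"
      if "dirichlet_char q chi" for c chi
      using tendsto_mult[OF tendsto_const[of c] moebius_dirichlet_char[OF that]]
      by (simp add: sum_distrib_left mult_ac)
  qed (auto simp: h_def q)
  have key: "(if gcd (d * m) q = d then of_int (moebius_mu (d * m)) * g (d * m) else 0) =
      of_int (moebius_mu d) * (of_int (moebius_mu m) * h d m)" if d: "d dvd q" for d m
  proof (cases "coprime m q")
    case True
    hence "gcd (d * m) q = gcd d q" by (simp add: gcd_mult_right_right_cancel gcd_mult_right_left_cancel gcd.commute[of _ q] coprime_commute)
    hence "gcd (d * m) q = d" using d by simp
    moreover have "coprime d m" using True d by (meson coprime_commute coprime_divisors dvd_refl)
    ultimately show ?thesis using True by (simp add: h_def moebius_mu_mult_coprime)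
  next
    case False
    have "moebius_mu (d * m) = 0" if gcd: "gcd (d * m) q = d"
    proof -
      obtain p where p: "prime p" "p dvd m" "p dvd q"
        using False by (metis coprime_iff_gcd_eq_1 gcd_dvd1 gcd_dvd2 dvd_trans prime_factor_nat)
      have d0: "d > 0" using d q by (auto intro: Nat.gr0I)
      have "p dvd d"
      proof (rule ccontr)
        assume "\<not> p dvd d"
        hence "coprime d p" using prime_imp_coprime[OF p(1)] coprime_commute by blast
        hence "d * p dvd q" using d p by (intro divides_mult) auto
        moreover have "d * p dvd d * m" using p by simp
        ultimately have "d * p dvd d" using gcd by (metis gcd_greatest)
        hence "d * p \<le> d" using d0 by (intro dvd_imp_le) auto
        thus False using d0 prime_gt_1_nat[OF p(1)] by simp
      qed
      hence "p\<^sup>2 dvd d * m" using p by (simp add: power2_eq_square mult_dvd_mono)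
      hence "\<not> squarefree (d * m)" using p by (intro not_squarefreeI[of p]) auto
      thus ?thesis by (simp add: moebius_mu_def)
    qed
    thus ?thesis using False by (simp add: h_def)
  qed
  have fin: "finite {d. d dvd q}" using q by simp
  have "(\<Sum>n=1..N. of_int (moebius_mu n) * g n) =
     (\<Sum>d | d dvd q. of_int (moebius_mu d) * (\<Sum>m=1..N div d. of_int (moebius_mu m) * h d m))" for N
  proof -
    have "(\<Sum>n=1..N. of_int (moebius_mu n) * g n) =
       (\<Sum>n=1..N. \<Sum>d | d dvd q. if d = gcd n q then of_int (moebius_mu n) * g n else 0)"
      using fin by (intro sum.cong refl) (simp add: sum.delta)
    also have "\<dots> = (\<Sum>d | d dvd q. \<Sum>n=1..N. if d = gcd n q then of_int (moebius_mu n) * g n else 0)"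
      by (rule sum.swap)
    also have "\<dots> = (\<Sum>d | d dvd q. \<Sum>m=1..N div d. if gcd (d * m) q = d then of_int (moebius_mu (d * m)) * g (d * m) else 0)"
    proof (rule sum.cong)
      fix d assume "d \<in> {d. d dvd q}"
      hence d0: "d > 0" using q by (auto intro: Nat.gr0I)
      have "(\<Sum>n=1..N. if d = gcd n q then of_int (moebius_mu n) * g n else 0) =
          (\<Sum>n\<in>(*) d ` {1..N div d}. if d = gcd n q then of_int (moebius_mu n) * g n else 0)"
      proof (rule sum.mono_neutral_right)
        show "(*) d ` {1..N div d} \<subseteq> {1..N}" using d0 by (auto simp: less_eq_div_iff_mult_less_eq mult.commute)
        show "\<forall>i\<in>{1..N} - (*) d ` {1..N div d}. (if d = gcd i q then of_int (moebius_mu i) * g i else 0) = 0"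
        proof
          fix i assume i: "i \<in> {1..N} - (*) d ` {1..N div d}"
          have "d \<noteq> gcd i q"
          proof
            assume "d = gcd i q"
            hence "d dvd i" by simp
            then obtain k where "i = d * k" by (elim dvdE)
            thus False using i d0 by (auto simp: less_eq_div_iff_mult_less_eq mult.commute)
          qed
          thus "(if d = gcd i q then of_int (moebius_mu i) * g i else 0) = 0" by simp
        qed
      qed simp
      also have "\<dots> = (\<Sum>m=1..N div d. if d = gcd (d * m) q then of_int (moebius_mu (d * m)) * g (d * m) else 0)"
        using d0 by (subst sum.reindex) (auto simp: inj_on_def)
      finally show "(\<Sum>n=1..N. if d = gcd n q then of_int (moebius_mu n) * g n else 0) =
        (\<Sum>m=1..N div d. if gcd (d * m) q = d then of_int (moebius_mu (d * m)) * g (d * m) else 0)"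
        by (simp add: eq_commute[of d])
    qed simp
    also have "\<dots> = (\<Sum>d | d dvd q. of_int (moebius_mu d) * (\<Sum>m=1..N div d. of_int (moebius_mu m) * h d m))"
      by (intro sum.cong refl) (simp add: key sum_distrib_left)
    finally show ?thesis .
  qed
  hence eq: "(\<Sum>n=1..N. of_int (moebius_mu n) * g n) / of_nat N =
     (\<Sum>d | d dvd q. of_int (moebius_mu d) * ((\<Sum>m=1..N div d. of_int (moebius_mu m) * h d m) / of_nat N))" for N
    by (simp only: sum_divide_distrib[where A = "{d. d dvd q}"] times_divide_eq_right)
  have "(\<lambda>N. \<Sum>d | d dvd q. of_int (moebius_mu d) * ((\<Sum>m=1..N div d. of_int (moebius_mu m) * h d m) / of_nat N))
      \<longlonglongrightarrow> (\<Sum>d | d dvd q. of_int (moebius_mu d) * 0)"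
    by (intro tendsto_sum tendsto_mult tendsto_const moebius_mean_div hlim) (use q in \<open>auto intro: Nat.gr0I\<close>)
  thus ?thesis unfolding eq by simp
qed

theorem davenport_moebius:
  assumes "cmod \<zeta> = 1"
  shows "moebius_mean (\<lambda>n. \<zeta> ^ n) \<longlonglongrightarrow> 0"
proof (cases "\<exists>q>0. \<zeta> ^ q = 1")
  case True
  then obtain q where "q > 0" "\<zeta> ^ q = 1" by auto
  thus ?thesis by (intro moebius_periodic[of q]) (auto simp: power_add)
next
  case False
  hence "\<zeta> ^ q \<noteq> 1" if "q > 0" for q using that by blast
  thus ?thesis by (rule moebius_not_root_of_unity[OF assms])
qed

section \<open>Diagonalising an automorphism\<close>

text \<open>
  Either two members of the sequence coincide, or they are too many to be linearly independent.
\<close>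

lemma (in cstar_algebra) powers_dependent:
  fixes u :: "nat \<Rightarrow> 'a"
  assumes fd: "finite_dimensional A" and u: "\<And>n. u n \<in> carrier A"
  obtains n c where "\<exists>i<n. c i \<noteq> 0" "(\<Sum>i<n. c i \<odot> u i) = 0"
proof -
  obtain S where S: "finite S" "V.span S = carrier A" using fd by (auto simp: finite_dimensional_def)
  define n where "n = Suc (card S)"
  show ?thesis
  proof (cases "inj_on u {..<n}")
    case False
    then obtain i j where ij: "i < n" "j < n" "i \<noteq> j" "u i = u j" by (auto simp: inj_on_def)
    define c where "c k = (if k = i then 1 else if k = j then -1 else 0 :: complex)" for k
    have "(\<Sum>k<n. c k \<odot> u k) = (\<Sum>k\<in>{i, j}. c k \<odot> u k)"
      using ij by (intro sum.mono_neutral_right) (auto simp: c_def)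
    also have "\<dots> = 0" using ij by (simp add: c_def)
    finally show ?thesis using ij by (intro that[of n c]) (auto simp: c_def)
  next
    case True
    have "V.dependent (u ` {..<n})"
    proof (rule ccontr)
      assume "V.independent (u ` {..<n})"
      moreover have "u ` {..<n} \<subseteq> V.span S" using u S by auto
      ultimately have "card (u ` {..<n}) \<le> card S" using V.independent_span_bound[OF S(1)] by blast
      thus False using True by (simp add: card_image n_def)
    qed
    then obtain v where v: "\<exists>x\<in>u ` {..<n}. v x \<noteq> 0" "(\<Sum>x\<in>u ` {..<n}. v x \<odot> x) = 0"
      using V.dependent_finite[of "u ` {..<n}"] by auto
    have "(\<Sum>i<n. v (u i) \<odot> u i) = 0" using v(2) True by (simp add: sum.reindex)
    thus ?thesis using v(1) by (intro that[of n "\<lambda>i. v (u i)"]) auto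
  qed
qed

text \<open>
  The finite sums of eigenvectors of \<open>\<alpha>\<close> with eigenvalues on the unit circle. The same
  eigenvalue may occur several times in a sum.
\<close>

inductive eigen_sum :: "'a::ab_group_add star_alg \<Rightarrow> ('a \<Rightarrow> 'a) \<Rightarrow> 'a \<Rightarrow> bool" for A \<alpha> where
  zero: "eigen_sum A \<alpha> 0"
| add: "eigen_sum A \<alpha> x \<Longrightarrow> e \<in> carrier A \<Longrightarrow> \<alpha> e = scale A w e \<Longrightarrow> cmod w = 1 \<Longrightarrow> eigen_sum A \<alpha> (x + e)"

locale isometric_map = cstar_algebra A for A :: "'a::ab_group_add star_alg" (structure) +
  fixes \<alpha> :: "'a \<Rightarrow> 'a"
  assumes lin: "linear_map A A \<alpha>" and iso: "\<And>a. a \<in> carrier A \<Longrightarrow> nrm A (\<alpha> a) = nrm A a"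
begin

lemma map_closed: "a \<in> carrier A \<Longrightarrow> \<alpha> a \<in> carrier A"
  using lin by (auto simp: linear_map_def)

lemma map_add: "a \<in> carrier A \<Longrightarrow> b \<in> carrier A \<Longrightarrow> \<alpha> (a + b) = \<alpha> a + \<alpha> b"
  using lin by (simp add: linear_map_def)

lemma map_scale: "a \<in> carrier A \<Longrightarrow> \<alpha> (z \<odot> a) = z \<odot> \<alpha> a"
  using lin by (simp add: linear_map_def)

lemma map_diff: "a \<in> carrier A \<Longrightarrow> b \<in> carrier A \<Longrightarrow> \<alpha> (a - b) = \<alpha> a - \<alpha> b"
  using map_add[of "a - b" b] by (simp add: closed)

lemma map_zero: "\<alpha> 0 = 0"
  using map_diff[of 0 0] by (simp add: closed)

lemma pow_closed: "a \<in> carrier A \<Longrightarrow> (\<alpha> ^^ n) a \<in> carrier A"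
  by (induction n) (auto intro: map_closed)

lemma pow_diff: "a \<in> carrier A \<Longrightarrow> b \<in> carrier A \<Longrightarrow> (\<alpha> ^^ n) (a - b) = (\<alpha> ^^ n) a - (\<alpha> ^^ n) b"
  by (induction n) (auto simp: map_diff pow_closed)

lemma pow_add: "a \<in> carrier A \<Longrightarrow> b \<in> carrier A \<Longrightarrow> (\<alpha> ^^ n) (a + b) = (\<alpha> ^^ n) a + (\<alpha> ^^ n) b"
  by (induction n) (auto simp: map_add pow_closed)

lemma pow_scale: "a \<in> carrier A \<Longrightarrow> (\<alpha> ^^ n) (z \<odot> a) = z \<odot> (\<alpha> ^^ n) a"
  by (induction n) (auto simp: map_scale pow_closed)

lemma nrm_pow: "a \<in> carrier A \<Longrightarrow> nrm A ((\<alpha> ^^ n) a) = nrm A a"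
  by (induction n) (auto simp: iso pow_closed)

lemma eigen_sum_closed: "eigen_sum A \<alpha> x \<Longrightarrow> x \<in> carrier A"
  by (induction rule: eigen_sum.induct) (auto intro: closed)

text \<open>
  On eigenvectors for eigenvalues other than \<open>l\<close> the map \<open>y \<mapsto> \<alpha> y - l y\<close> is invertible; what cannot be
  reached is an eigenvector for \<open>l\<close> itself.
\<close>

lemma eigen_sum_solve:
  assumes "eigen_sum A \<alpha> z"
  shows "\<exists>y e. eigen_sum A \<alpha> y \<and> e \<in> carrier A \<and> \<alpha> e = l \<odot> e \<and> (cmod l = 1 \<or> e = 0) \<and> z = (\<alpha> y - l \<odot> y) + e"
  using assms
proof (induction rule: eigen_sum.induct)
  case zero
  thus ?case by (intro exI[of _ 0]) (auto simp: map_zero closed eigen_sum.zero)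
next
  case (add z f w)
  then obtain y e where ye: "eigen_sum A \<alpha> y" "e \<in> carrier A" "\<alpha> e = l \<odot> e" "cmod l = 1 \<or> e = 0" "z = (\<alpha> y - l \<odot> y) + e"
    by blast
  have yA: "y \<in> carrier A" using ye(1) by (rule eigen_sum_closed)
  show ?case
  proof (cases "w = l")
    case True
    thus ?thesis using ye add by (intro exI[of _ y] exI[of _ "e + f"]) (auto simp: map_add V.scale_right_distrib closed)
  next
    case False
    define g where "g = (1 / (w - l)) \<odot> f"
    have g: "g \<in> carrier A" "\<alpha> g = w \<odot> g" using add by (simp_all add: g_def closed map_scale V.scale_left_commute)
    have "\<alpha> g - l \<odot> g = f" using False g by (simp add: g_def V.scale_left_diff_distrib[symmetric] diff_divide_distrib[symmetric])
    hence "z + f = (\<alpha> (y + g) - l \<odot> (y + g)) + e"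
      using ye yA g by (simp add: map_add V.scale_right_distrib)
    moreover have "eigen_sum A \<alpha> (y + g)" using ye(1) g add by (intro eigen_sum.add) auto
    ultimately show ?thesis using ye by blast
  qed
qed

text \<open>
  By the preceding lemma the difference \<open>u\<close> of \<open>x\<close> and an eigenvector sum satisfies \<open>\<alpha> u = l u + e\<close> with
  \<open>\<alpha> e = l e\<close>. A nonzero \<open>e\<close> would be a Jordan block: the norm of \<open>\<alpha>^n u\<close> would grow linearly, although \<open>\<alpha>\<close>
  is isometric. So \<open>u\<close> is an eigenvector.
\<close>

lemma eigen_sum_step:
  assumes x: "x \<in> carrier A" and e: "eigen_sum A \<alpha> (\<alpha> x - l \<odot> x)"
  shows "eigen_sum A \<alpha> x"
proof -
  obtain y e where ye: "eigen_sum A \<alpha> y" "e \<in> carrier A" "\<alpha> e = l \<odot> e" "cmod l = 1 \<or> e = 0"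
    "\<alpha> x - l \<odot> x = (\<alpha> y - l \<odot> y) + e" using eigen_sum_solve[OF e, of l] by blast
  have yA: "y \<in> carrier A" using ye(1) by (rule eigen_sum_closed)
  define u where "u = x - y"
  have uA: "u \<in> carrier A" unfolding u_def using x yA by (rule closed)
  have u: "\<alpha> u = l \<odot> u + e"
    using ye(5) x yA by (simp add: u_def map_diff V.scale_right_diff_distrib algebra_simps)
  have e0: "e = 0"
  proof (rule ccontr)
    assume "e \<noteq> 0"
    hence l: "cmod l = 1" using ye(4) by blast
    have pw: "(\<alpha> ^^ n) u = l ^ n \<odot> u + (of_nat n * l ^ (n - 1)) \<odot> e" for n
    proof (induction n)
      case (Suc n)
      have "(\<alpha> ^^ Suc n) u = l ^ n \<odot> (l \<odot> u + e) + (of_nat n * l ^ (n - 1)) \<odot> (l \<odot> e)"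
        using Suc uA ye by (simp add: map_add map_scale closed u)
      also have "\<dots> = l ^ Suc n \<odot> u + (l ^ n + of_nat n * l ^ (n - 1) * l) \<odot> e"
        by (simp add: V.scale_right_distrib V.scale_left_distrib mult.commute add.assoc)
      also have "l ^ n + of_nat n * l ^ (n - 1) * l = of_nat (Suc n) * l ^ (Suc n - 1)"
        by (cases n) (simp_all add: algebra_simps)
      finally show ?case .
    qed simp
    have "real n * nrm A e \<le> 2 * nrm A u" for n
    proof -
      have "real n * nrm A e = nrm A ((of_nat n * l ^ (n - 1)) \<odot> e)"
        using ye(2) l by (simp add: nrm_scale norm_mult norm_power)
      also have "(of_nat n * l ^ (n - 1)) \<odot> e = (\<alpha> ^^ n) u - l ^ n \<odot> u" by (simp add: pw)
      also have "nrm A \<dots> \<le> nrm A ((\<alpha> ^^ n) u) + nrm A (l ^ n \<odot> u)"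
        using uA by (intro nrm_triangle_diff closed pow_closed)
      also have "\<dots> = 2 * nrm A u" using uA l by (simp add: nrm_pow nrm_scale norm_power)
      finally show ?thesis .
    qed
    moreover have "nrm A e > 0" using nrm_nonneg[OF ye(2)] nrm_eq_0_iff[OF ye(2)] \<open>e \<noteq> 0\<close> by simp
    ultimately show False using reals_Archimedean3[of "nrm A e"] by (meson not_le)
  qed
  have ul: "\<alpha> u = l \<odot> u" using u e0 by simp
  have "eigen_sum A \<alpha> (y + u)"
  proof (cases "u = 0")
    case False
    have "nrm A u = cmod l * nrm A u" using iso[OF uA] ul nrm_scale[OF uA, of l] by simp
    moreover have "nrm A u \<noteq> 0" using nrm_eq_0_iff[OF uA] False by simp
    ultimately have "cmod l = 1" by simp
    thus ?thesis using ye(1) uA ul by (intro eigen_sum.add)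
  qed (use ye in simp)
  thus ?thesis by (simp add: u_def)
qed

text \<open>
  Induction on the degree, splitting off one linear factor of the annihilating polynomial at a time.
  The bound \<open>n\<close> on the number of terms stands in for the degree to keep the sums in a fixed shape.
\<close>

lemma eigen_sum_annihilated:
  assumes "p \<noteq> 0" "degree p < n" "x \<in> carrier A" "(\<Sum>i<n. coeff p i \<odot> (\<alpha> ^^ i) x) = 0"
  shows "eigen_sum A \<alpha> x"
  using assms
proof (induction n arbitrary: p x)
  case (Suc n)
  show ?case
  proof (cases "degree p = 0")
    case True
    then obtain c where c: "p = [:c:]" by (rule degree_eq_zeroE)
    have "(\<Sum>i<Suc n. coeff p i \<odot> (\<alpha> ^^ i) x) = (\<Sum>i\<in>{0}. coeff p i \<odot> (\<alpha> ^^ i) x)"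
      using c by (intro sum.mono_neutral_right) (auto simp: coeff_pCons split: nat.splits)
    hence "c \<odot> x = 0" using Suc.prems c by simp
    hence "x = 0" using Suc.prems c by simp
    thus ?thesis by (simp add: eigen_sum.zero)
  next
    case False
    hence "\<not> constant (poly p)" by (simp add: constant_degree)
    hence "\<exists>l. poly p l = 0" by (rule Fundamental_Theorem_Algebra.fundamental_theorem_of_algebra)
    then obtain l where "poly p l = 0" ..
    hence "[:- l, 1:] dvd p" by (simp only: poly_eq_0_iff_dvd)
    then obtain r where r: "p = [:- l, 1:] * r" by (elim dvdE)
    have r0: "r \<noteq> 0" using Suc.prems(1) r by auto
    have "degree p = Suc (degree r)" unfolding r using r0 by (subst degree_mult_eq) auto
    hence dr: "degree r < n" using Suc.prems(2) by simp
    have coeff: "coeff p i = (case i of 0 \<Rightarrow> 0 | Suc j \<Rightarrow> coeff r j) - l * coeff r i" for i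
      unfolding r by (simp add: mult_pCons_left coeff_pCons split: nat.splits)
    have "0 = (\<Sum>i<Suc n. coeff p i \<odot> (\<alpha> ^^ i) x)" using Suc.prems by simp
    also have "\<dots> = (\<Sum>i<Suc n. (case i of 0 \<Rightarrow> 0 | Suc j \<Rightarrow> coeff r j) \<odot> (\<alpha> ^^ i) x)
        - (\<Sum>i<Suc n. (l * coeff r i) \<odot> (\<alpha> ^^ i) x)"
      by (simp only: coeff V.scale_left_diff_distrib sum_subtractf)
    also have "(\<Sum>i<Suc n. (case i of 0 \<Rightarrow> 0 | Suc j \<Rightarrow> coeff r j) \<odot> (\<alpha> ^^ i) x) = (\<Sum>i<n. coeff r i \<odot> (\<alpha> ^^ Suc i) x)"
      by (subst sum.lessThan_Suc_shift) simp
    also have "(\<Sum>i<Suc n. (l * coeff r i) \<odot> (\<alpha> ^^ i) x) = (\<Sum>i<n. (l * coeff r i) \<odot> (\<alpha> ^^ i) x)"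
      using dr by (simp add: coeff_eq_0)
    also have "(\<Sum>i<n. coeff r i \<odot> (\<alpha> ^^ Suc i) x) - (\<Sum>i<n. (l * coeff r i) \<odot> (\<alpha> ^^ i) x) =
        (\<Sum>i<n. coeff r i \<odot> (\<alpha> ^^ i) (\<alpha> x - l \<odot> x))"
      unfolding sum_subtractf[symmetric]
    proof (intro sum.cong refl)
      fix i
      have "(\<alpha> ^^ i) (\<alpha> x - l \<odot> x) = (\<alpha> ^^ Suc i) x - l \<odot> (\<alpha> ^^ i) x"
        using Suc.prems(3) by (simp add: pow_diff pow_scale map_closed closed funpow_swap1)
      thus "coeff r i \<odot> (\<alpha> ^^ Suc i) x - (l * coeff r i) \<odot> (\<alpha> ^^ i) x = coeff r i \<odot> (\<alpha> ^^ i) (\<alpha> x - l \<odot> x)"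
        by (simp add: V.scale_right_diff_distrib mult.commute)
    qed
    finally have "(\<Sum>i<n. coeff r i \<odot> (\<alpha> ^^ i) (\<alpha> x - l \<odot> x)) = 0" by simp
    hence "eigen_sum A \<alpha> (\<alpha> x - l \<odot> x)"
      using Suc.prems(3) by (intro Suc.IH[OF r0 dr] closed map_closed)
    thus ?thesis by (rule eigen_sum_step[OF Suc.prems(3)])
  qed
qed simp

theorem eigen_sum_all:
  assumes fd: "finite_dimensional A" and x: "x \<in> carrier A"
  shows "eigen_sum A \<alpha> x"
proof -
  obtain n c where c: "\<exists>i<n. c i \<noteq> 0" "(\<Sum>i<n. c i \<odot> (\<alpha> ^^ i) x) = 0"
    using powers_dependent[OF fd, of "\<lambda>i. (\<alpha> ^^ i) x"] pow_closed[OF x] by blast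
  define p where "p = (\<Sum>i<n. monom (c i) i)"
  have cp: "coeff p k = (if k < n then c k else 0)" for k
    by (simp add: p_def coeff_sum)
  have p0: "p \<noteq> 0" using c(1) cp by (metis coeff_0)
  have "degree p < n" using p0 cp by (intro degree_lessI) auto
  moreover have "(\<Sum>i<n. coeff p i \<odot> (\<alpha> ^^ i) x) = 0" using c(2) by (simp add: cp)
  ultimately show ?thesis using eigen_sum_annihilated p0 x by blast
qed

end

section \<open>Disjointness from the Moebius function\<close>

text \<open>
  Both the automorphism and its inverse are *-homomorphisms, hence contractive.
\<close>

lemma star_automorphism_isometric:
  assumes A: "cstar_algebra A" and fd: "finite_dimensional A" and \<alpha>: "star_automorphism A \<alpha>"
  shows "isometric_map A \<alpha>"
proof -
  interpret A: cstar_algebra A by fact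
  have hom: "star_hom A A \<alpha>" and bij: "bij_betw \<alpha> (carrier A) (carrier A)" using \<alpha> by (auto simp: star_automorphism_def)
  define \<beta> where "\<beta> = inv_into (carrier A) \<alpha>"
  have \<beta>: "\<beta> (\<alpha> a) = a" "\<alpha> (\<beta> a) = a" "\<beta> a \<in> carrier A" if "a \<in> carrier A" for a
    using bij that by (auto simp: \<beta>_def bij_betw_inv_into_left bij_betw_inv_into_right inv_into_into bij_betw_def)
  have eqI: "\<beta> x = y" if "y \<in> carrier A" "\<alpha> y = x" for x y using \<beta>(1)[OF that(1)] that(2) by simp
  have "star_hom A A \<beta>"
    using hom unfolding star_hom_def linear_map_def
    by (auto intro!: eqI simp: \<beta> A.closed A.mult_closed A.star_closed)
  hence "contractive A A \<beta>" using star_hom_contractive[OF A fd A] by blast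
  moreover have c: "contractive A A \<alpha>" using star_hom_contractive[OF A fd A hom] .
  moreover have \<alpha>A: "\<alpha> a \<in> carrier A" if "a \<in> carrier A" for a using bij that by (auto simp: bij_betw_def)
  ultimately have "nrm A (\<alpha> a) = nrm A a" if "a \<in> carrier A" for a
    using that \<beta>(1)[OF that] unfolding contractive_def by (metis antisym)
  thus ?thesis using A hom by (intro isometric_map.intro isometric_map_axioms.intro) (auto simp: star_hom_def)
qed

theorem linearly_disjoint_moebius:
  assumes A: "cstar_algebra A" and fd: "finite_dimensional A" and \<alpha>: "star_automorphism A \<alpha>"
  shows "linearly_disjoint moebius_mu A \<alpha>"
  unfolding linearly_disjoint_def
proof (intro allI impI ballI)
  fix \<rho> a assume \<rho>: "state A \<rho>" and a: "a \<in> carrier A"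
  interpret isometric_map A \<alpha> by (rule star_automorphism_isometric[OF A fd \<alpha>])
  have add: "\<rho> (x + y) = \<rho> x + \<rho> y" if "x \<in> carrier A" "y \<in> carrier A" for x y
    using \<rho> that by (simp add: state_def)
  have scl: "\<rho> (scale A z x) = z * \<rho> x" if "x \<in> carrier A" for z x using \<rho> that by (simp add: state_def)
  have \<rho>0: "\<rho> 0 = 0" using add[of 0 0] by (simp add: closed)
  have pow0: "(\<alpha> ^^ n) 0 = 0" for n by (induction n) (auto simp: map_zero)
  have "eigen_sum A \<alpha> a" by (rule eigen_sum_all[OF fd a])
  thus "(\<lambda>N. (1 / of_nat N) * (\<Sum>n = 1..N. of_int (moebius_mu n) * \<rho> ((\<alpha> ^^ n) a))) \<longlonglongrightarrow> 0"
  proof (induction rule: eigen_sum.induct)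
    case zero
    thus ?case by (simp add: pow0 \<rho>0)
  next
    case (add x e w)
    have xA: "x \<in> carrier A" using add(1) by (rule eigen_sum_closed)
    have "(\<alpha> ^^ n) e = scale A (w ^ n) e" for n
      by (induction n) (use add in \<open>auto simp: map_scale mult.commute\<close>)
    hence "\<rho> ((\<alpha> ^^ n) (x + e)) = \<rho> ((\<alpha> ^^ n) x) + w ^ n * \<rho> e" for n
      using xA add(2) by (simp add: pow_add pow_closed scl \<open>\<And>x y. x \<in> carrier A \<Longrightarrow> y \<in> carrier A \<Longrightarrow> \<rho> (x + y) = \<rho> x + \<rho> y\<close> closed)
    hence "(1 / of_nat N) * (\<Sum>n = 1..N. of_int (moebius_mu n) * \<rho> ((\<alpha> ^^ n) (x + e))) =
        (1 / of_nat N) * (\<Sum>n = 1..N. of_int (moebius_mu n) * \<rho> ((\<alpha> ^^ n) x))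
        + ((\<Sum>n = 1..N. of_int (moebius_mu n) * w ^ n) / of_nat N) * \<rho> e" for N
      by (simp add: distrib_left sum.distrib sum_distrib_right sum_divide_distrib add_divide_distrib mult.assoc)
    moreover have "(\<lambda>N. (1 / of_nat N) * (\<Sum>n = 1..N. of_int (moebius_mu n) * \<rho> ((\<alpha> ^^ n) x))
        + ((\<Sum>n = 1..N. of_int (moebius_mu n) * w ^ n) / of_nat N) * \<rho> e) \<longlonglongrightarrow> 0 + 0 * \<rho> e"
      by (intro tendsto_intros add.IH davenport_moebius add)
    ultimately show ?case by simp
  qed
qed

theorem theorem3p2:
  fixes A :: "'a::ab_group_add star_alg" and \<alpha> :: "'a \<Rightarrow> 'a"
  assumes "cstar_algebra A" and "finite_dimensional A" and "star_automorphism A \<alpha>"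
  shows "(\<forall>\<pi> :: 'a \<Rightarrow> 'h::complex_hilbert \<Rightarrow>\<^sub>L 'h.
            faithful_representation A \<pi> \<longrightarrow> ht A \<pi> \<alpha> = 0)
         \<and> linearly_disjoint moebius_mu A \<alpha>"
proof (intro conjI allI impI)
  fix \<pi> :: "'a \<Rightarrow> 'h \<Rightarrow>\<^sub>L 'h"
  assume "faithful_representation A \<pi>"
  moreover have "\<alpha> ` carrier A \<subseteq> carrier A"
    using assms(3) by (auto simp: star_automorphism_def bij_betw_def)
  ultimately show "ht A \<pi> \<alpha> = 0"
    using assms by (intro ht_eq_0) (auto simp: faithful_representation_def)
qed (rule linearly_disjoint_moebius[OF assms])

end
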